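(* Let $\Gamma=\operatorname{PGL}(3,\mathbb{F}_q[t])$, acting on the Bruhat–Tits building $\mathcal{B}$ of $\operatorname{PGL}(3,\mathbb{F}_q(\!(t^{-1})\!))$, and let $$Z_\Gamma(q^{-s})=\prod_{k=1}^2\ \prod_{c\text{ prime of type }k}\frac{1}{1-w(c)\,q^{-sk\ell(c)}}$$ be its edge zeta function. Then $Z_\Gamma(q^{-s})$ converges for all $s\in\mathbb{C}$ with $\operatorname{Re}s>2$, and it is given by $$Z_{\Gamma}(q^{-s})=\frac{(1-q^{4-3s})^2(1-q^{4-6s})^2}{(1-q^{3-3s})(1-q^{6-3s})(1-q^{3-6s})(1-q^{6-6s})}.$$
   Context: Let $\mathbb{F}_q$ be the finite field with $q$ elements, $F=\mathbb{F}_q(\!(t^{-1})\!)$, $\mathcal{O}=\mathbb{F}_q[\![t^{-1}]\!]$, $\pi=t^{-1}$. Building: the vertices of $\mathcal{B}$ are the homothety classes $[L]$ of rank-3 $\mathcal{O}$-lattices $L\subset F^3$; three vertices form a 2-simplex (chamber) if they have representatives with $\pi L_1\subsetneq L_3\subsetneq L_2\subsetneq L_1$; edges are the pairs of distinct vertices contained in a common chamber. A directed edge $\tilde e$ has source $s(\tilde e)$ and target $t(\tilde e)$. The directed edge $x\to y$ has type 1 (resp. type 2) if there are representatives $L\in x$, $L'\in y$ with $\pi L'\subset L\subset L'$ and $[L':L]=q$ (resp. $q^2$). The group $\operatorname{PGL}(3,F)$ acts on $\mathcal{B}$ by left translation, preserving types. A path $(\tilde e_1,\dots,\tilde e_n)$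 of directed edges (with $t(\tilde e_j)=s(\tilde e_{j+1})$), all of the same type $k$, is geodesic if for each $1\le j\le n-1$ the vertices $s(\tilde e_j),\,t(\tilde e_j)=s(\tilde e_{j+1}),\,t(\tilde e_{j+1})$ do not form a chamber. Quotient and weights: let $X=\Gamma\backslash\mathcal{B}$ and let $\operatorname{E}_k(X)$ be the set of $\Gamma$-orbits of type $k$ directed edges of $\mathcal{B}$; let $p$ denote the projection. For $e,e'\in \operatorname{E}_k(X)$ let $$w(e,e')=\#\{\tilde e'\text{ of type }k\text{ in }\mathcal{B}: p(\tilde e')=e',\ (\tilde e,\tilde e')\text{ is a geodesic path}\},$$ where $\tilde e$ is any lift of $e$ (independent of the choice). Cycles: a closed path of type $k$ and length $n$ is a sequence $(e_1,\dots,e_n)$ in $\operatorname{E}_k(X)$ with $w(e_j,e_{j+1})\neq 0$ for all $j$ modulo $n$ (including the pair $(e_n,e_1)$). A cycle $c$ of type $k$ is an equivalence class of such closed paths under cyclic shift; $\ell(c)=n$ is its length and $w(c)=\prod_{j \bmod n}w(e_j,e_{j+1})$ its weight. A cycle is prime if it is not a proper power (an $m$-fold repetition, $m\ge2$) of a shorter cycle. *)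

theory Defs
  imports "HOL-Analysis.Analysis" "HOL-Computational_Algebra.Computational_Algebra"
begin

text \<open>
  The finite field is a type \<open>'a :: finite_field\<close>, so \<open>q = CARD('a)\<close>.  The field
  \<open>F = \<bbbF>\<^sub>q((t\<^sup>-\<^sup>1))\<close> is \<open>'a fls\<close> with the formal variable of the library read as \<open>t\<^sup>-\<^sup>1\<close>:
  thus \<open>fls_X\<close> is the uniformizer \<open>\<pi> = t\<^sup>-\<^sup>1\<close> and \<open>fls_X_inv\<close> is \<open>t\<close>.
\<close>

definition int_ring :: "'a::field fls set" where
  "int_ring = range fps_to_fls"


section \<open>The building\<close>

definition lattice3 :: "('a::field fls ^ 3) set \<Rightarrow> bool" where
  "lattice3 L \<longleftrightarrow> (\<exists>b :: 3 \<Rightarrow> 'a fls ^ 3. inj b \<and> vec.independent (range b) \<and>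
     L = {\<Sum>i\<in>UNIV. c i *s b i | c. \<forall>i. c i \<in> int_ring})"

definition scale :: "'a::field fls \<Rightarrow> ('a fls ^ 3) set \<Rightarrow> ('a fls ^ 3) set" where
  "scale a L = (\<lambda>v. a *s v) ` L"

type_synonym 'a vertex = "('a fls ^ 3) set set"
type_synonym 'a edge = "'a vertex \<times> 'a vertex"

definition homothety_class :: "('a::field fls ^ 3) set \<Rightarrow> 'a vertex" where
  "homothety_class L = {scale a L | a. a \<noteq> 0}"

definition vertices :: "'a::field vertex set" where
  "vertices = {homothety_class L | L. lattice3 L}"

text \<open>Chambers are unordered: any assignment of the three vertices to \<open>L\<^sub>1\<close>, \<open>L\<^sub>2\<close>, \<open>L\<^sub>3\<close> is allowed.\<close>

definition chamber :: "'a::field vertex set \<Rightarrow> bool" where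
  "chamber C \<longleftrightarrow> (\<exists>x\<in>vertices. \<exists>y\<in>vertices. \<exists>z\<in>vertices. C = {x, y, z} \<and>
     (\<exists>L1\<in>x. \<exists>L2\<in>y. \<exists>L3\<in>z. scale fls_X L1 \<subset> L3 \<and> L3 \<subset> L2 \<and> L2 \<subset> L1))"

text \<open>A directed edge is the pair of its source and its target.\<close>

definition directed_edges :: "'a::field edge set" where
  "directed_edges = {(x, y). x \<noteq> y \<and> (\<exists>C. chamber C \<and> x \<in> C \<and> y \<in> C)}"

definition lattice_index :: "('a::field fls ^ 3) set \<Rightarrow> ('a fls ^ 3) set \<Rightarrow> nat" where
  "lattice_index L' L = card (L' // {(v, w). v \<in> L' \<and> w \<in> L' \<and> v - w \<in> L})"

definition typed_edges :: "nat \<Rightarrow> 'a::finite_field edge set" where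
  "typed_edges k = {(x, y) \<in> directed_edges.
     \<exists>L\<in>x. \<exists>L'\<in>y. scale fls_X L' \<subseteq> L \<and> L \<subseteq> L' \<and> lattice_index L' L = CARD('a) ^ k}"

definition geodesic_path :: "nat \<Rightarrow> 'a::finite_field edge list \<Rightarrow> bool" where
  "geodesic_path k es \<longleftrightarrow> set es \<subseteq> typed_edges k \<and>
     (\<forall>j. Suc j < length es \<longrightarrow> snd (es ! j) = fst (es ! Suc j) \<and>
        \<not> chamber {fst (es ! j), snd (es ! j), snd (es ! Suc j)})"


section \<open>Projective linear groups\<close>

text \<open>An element of \<open>PGL\<close> is a class of invertible matrices modulo multiplication by units.\<close>

definition PGL :: "('r::comm_ring_1 ^ 'n ^ 'n) set set" where
  "PGL = {A. invertible A} //
     {(A, B). invertible A \<and> (\<exists>c. c dvd 1 \<and> B = mat c ** A)}"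

definition poly_to_fls :: "'a::field poly \<Rightarrow> 'a fls" where
  "poly_to_fls p = poly (map_poly fls_const p) fls_X_inv"

text \<open>\<open>PGL(3, \<bbbF>\<^sub>q[t])\<close>, as the subgroup of \<open>PGL(3, F)\<close> onto which it embeds.\<close>

definition PGL3_poly :: "('a::field fls ^ 3 ^ 3) set set" where
  "PGL3_poly = {h \<in> PGL. \<exists>g\<in>(PGL :: ('a poly ^ 3 ^ 3) set set). map_matrix poly_to_fls ` g \<subseteq> h}"

definition act_vertex :: "('a::field fls ^ 3 ^ 3) set \<Rightarrow> 'a vertex \<Rightarrow> 'a vertex" where
  "act_vertex g x = {(\<lambda>v. A *v v) ` L | A L. A \<in> g \<and> L \<in> x}"

definition act_edge :: "('a::field fls ^ 3 ^ 3) set \<Rightarrow> 'a edge \<Rightarrow> 'a edge" where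
  "act_edge g e = (act_vertex g (fst e), act_vertex g (snd e))"


section \<open>The quotient and its cycles\<close>

text \<open>
  In this section \<open>\<Gamma>\<close> stands for a subgroup of \<open>PGL(3, F)\<close>.  Edges of the quotient are orbits,
  as sets of edges of the building, so \<open>p(e) = e'\<close> reads \<open>e \<in> e'\<close>.
\<close>

definition edge_orbits :: "('a::finite_field fls ^ 3 ^ 3) set set \<Rightarrow> nat \<Rightarrow> 'a edge set set" where
  "edge_orbits \<Gamma> k = {{act_edge g e | g. g \<in> \<Gamma>} | e. e \<in> typed_edges k}"

text \<open>
  The weight does not depend on the chosen lift, as \<open>\<Gamma>\<close> acts by automorphisms that preserve
  types.  It is a number of neighbours in a locally finite complex, so the set is finite.
\<close>

definition edge_weight :: "nat \<Rightarrow> 'a::finite_field edge set \<Rightarrow> 'a edge set \<Rightarrow> nat" where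
  "edge_weight k e e' = card {d \<in> e'. geodesic_path k [SOME l. l \<in> e, d]}"

definition closed_paths :: "('a::finite_field fls ^ 3 ^ 3) set set \<Rightarrow> nat \<Rightarrow> 'a edge set list set" where
  "closed_paths \<Gamma> k = {es. es \<noteq> [] \<and> set es \<subseteq> edge_orbits \<Gamma> k \<and>
     (\<forall>j < length es. edge_weight k (es ! j) (es ! (Suc j mod length es)) \<noteq> 0)}"

definition cycles :: "('a::finite_field fls ^ 3 ^ 3) set set \<Rightarrow> nat \<Rightarrow> 'a edge set list set set" where
  "cycles \<Gamma> k = closed_paths \<Gamma> k // {(es, ds). es \<in> closed_paths \<Gamma> k \<and> (\<exists>m. ds = rotate m es)}"

text \<open>Length and weight are invariant under cyclic shift, so any representative will do.\<close>

definition cycle_length :: "'a edge set list set \<Rightarrow> nat" where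
  "cycle_length c = length (SOME es. es \<in> c)"

definition path_weight :: "nat \<Rightarrow> 'a::finite_field edge set list \<Rightarrow> nat" where
  "path_weight k es = (\<Prod>j<length es. edge_weight k (es ! j) (es ! (Suc j mod length es)))"

definition cycle_weight :: "nat \<Rightarrow> 'a::finite_field edge set list set \<Rightarrow> nat" where
  "cycle_weight k c = path_weight k (SOME es. es \<in> c)"

definition prime_cycles :: "('a::finite_field fls ^ 3 ^ 3) set set \<Rightarrow> nat \<Rightarrow> 'a edge set list set set" where
  "prime_cycles \<Gamma> k = {c \<in> cycles \<Gamma> k.
     \<not> (\<exists>m\<ge>2. \<exists>d\<in>cycles \<Gamma> k. \<exists>ds\<in>d. concat (replicate m ds) \<in> c)}"


section \<open>The zeta function\<close>

text \<open>
  Products over an arbitrary index set are limits of the net of finite subproducts, as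
  \<open>has_sum\<close> is for sums.  Convergence asks, as usual for products, for a nonzero limit; over
  \<open>\<complex>\<close> this amounts to absolute convergence with no factor equal to zero.
\<close>

definition has_product :: "('b \<Rightarrow> complex) \<Rightarrow> 'b set \<Rightarrow> complex \<Rightarrow> bool" where
  "has_product f A z \<longleftrightarrow> (prod f \<longlongrightarrow> z) (finite_subsets_at_top A)"

definition product_converges :: "('b \<Rightarrow> complex) \<Rightarrow> 'b set \<Rightarrow> bool" where
  "product_converges f A \<longleftrightarrow> (\<exists>z. z \<noteq> 0 \<and> has_product f A z)"

definition product_over :: "('b \<Rightarrow> complex) \<Rightarrow> 'b set \<Rightarrow> complex" where
  "product_over f A = (THE z. has_product f A z)"

definition euler_factor :: "nat \<Rightarrow> complex \<Rightarrow> 'a::finite_field edge set list set \<Rightarrow> complex" where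
  "euler_factor k u c = 1 / (1 - of_nat (cycle_weight k c) * u ^ (k * cycle_length c))"

text \<open>The argument \<open>u\<close> is \<open>q\<^sup>-\<^sup>s\<close>.\<close>

definition edge_zeta_converges :: "('a::finite_field fls ^ 3 ^ 3) set set \<Rightarrow> complex \<Rightarrow> bool" where
  "edge_zeta_converges \<Gamma> u \<longleftrightarrow> (\<forall>k\<in>{1..2}. product_converges (euler_factor k u) (prime_cycles \<Gamma> k))"

definition edge_zeta :: "('a::finite_field fls ^ 3 ^ 3) set set \<Rightarrow> complex \<Rightarrow> complex" where
  "edge_zeta \<Gamma> u = (\<Prod>k=1..2. product_over (euler_factor k u) (prime_cycles \<Gamma> k))"

end

theory Submission
  imports Defs "HOL-Complex_Analysis.Conformal_Mappings"
begin

text \<open>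
  Write \<open>D = diag(\<pi>, 1, 1)\<close>. A type 1 edge runs from \<open>[A D O^3]\<close> to \<open>[A O^3]\<close> for some \<open>A\<close> in \<open>GL(3, F)\<close>,
  so \<open>\<Gamma>\<close>-orbits of type 1 edges are double cosets of \<open>GL(3, F_q[t])\<close> and a parahoric subgroup modulo
  scalars; by reduction theory they are represented by \<open>diag(t, t^a, t^b)\<close> with \<open>a \<le> b\<close>. The geodesic
  successors of the edge of \<open>A\<close> are the \<open>q^2\<close> edges of \<open>A u D^-1\<close>, where \<open>u\<close> is lower unipotent with
  first column \<open>(1, c, d)\<close> over \<open>F_q\<close>, and moving them back to representatives gives the transition numbers of the
  quotient. Inverse transposition exchanges the two types, so both have the same transition numbers.

  The product over prime cycles is the exponential of the sum of \<open>w(p) z^n / n\<close> over closed paths \<open>p\<close> of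
  length \<open>n\<close>, formally minus the logarithm of the determinant of \<open>1 - z T\<close> for the transition matrix \<open>T\<close>. For
  \<open>z > 0\<close> this sum is evaluated in \<open>[0, \<infinity>]\<close>, where rearrangements are harmless, by eliminating sets of
  vertices that carry no closed path, as in a Schur complement; what remains is a rank-one perturbation
  of a triangular kernel. The identity theorem extends the result to complex \<open>z\<close>.
\<close>

section \<open>Cyclic words\<close>

text \<open>The quotient is infinite, so there is no determinant to expand; sums over closed words
  take its place, and a Schur complement becomes a regrouping of words. The order of elimination
  follows the transitions on the pairs \<open>(a, b)\<close>: the generic step lowers both exponents
  by 1, and only \<open>a \<le> 0\<close> permits a jump back up. Pairs with
  \<open>a \<ge> 1\<close> merely descend a diagonal to \<open>a = 0\<close>, at
  \<open>q^2 z\<close> per step; pairs with \<open>b < 0\<close> descend until a jump. The remaining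
  paths are cut at their visits to the row \<open>b = 0\<close>, with coordinate
  \<open>d = - a\<close>. Between two visits a path either is reset to \<open>a = 0\<close> by a
  jump, and then \<open>d\<close> enters its weight only through \<open>(q^2 z)^d\<close>, or it is
  not, and then \<open>d\<close> strictly grows: these are the rank-one and the triangular part. The
  evaluation closes up because \<open>(q^2 z)^d\<close> is also an eigenvector of the triangular
  part. Each step raises \<open>a + b\<close> by 1 modulo 3, so closed paths have length divisible
  by 3 and only \<open>z^3\<close> occurs in the result. Its factor \<open>1 - q^6 z^3\<close> is
  \<open>1 - (q^2 z)^3\<close>, which is where the bound \<open>Re s > 2\<close> comes from.\<close>

definition cyc :: "('v \<Rightarrow> 'v \<Rightarrow> 'b::comm_semiring_1) \<Rightarrow> 'v list \<Rightarrow> 'b" where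
  "cyc w p = (\<Prod>j<length p. w (p ! j) (p ! (Suc j mod length p)))"

abbreviation lpow :: "nat \<Rightarrow> 'v list \<Rightarrow> 'v list" where
  "lpow m v \<equiv> concat (replicate m v)"

lemma length_lpow [simp]: "length (lpow m v) = m * length v"
  by (induction m) auto

lemma nth_lpow: "j < m * length v \<Longrightarrow> lpow m v ! j = v ! (j mod length v)"
proof (induction m arbitrary: j)
  case (Suc m)
  show ?case
  proof (cases "j < length v")
    case False
    then have "j - length v < m * length v" using Suc.prems by auto
    from Suc.IH[OF this] show ?thesis using False by (simp add: nth_append le_mod_geq)
  qed (simp add: nth_append)
qed simp

lemma cyc_rotate: "cyc w (rotate m p) = cyc w p"
proof (cases "p = []")
  case False
  define n where "n = length p"
  have n: "n > 0" using False by (simp add: n_def)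
  have "cyc w (rotate m p) = (\<Prod>j<n. w (p ! ((m + j) mod n)) (p ! (Suc ((m + j) mod n) mod n)))"
    unfolding cyc_def length_rotate n_def[symmetric]
  proof (rule prod.cong)
    fix j assume "j \<in> {..<n}"
    moreover have "Suc j mod n < n" using n by simp
    moreover have "(m + Suc j mod n) mod n = Suc ((m + j) mod n) mod n"
      by (simp add: mod_simps)
    ultimately show "w (rotate m p ! j) (rotate m p ! (Suc j mod n)) = w (p ! ((m + j) mod n)) (p ! (Suc ((m + j) mod n) mod n))"
      by (simp add: nth_rotate n_def)
  qed simp
  also have "\<dots> = (\<Prod>j<n. w (p ! j) (p ! (Suc j mod n)))"
  proof (rule prod.reindex_bij_betw)
    have "inj_on (\<lambda>j. (m + j) mod n) {..<n}"
    proof (rule inj_onI)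
      have *: "i = j" if "i \<le> j" "j < n" "(m + i) mod n = (m + j) mod n" for i j
      proof -
        have "n dvd (m + j) - (m + i)" using that mod_eq_dvd_iff_nat[of "m + i" "m + j" n] by simp
        then have "n dvd j - i" by simp
        then show ?thesis using that by (auto dest: dvd_imp_le)
      qed
      fix i j assume "i \<in> {..<n}" "j \<in> {..<n}" "(m + i) mod n = (m + j) mod n"
      then show "i = j" using *[of i j] *[of j i] by (cases "i \<le> j") auto
    qed
    moreover have "(\<lambda>j. (m + j) mod n) ` {..<n} \<subseteq> {..<n}" using n by auto
    ultimately show "bij_betw (\<lambda>j. (m + j) mod n) {..<n} {..<n}"
      unfolding bij_betw_def by (simp add: endo_inj_surj)
  qed
  finally show ?thesis by (simp add: cyc_def n_def)
qed (simp add: cyc_def)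

lemma cyc_lpow: "cyc w (lpow m v) = cyc w v ^ m"
proof (cases "v = [] \<or> m = 0")
  case False
  define l where "l = length v"
  have l: "l > 0" "m > 0" using False by (auto simp: l_def)
  have "cyc w (lpow m v) = (\<Prod>j<m * l. w (v ! (j mod l)) (v ! (Suc j mod l)))"
    unfolding cyc_def length_lpow l_def[symmetric]
  proof (rule prod.cong)
    fix j assume j: "j \<in> {..<m * l}"
    have "Suc j mod (m * l) < m * l" using l by simp
    moreover have "Suc j mod (m * l) mod l = Suc j mod l" by (simp add: mod_mult_self2 mod_mod_cancel)
    ultimately show "w (lpow m v ! j) (lpow m v ! (Suc j mod (m * l))) = w (v ! (j mod l)) (v ! (Suc j mod l))"
      using j by (simp add: nth_lpow l_def)
  qed simp
  also have "\<dots> = (\<Prod>i<m. \<Prod>j\<in>{i * l..<i * l + l}. w (v ! (j mod l)) (v ! (Suc j mod l)))"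
    by (rule prod.nat_group[symmetric])
  also have "\<dots> = (\<Prod>i<m. cyc w v)"
  proof (rule prod.cong)
    fix i
    have "(\<Prod>j\<in>{i * l..<i * l + l}. w (v ! (j mod l)) (v ! (Suc j mod l))) =
        (\<Prod>j\<in>{0..<l}. w (v ! ((j + i * l) mod l)) (v ! (Suc (j + i * l) mod l)))"
      using prod.shift_bounds_nat_ivl[of "\<lambda>j. w (v ! (j mod l)) (v ! (Suc j mod l))" 0 "i * l" l] by (simp add: add.commute)
    also have "\<dots> = cyc w v" unfolding cyc_def l_def[symmetric] lessThan_atLeast0
    proof (rule prod.cong)
      fix j assume "j \<in> {0..<l}"
      moreover have "Suc (j + i * l) mod l = Suc j mod l" by (metis add_Suc mod_mult_self1)
      ultimately show "w (v ! ((j + i * l) mod l)) (v ! (Suc (j + i * l) mod l)) = w (v ! j) (v ! (Suc j mod l))" by simp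
    qed simp
    finally show "(\<Prod>j\<in>{i * l..<i * l + l}. w (v ! (j mod l)) (v ! (Suc j mod l))) = cyc w v" .
  qed simp
  finally show ?thesis by simp
qed (auto simp: cyc_def)

lemma rotate_lpow: "rotate i (lpow m v) = lpow m (rotate i v)"
proof (cases "v = [] \<or> m = 0")
  case False
  show ?thesis
  proof (rule nth_equalityI)
    fix j assume "j < length (rotate i (lpow m v))"
    then have j: "j < m * length v" by simp
    have "m * length v > 0" using j by linarith
    then have "(i + j) mod (m * length v) < m * length v" by (rule mod_less_divisor)
    moreover have "(i + j) mod (m * length v) mod length v = (i + j) mod length v"
      by (simp add: mod_mod_cancel)
    moreover have "(i + j mod length v) mod length v = (i + j) mod length v" by (simp add: mod_simps)
    moreover have "j mod length v < length v" using False by simp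
    ultimately show "rotate i (lpow m v) ! j = lpow m (rotate i v) ! j"
      using j by (simp add: nth_rotate nth_lpow)
  qed simp
qed auto

lemma lpow_lpow: "lpow m (lpow k v) = lpow (m * k) v"
  by (induction m) (simp_all add: replicate_add)

section \<open>Periods and primitive roots of words\<close>

definition primitive :: "'v list \<Rightarrow> bool" where
  "primitive p \<longleftrightarrow> p \<noteq> [] \<and> (\<forall>m v. m \<ge> 2 \<longrightarrow> p \<noteq> lpow m v)"

definition period :: "'v list \<Rightarrow> nat" where
  "period p = (LEAST d. d > 0 \<and> rotate d p = p)"

lemma period:
  assumes "p \<noteq> []" shows "period p > 0" "rotate (period p) p = p" "\<And>d. d > 0 \<Longrightarrow> rotate d p = p \<Longrightarrow> period p \<le> d"
proof -
  have "length p > 0 \<and> rotate (length p) p = p" using assms by simp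
  then have "period p > 0 \<and> rotate (period p) p = p" unfolding period_def by (rule LeastI)
  then show "period p > 0" "rotate (period p) p = p" by auto
  show "\<And>d. d > 0 \<Longrightarrow> rotate d p = p \<Longrightarrow> period p \<le> d" unfolding period_def by (auto intro: Least_le)
qed

lemma rotate_mult: "rotate d p = p \<Longrightarrow> rotate (k * d) p = p"
  by (induction k) (simp_all flip: rotate_rotate)

text \<open>Otherwise the remainder of \<open>d\<close> modulo the period would be a smaller
  positive shift that fixes \<open>p\<close>.\<close>

lemma period_dvd: assumes "p \<noteq> []" "rotate d p = p" shows "period p dvd d"
proof (rule ccontr)
  assume "\<not> period p dvd d"
  then have r: "d mod period p > 0" by (simp add: mod_greater_zero_iff_not_dvd)
  have "rotate d p = rotate (d mod period p) (rotate (d div period p * period p) p)"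
    by (simp add: rotate_rotate)
  then have "rotate (d mod period p) p = p" using assms(2) rotate_mult[OF period(2)[OF assms(1)]] by simp
  then have "period p \<le> d mod period p" using period(3)[OF assms(1) r] by simp
  then show False using mod_less_divisor[OF period(1)[OF assms(1)], of d] by simp
qed

text \<open>Invariance under the shift by \<open>d\<close> makes the letter at \<open>j\<close>
  depend only on \<open>j mod d\<close>.\<close>

lemma rotate_period_lpow:
  assumes "p \<noteq> []" "d > 0" "rotate d p = p" "d dvd length p"
  shows "p = lpow (length p div d) (take d p)"
proof (rule nth_equalityI)
  have dl: "d \<le> length p" using assms by (simp add: dvd_imp_le)
  then show l: "length p = length (lpow (length p div d) (take d p))" using assms by simp
  fix j assume j: "j < length p"
  have "rotate (j div d * d) p = p" by (rule rotate_mult[OF assms(3)])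
  then have "p ! (j mod d) = rotate (j div d * d) p ! (j mod d)" by simp
  also have "\<dots> = p ! ((j div d * d + j mod d) mod length p)"
    using j by (intro nth_rotate) (metis le_less_trans mod_less_eq_dividend)
  also have "\<dots> = p ! j" using j by simp
  finally have "p ! j = take d p ! (j mod d)" using assms(2) by simp
  moreover have "length (take d p) = d" using dl by simp
  moreover have "j < length p div d * length (take d p)" using j l by simp
  ultimately show "p ! j = lpow (length p div d) (take d p) ! j" by (metis nth_lpow)
qed

lemma primitive_period: assumes "primitive p" shows "period p = length p"
proof (rule ccontr)
  assume ne: "period p \<noteq> length p"
  have p: "p \<noteq> []" using assms by (simp add: primitive_def)
  have dvd: "period p dvd length p" using period_dvd[OF p] by simp
  then obtain m where m: "length p = m * period p" by (metis dvd_def mult.commute)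
  have "m \<noteq> 0" using m p by (metis length_0_conv mult_0)
  moreover have "m \<noteq> 1" using m ne by auto
  ultimately have "length p div period p \<ge> 2" using m period(1)[OF p] by simp
  moreover have "p = lpow (length p div period p) (take (period p) p)"
    using rotate_period_lpow[OF p period(1,2)[OF p] dvd] .
  ultimately show False using assms unfolding primitive_def by metis
qed

text \<open>The root is the prefix whose length is the least period: if it were a proper power
  itself, \<open>p\<close> would have a smaller period.\<close>

lemma primitive_root: assumes "p \<noteq> []" obtains m u where "m > 0" "primitive u" "p = lpow m u"
proof -
  define u where "u = take (period p) p"
  define m where "m = length p div period p"
  have dvd: "period p dvd length p" using period_dvd[OF assms] by simp
  then have le: "period p \<le> length p" using assms by (simp add: dvd_imp_le)
  have p: "p = lpow m u"
    using rotate_period_lpow[OF assms period(1,2)[OF assms] dvd] by (simp add: u_def m_def)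
  have lu: "length u = period p" using le by (simp add: u_def)
  have "primitive u" unfolding primitive_def
  proof safe
    assume "u = []" then show False using lu period(1)[OF assms] by simp
  next
    fix k v assume k: "2 \<le> k" "u = lpow k v"
    have "rotate (length v) p = p"
      unfolding p k(2) lpow_lpow rotate_lpow by simp
    moreover have "length v > 0" using k lu period(1)[OF assms] by (cases "v = []") auto
    ultimately have "period p \<le> length v" using period(3)[OF assms] by blast
    moreover have "k * length v = period p" using lu k by simp
    ultimately show False using k(1) \<open>length v > 0\<close> by (metis One_nat_def Suc_1 mult_le_cancel2 mult_1 not_less_eq_eq)
  qed
  moreover have "m > 0" using p assms by (cases m) auto
  ultimately show ?thesis using that p by blast
qed

lemma period_lpow: assumes "primitive u" "m > 0" shows "period (lpow m u) = length u"
proof -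
  have u: "u \<noteq> []" using assms by (simp add: primitive_def)
  then have p: "lpow m u \<noteq> []" using assms by simp
  let ?d = "period (lpow m u)"
  have "?d dvd length u" by (rule period_dvd[OF p]) (simp add: rotate_lpow)
  have "lpow m (rotate ?d u) = lpow m u" using period(2)[OF p] by (simp add: rotate_lpow)
  moreover have "take (length u) (lpow m v) = v" if "length v = length u" for v
    using that assms(2) by (cases m) auto
  ultimately have "rotate ?d u = u" by (metis length_rotate)
  then have "period u dvd ?d" by (rule period_dvd[OF u])
  then show ?thesis using \<open>?d dvd length u\<close> primitive_period[OF assms(1)] by (metis dvd_antisym)
qed

text \<open>Root and exponent are both read off the period, which is the length of the root by
  \<open>period_lpow\<close>.\<close>

lemma primitive_root_unique:
  assumes "primitive u" "primitive v" "m > 0" "k > 0" "lpow m u = lpow k v"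
  shows "u = v \<and> m = k"
proof -
  have l: "length u = length v" using period_lpow assms by metis
  have "take (length u) (lpow m u) = u" "take (length u) (lpow k v) = v"
    using assms(3,4) l by (cases m; cases k; simp)+
  then have "u = v" using assms(5) by simp
  moreover have "m * length u = k * length u" using arg_cong[OF assms(5), of length] l by simp
  moreover have "length u > 0" using assms(1) by (simp add: primitive_def)
  ultimately show ?thesis by simp
qed

lemma primitive_rotate: "primitive (rotate i p) \<longleftrightarrow> primitive p"
proof -
  have *: "primitive (rotate i p)" if "primitive p" for i and p :: "'a list"
    unfolding primitive_def
  proof safe
    assume "rotate i p = []" then show False using that by (simp add: primitive_def)
  next
    fix m v assume m: "2 \<le> m" "rotate i p = lpow m v"
    define n where "n = length p"
    \<comment> \<open>Among natural numbers, \<open>n * i - i\<close> plays the role of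
      \<open>- i\<close> modulo \<open>n\<close>; the subtraction is exact since
      \<open>n \<ge> 1\<close>.\<close>
    have "rotate (n * i - i) (rotate i p) = p"
    proof -
      have "n \<ge> 1" using that by (cases p) (auto simp: n_def primitive_def)
      then have "n * i - i + i = n * i" by simp
      then have "rotate (n * i - i) (rotate i p) = rotate (n * i) p" by (simp only: rotate_rotate)
      also have "\<dots> = p" by (simp add: n_def rotate_id)
      finally show ?thesis .
    qed
    then have "p = lpow m (rotate (n * i - i) v)" using m by (simp add: rotate_lpow)
    then show False using that m(1) unfolding primitive_def by blast
  qed
  have "rotate (length p * i - i) (rotate i p) = p" if "p \<noteq> []"
  proof -
    have "length p \<ge> 1" using that by (cases p) auto
    then have "length p * i - i + i = length p * i" by simp
    then show ?thesis by (simp add: rotate_rotate rotate_id)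
  qed
  then show ?thesis using * by (metis rotate_is_Nil_conv)
qed

text \<open>Two equal rotations would give a period below the length. Hence the rotations of a prime
  cycle count separately in the Euler product.\<close>

lemma primitive_rotate_inj:
  assumes "primitive p" "i < length p" "j < length p" "rotate i p = rotate j p" shows "i = j"
proof -
  have *: "i = j" if "i \<le> j" "j < length p" "rotate i p = rotate j p" for i j
  proof (rule ccontr)
    assume "i \<noteq> j"
    have "length p - i + i = length p" using that by simp
    then have "rotate (length p - i) (rotate i p) = p" by (simp only: rotate_rotate) simp
    moreover have "rotate (length p - i) (rotate j p) = rotate (j - i) p"
    proof -
      have e: "length p - i + j = (j - i) + length p" using that by simp
      have "rotate (length p - i) (rotate j p) = rotate (j - i) (rotate (length p) p)"
        by (simp only: rotate_rotate e)
      then show ?thesis by simp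
    qed
    ultimately have "rotate (j - i) p = p" using that by simp
    moreover have "p \<noteq> []" "j - i > 0" using assms(1) that \<open>i \<noteq> j\<close> by (auto simp: primitive_def)
    ultimately have "period p \<le> j - i" using period(3) by blast
    then show False using primitive_period[OF assms(1)] that by simp
  qed
  show ?thesis using *[of i j] *[of j i] assms by (metis nat_le_linear)
qed


section \<open>The Euler product over prime cycles\<close>

lemma path_weight_cyc: "path_weight k p = cyc (edge_weight k) p"
  by (simp add: path_weight_def cyc_def)

lemma closed_paths_iff:
  "p \<in> closed_paths \<Gamma> k \<longleftrightarrow> p \<noteq> [] \<and> set p \<subseteq> edge_orbits \<Gamma> k \<and> path_weight k p \<noteq> 0"
  by (auto simp: closed_paths_def path_weight_def)

lemma closed_paths_rotate: "rotate m p \<in> closed_paths \<Gamma> k \<longleftrightarrow> p \<in> closed_paths \<Gamma> k"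
  by (simp add: closed_paths_iff path_weight_cyc cyc_rotate)

lemma closed_paths_lpow: "m > 0 \<Longrightarrow> lpow m p \<in> closed_paths \<Gamma> k \<longleftrightarrow> p \<in> closed_paths \<Gamma> k"
  by (auto simp: closed_paths_iff path_weight_cyc cyc_lpow)

definition rotations :: "'v list \<Rightarrow> 'v list set" where
  "rotations p = range (\<lambda>m. rotate m p)"

lemma rotate_back: "\<exists>n. rotate n (rotate m p) = p"
proof (cases "p = []")
  case False
  then have "length p \<ge> 1" by (cases p) auto
  then have "length p * m - m + m = length p * m" by simp
  then have "rotate (length p * m - m) (rotate m p) = p" by (simp add: rotate_rotate rotate_id)
  then show ?thesis by blast
qed auto

lemma rotations_rotate: "rotations (rotate m p) = rotations p"
proof -
  obtain n where n: "rotate n (rotate m p) = p" using rotate_back by blast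
  have "rotate i (rotate m p) \<in> rotations p" for i by (simp add: rotations_def rotate_rotate)
  moreover have "rotate i p \<in> rotations (rotate m p)" for i
    using n unfolding rotations_def by (metis rangeI rotate_rotate)
  ultimately show ?thesis unfolding rotations_def by blast
qed

lemma self_rotations: "p \<in> rotations p"
  unfolding rotations_def by (rule range_eqI[of _ _ 0]) simp

lemma cycles_eq: "cycles \<Gamma> k = rotations ` closed_paths \<Gamma> k"
proof -
  have "{(es, ds). es \<in> closed_paths \<Gamma> k \<and> (\<exists>m. ds = rotate m es)} `` {p} = rotations p" if "p \<in> closed_paths \<Gamma> k" for p
    using that by (auto simp: rotations_def)
  then show ?thesis unfolding cycles_def quotient_def by blast
qed

text \<open>The same choice as in \<open>cycle_length\<close> and \<open>cycle_weight\<close>, so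
  that both are attributes of \<open>rep c\<close>.\<close>

definition rep :: "'v list set \<Rightarrow> 'v list" where
  "rep c = (SOME p. p \<in> c)"

lemma rep_cycle:
  assumes "c \<in> cycles \<Gamma> k" shows "rep c \<in> closed_paths \<Gamma> k" "c = rotations (rep c)"
proof -
  obtain p where p: "p \<in> closed_paths \<Gamma> k" "c = rotations p" using assms by (auto simp: cycles_eq)
  have "rep c \<in> c" unfolding rep_def using self_rotations[of p] p by (metis someI)
  then obtain m where "rep c = rotate m p" using p by (auto simp: rotations_def)
  then show "rep c \<in> closed_paths \<Gamma> k" "c = rotations (rep c)"
    using p by (simp_all add: closed_paths_rotate rotations_rotate)
qed

text \<open>Being a proper power survives rotation, and by \<open>closed_paths_lpow\<close> the root
  of a closed path is again a closed path.\<close>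

lemma prime_cycle_iff:
  assumes c: "c \<in> cycles \<Gamma> k" shows "c \<in> prime_cycles \<Gamma> k \<longleftrightarrow> primitive (rep c)"
proof
  assume pr: "c \<in> prime_cycles \<Gamma> k"
  show "primitive (rep c)" unfolding primitive_def
  proof safe
    assume "rep c = []" then show False using rep_cycle[OF c] by (simp add: closed_paths_iff)
  next
    fix m v assume m: "2 \<le> m" "rep c = lpow m v"
    then have "v \<in> closed_paths \<Gamma> k" using rep_cycle(1)[OF c] closed_paths_lpow[of m v] by simp
    then have "rotations v \<in> cycles \<Gamma> k" by (simp add: cycles_eq)
    moreover have "lpow m v \<in> c" using rep_cycle(2)[OF c] self_rotations m by metis
    ultimately show False using pr m self_rotations[of v] unfolding prime_cycles_def by blast
  qed
next
  assume pr: "primitive (rep c)"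
  have "\<not> (\<exists>m\<ge>2. \<exists>d\<in>cycles \<Gamma> k. \<exists>ds\<in>d. lpow m ds \<in> c)"
  proof safe
    fix m d ds assume m: "2 \<le> m" "lpow m ds \<in> c"
    then obtain i where "lpow m ds = rotate i (rep c)" using rep_cycle(2)[OF c] by (auto simp: rotations_def)
    then have "primitive (lpow m ds)" using pr primitive_rotate by metis
    then show False using m(1) unfolding primitive_def by blast
  qed
  then show "c \<in> prime_cycles \<Gamma> k" using c by (simp add: prime_cycles_def)
qed

lemma prime_cycleD:
  assumes "c \<in> prime_cycles \<Gamma> k"
  shows "primitive (rep c)" "rep c \<in> closed_paths \<Gamma> k" "c = rotations (rep c)"
    "cycle_length c = length (rep c)" "cycle_weight k c = path_weight k (rep c)" "cycle_length c > 0"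
proof -
  have c: "c \<in> cycles \<Gamma> k" using assms by (simp add: prime_cycles_def)
  show "primitive (rep c)" using assms prime_cycle_iff[OF c] by blast
  then show "cycle_length c > 0" by (simp add: cycle_length_def primitive_def flip: rep_def)
  show "rep c \<in> closed_paths \<Gamma> k" "c = rotations (rep c)" using rep_cycle[OF c] by auto
  show "cycle_length c = length (rep c)" "cycle_weight k c = path_weight k (rep c)"
    by (simp_all add: cycle_length_def cycle_weight_def rep_def)
qed

text \<open>Surjectivity is the existence of primitive roots; injectivity combines
  \<open>primitive_root_unique\<close> with the distinctness of the rotations of a primitive
  word.\<close>

lemma bij_prime_powers:
  "bij_betw (\<lambda>(c, i, j). lpow j (rotate i (rep c)))
     (SIGMA c:prime_cycles \<Gamma> k. {..<cycle_length c} \<times> {1..}) (closed_paths \<Gamma> k)"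
proof (rule bij_betw_imageI)
  show "inj_on (\<lambda>(c, i, j). lpow j (rotate i (rep c))) (SIGMA c:prime_cycles \<Gamma> k. {..<cycle_length c} \<times> {1..})"
  proof (rule inj_onI, clarsimp)
    fix c i j c' i' j'
    assume c: "c \<in> prime_cycles \<Gamma> k" "i < cycle_length c" "Suc 0 \<le> j"
      and c': "c' \<in> prime_cycles \<Gamma> k" "i' < cycle_length c'" "Suc 0 \<le> j'"
      and eq: "lpow j (rotate i (rep c)) = lpow j' (rotate i' (rep c'))"
    have "rotate i (rep c) = rotate i' (rep c') \<and> j = j'"
      by (rule primitive_root_unique) (use c c' eq prime_cycleD(1)[OF c(1)] prime_cycleD(1)[OF c'(1)] in \<open>auto simp: primitive_rotate\<close>)
    then have r: "rotate i (rep c) = rotate i' (rep c')" "j = j'" by auto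
    then have "c = c'" using prime_cycleD(3) c(1) c'(1) rotations_rotate by metis
    then have "i = i'" using r c(2) c'(2) prime_cycleD(1,4)[OF c(1)] primitive_rotate_inj by metis
    then show "c = c' \<and> i = i' \<and> j = j'" using r \<open>c = c'\<close> by simp
  qed
  show "(\<lambda>(c, i, j). lpow j (rotate i (rep c))) ` (SIGMA c:prime_cycles \<Gamma> k. {..<cycle_length c} \<times> {1..}) = closed_paths \<Gamma> k"
  proof (intro equalityI subsetI)
    fix p assume "p \<in> (\<lambda>(c, i, j). lpow j (rotate i (rep c))) ` (SIGMA c:prime_cycles \<Gamma> k. {..<cycle_length c} \<times> {1..})"
    then show "p \<in> closed_paths \<Gamma> k" using prime_cycleD(2) by (auto simp: closed_paths_lpow closed_paths_rotate)
  next
    fix p assume p: "p \<in> closed_paths \<Gamma> k"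
    then have "p \<noteq> []" by (simp add: closed_paths_iff)
    then obtain m u where u: "m > 0" "primitive u" "p = lpow m u" by (rule primitive_root)
    then have uP: "u \<in> closed_paths \<Gamma> k" using p by (simp add: closed_paths_lpow)
    define c where "c = rotations u"
    have c: "c \<in> cycles \<Gamma> k" using uP by (simp add: c_def cycles_eq)
    obtain i where i: "u = rotate i (rep c)" using rep_cycle(2)[OF c] self_rotations[of u] c_def by (auto simp: rotations_def)
    have "primitive (rep c)" using u(2) i primitive_rotate by metis
    then have pc: "c \<in> prime_cycles \<Gamma> k" using prime_cycle_iff[OF c] by blast
    have "u = rotate (i mod cycle_length c) (rep c)"
      using i rotate_conv_mod prime_cycleD(4)[OF pc] by metis
    then show "p \<in> (\<lambda>(c, i, j). lpow j (rotate i (rep c))) ` (SIGMA c:prime_cycles \<Gamma> k. {..<cycle_length c} \<times> {1..})"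
      using u pc prime_cycleD(6)[OF pc]
      by (intro image_eqI[of _ _ "(c, i mod cycle_length c, m)"]) auto
  qed
qed

lemma has_sum_Ln:
  assumes "norm (y :: complex) < 1"
  shows "((\<lambda>j. y ^ j / of_nat j) has_sum (- Ln (1 - y))) {1..}"
proof -
  have "(\<lambda>n. (-1) ^ Suc n / of_nat n * (- y) ^ n) sums Ln (1 + (- y))"
    using assms by (intro Ln_series) simp
  then have A: "(\<lambda>n. - ((-1) ^ Suc n / of_nat n * (- y) ^ n)) sums - Ln (1 - y)"
    by (auto dest: sums_minus)
  have B: "- ((-1) ^ Suc n / of_nat n * (- y) ^ n) = y ^ n / of_nat n" for n
  proof -
    have "(-1) ^ n * (-1) ^ n = (1 :: complex)" by (simp add: minus_one_power_iff)
    moreover have "- ((-1) ^ Suc n / of_nat n * (- y) ^ n) = ((-1) ^ n * (-1) ^ n) * (y ^ n / of_nat n)"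
      unfolding power_minus[of y n] by simp
    ultimately show ?thesis by simp
  qed
  have s: "(\<lambda>n. y ^ n / of_nat n) sums - Ln (1 - y)" using A unfolding B .
  have "summable (\<lambda>n. norm (y ^ n / of_nat n))"
  proof (rule summable_comparison_test)
    show "summable (\<lambda>n. norm y ^ n)" using assms by (simp add: summable_geometric)
    show "\<exists>N. \<forall>n\<ge>N. norm (norm (y ^ n / of_nat n)) \<le> norm y ^ n"
      by (intro exI[of _ 1]) (auto simp: norm_divide norm_power field_simps
          intro: mult_right_mono[of 1 _ "norm y ^ _", simplified])
  qed
  then have "((\<lambda>j. y ^ j / of_nat j) has_sum (- Ln (1 - y))) UNIV"
    using s by (rule norm_summable_imp_has_sum)
  \<comment> \<open>The index 0 contributes \<open>1 / 0 = 0\<close>.\<close>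
  then show ?thesis
    by (subst has_sum_cong_neutral[where T = UNIV and g = "\<lambda>j. y ^ j / of_nat j"]) (auto simp: not_le)
qed

text \<open>Otherwise the terms dominate \<open>1 / j\<close> and the harmonic series would
  converge. Applied to the powers of one prime cycle, this puts \<open>w(c) z^l\<close> inside the
  disc where the logarithm series converges.\<close>

lemma summable_imp_norm_less_1:
  assumes "(\<lambda>j. r ^ j / of_nat j) summable_on {1::nat..}" "(r::real) \<ge> 0" shows "r < 1"
proof (rule ccontr)
  assume "\<not> r < 1"
  then have "(\<lambda>j. 1 / of_nat j :: real) summable_on {1::nat..}"
    using assms(1) by (intro summable_on_comparison_test[OF assms(1)]) (auto simp: divide_right_mono one_le_power)
  then have "(\<lambda>j. 1 / of_nat j :: real) summable_on UNIV"
    by (subst summable_on_cong_neutral[where T = "{1::nat..}" and g = "\<lambda>j. 1 / of_nat j"]) (auto simp: not_le)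
  then have "summable (\<lambda>j. 1 / of_nat j :: real)" by (rule summable_on_imp_summable)
  then show False using not_summable_harmonic[where 'a = real] by (simp add: inverse_eq_divide)
qed

text \<open>Logarithms turn the product into a sum: by \<open>bij_prime_powers\<close> a prime cycle
  of length \<open>l\<close>, with \<open>y = w(c) z^l\<close>, contributes the terms
  \<open>y^j / (j l)\<close> once for each of its \<open>l\<close> rotations, in total
  \<open>- Ln (1 - y)\<close>. Absolute summability licenses the regrouping.\<close>

lemma euler_product:
  fixes z :: complex and \<Gamma> :: "('a::finite_field fls ^ 3 ^ 3) set set"
  assumes summ: "(\<lambda>p. of_nat (path_weight k p) * norm z ^ length p / of_nat (length p)) summable_on closed_paths \<Gamma> k"
  shows "has_product (\<lambda>c. 1 / (1 - of_nat (cycle_weight k c) * z ^ cycle_length c)) (prime_cycles \<Gamma> k)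
    (exp (\<Sum>\<^sub>\<infinity>p\<in>closed_paths \<Gamma> k. of_nat (path_weight k p) * z ^ length p / of_nat (length p)))"
proof -
  define f where "f p = of_nat (path_weight k p) * z ^ length p / of_nat (length p)" for p :: "'a edge set list"
  define S where "S = infsum f (closed_paths \<Gamma> k)"
  define \<Phi> where "\<Phi> = (\<lambda>(c, i, j). lpow j (rotate i (rep c :: 'a edge set list)))"
  define y where "y c = of_nat (cycle_weight k c) * z ^ cycle_length c" for c :: "'a edge set list set"
  let ?PC = "prime_cycles \<Gamma> k"
  let ?T = "SIGMA c:?PC. {..<cycle_length c} \<times> {1::nat..}"
  have bij: "bij_betw \<Phi> ?T (closed_paths \<Gamma> k)" unfolding \<Phi>_def by (rule bij_prime_powers)
  have nf: "norm (f p) = of_nat (path_weight k p) * norm z ^ length p / of_nat (length p)" for p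
    by (simp add: f_def norm_mult norm_divide norm_power)
  have abs: "(\<lambda>p. norm (f p)) summable_on closed_paths \<Gamma> k" unfolding nf by (rule summ)
  have f\<Phi>: "f (\<Phi> (c, i, j)) = y c ^ j / of_nat j / of_nat (cycle_length c)" if "c \<in> ?PC" for c i j
    using prime_cycleD(4,5)[OF that]
    by (simp add: f_def \<Phi>_def path_weight_cyc cyc_lpow cyc_rotate y_def power_mult_distrib mult.commute flip: power_mult)
  have "(f has_sum S) (closed_paths \<Gamma> k)"
    unfolding S_def by (rule has_sum_infsum, rule abs_summable_summable, rule abs)
  then have hs: "((\<lambda>t. f (\<Phi> t)) has_sum S) ?T" using has_sum_reindex_bij_betw[OF bij] by blast
  have absT: "(\<lambda>t. norm (f (\<Phi> t))) summable_on ?T"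
    using abs summable_on_reindex_bij_betw[OF bij, of "\<lambda>p. norm (f p)"] by blast
  \<comment> \<open>Summability along the powers of the unrotated representative alone already
    forces this.\<close>
  have y1: "norm (y c) < 1" if c: "c \<in> ?PC" for c
  proof -
    have l: "cycle_length c > 0" using prime_cycleD(6)[OF c] .
    have "(\<lambda>t. norm (f (\<Phi> t))) summable_on (\<lambda>j. (c, 0, j)) ` {1..}"
      using l c by (intro summable_on_subset_banach[OF absT]) auto
    then have "(\<lambda>j. norm (f (\<Phi> (c, 0, j)))) summable_on {1..}"
      by (subst (asm) summable_on_reindex) (auto simp: inj_on_def o_def)
    then have "(\<lambda>j. norm (y c) ^ j / of_nat j / of_nat (cycle_length c)) summable_on {1..}"
      using c by (simp add: f\<Phi> norm_divide norm_power norm_mult)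
    then have "(\<lambda>j. norm (y c) ^ j / of_nat j / of_nat (cycle_length c) * of_nat (cycle_length c)) summable_on {1..}"
      by (rule summable_on_cmult_left)
    then have "(\<lambda>j. norm (y c) ^ j / of_nat j) summable_on {1..}" using l by simp
    then show ?thesis by (rule summable_imp_norm_less_1) simp
  qed
  have inner: "((\<lambda>(i, j). f (\<Phi> (c, i, j))) has_sum (- Ln (1 - y c))) ({..<cycle_length c} \<times> {1..})" if c: "c \<in> ?PC" for c
  proof -
    have l: "cycle_length c > 0" using prime_cycleD(6)[OF c] .
    have j: "((\<lambda>j. f (\<Phi> (c, i, j))) has_sum (- Ln (1 - y c) / of_nat (cycle_length c))) {1..}" for i
      unfolding f\<Phi>[OF c] by (intro has_sum_divide_const has_sum_Ln y1 c)
    have "(\<lambda>t. f (\<Phi> t)) summable_on (\<lambda>t. (c, t)) ` ({..<cycle_length c} \<times> {1..})"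
      using c by (intro summable_on_subset_banach[OF has_sum_imp_summable[OF hs]]) auto
    then have "(\<lambda>t. f (\<Phi> (c, t))) summable_on ({..<cycle_length c} \<times> {1..})"
      by (subst (asm) summable_on_reindex) (auto simp: inj_on_def o_def)
    then have s: "((\<lambda>t. f (\<Phi> (c, t))) has_sum infsum (\<lambda>t. f (\<Phi> (c, t))) ({..<cycle_length c} \<times> {1..})) ({..<cycle_length c} \<times> {1..})"
      by (rule has_sum_infsum)
    have "((\<lambda>i. - Ln (1 - y c) / of_nat (cycle_length c)) has_sum infsum (\<lambda>t. f (\<Phi> (c, t))) ({..<cycle_length c} \<times> {1..})) {..<cycle_length c}"
      by (rule has_sum_SigmaD[OF s]) (rule j)
    then have "infsum (\<lambda>t. f (\<Phi> (c, t))) ({..<cycle_length c} \<times> {1..}) = - Ln (1 - y c)"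
      using l has_sum_unique[OF _ has_sum_finite[of "{..<cycle_length c}" "\<lambda>i. - Ln (1 - y c) / of_nat (cycle_length c)"]]
      by fastforce
    then show ?thesis using s by (simp add: case_prod_unfold)
  qed
  have "((\<lambda>c. - Ln (1 - y c)) has_sum S) ?PC"
    by (rule has_sum_SigmaD[OF hs]) (use inner in \<open>simp add: case_prod_unfold\<close>)
  then have lim: "(sum (\<lambda>c. - Ln (1 - y c)) \<longlongrightarrow> S) (finite_subsets_at_top ?PC)" by (simp add: has_sum_def)
  have "((\<lambda>F. exp (sum (\<lambda>c. - Ln (1 - y c)) F)) \<longlongrightarrow> exp S) (finite_subsets_at_top ?PC)"
    by (intro tendsto_exp lim)
  moreover have "\<forall>\<^sub>F F in finite_subsets_at_top ?PC. exp (sum (\<lambda>c. - Ln (1 - y c)) F) = (\<Prod>c\<in>F. 1 / (1 - y c))"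
  proof (rule eventually_finite_subsets_at_top_weakI)
    fix F assume F: "finite F" "F \<subseteq> ?PC"
    have "exp (sum (\<lambda>c. - Ln (1 - y c)) F) = (\<Prod>c\<in>F. exp (- Ln (1 - y c)))" using F by (simp add: exp_sum)
    also have "\<dots> = (\<Prod>c\<in>F. 1 / (1 - y c))"
    proof (rule prod.cong)
      fix c assume "c \<in> F"
      then have "1 - y c \<noteq> 0" using y1 F by force
      then show "exp (- Ln (1 - y c)) = 1 / (1 - y c)" by (simp add: exp_minus field_simps)
    qed simp
    finally show "exp (sum (\<lambda>c. - Ln (1 - y c)) F) = (\<Prod>c\<in>F. 1 / (1 - y c))" .
  qed
  ultimately have "((\<lambda>F. \<Prod>c\<in>F. 1 / (1 - y c)) \<longlongrightarrow> exp S) (finite_subsets_at_top ?PC)"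
    by (rule Lim_transform_eventually)
  then show ?thesis unfolding has_product_def y_def S_def f_def by (simp add: fun_eq_iff)
qed

lemma product_over_eq:
  assumes "has_product f A z" shows "product_over f A = z"
  unfolding product_over_def
proof (rule the_equality)
  show "has_product f A z" by (rule assms)
next
  fix z' assume "has_product f A z'"
  then show "z' = z" using assms tendsto_unique[OF finite_subsets_at_top_neq_bot] unfolding has_product_def by blast
qed


section \<open>Elimination of vertices from sums over closed paths\<close>

abbreviation esum :: "('b \<Rightarrow> ennreal) \<Rightarrow> ennreal" where
  "esum f \<equiv> (\<integral>\<^sup>+x. f x \<partial>count_space UNIV)"

lemma esum_pair: "esum f = esum (\<lambda>x. esum (\<lambda>y. f (x, y)))"
  by (rule nn_integral_fst_count_space[symmetric])

lemma esum_swap: "esum (\<lambda>x. esum (\<lambda>y. f x y)) = esum (\<lambda>y. esum (\<lambda>x. f x y))"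
  using nn_integral_fst_count_space[of "\<lambda>(x, y). f x y"] nn_integral_snd_count_space[of "\<lambda>(x, y). f x y"] by simp

lemma esum_cong: "(\<And>x. f x = g x) \<Longrightarrow> esum f = esum g"
  by simp

lemma esum_bij_betw:
  assumes "bij_betw g A B" "\<And>x. x \<notin> A \<Longrightarrow> f x = 0" "\<And>y. y \<notin> B \<Longrightarrow> h y = 0" "\<And>x. x \<in> A \<Longrightarrow> f x = h (g x)"
  shows "esum f = esum h"
proof -
  have "esum f = (\<integral>\<^sup>+x. f x \<partial>count_space A)"
    by (rule nn_integral_count_space_eq) (use assms in auto)
  also have "\<dots> = (\<integral>\<^sup>+x. h (g x) \<partial>count_space A)"
    by (rule nn_integral_cong) (use assms in auto)
  also have "\<dots> = (\<integral>\<^sup>+x. h x \<partial>count_space B)" by (rule nn_integral_bij_count_space[OF assms(1)])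
  also have "\<dots> = esum h"
    by (rule nn_integral_count_space_eq) (use assms in auto)
  finally show ?thesis .
qed

lemma esum_inj:
  assumes "inj g" "\<And>y. y \<notin> range g \<Longrightarrow> f y = 0" shows "esum f = esum (\<lambda>x. f (g x))"
  by (rule esum_bij_betw[symmetric, of g UNIV "range g"]) (use assms in \<open>auto simp: bij_betw_def\<close>)

lemma esum_cmult: "esum (\<lambda>x. c * f x) = c * esum f"
  by (rule nn_integral_cmult) simp

lemma esum_multc: "esum (\<lambda>x. f x * c) = esum f * c"
  by (rule nn_integral_multc) simp

lemma esum_add: "esum (\<lambda>x. f x + g x) = esum f + esum g"
  by (rule nn_integral_add) simp_all

lemma esum_single:
  assumes "\<And>x. x \<noteq> a \<Longrightarrow> f x = 0" shows "esum f = f a"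
proof -
  have "esum f = (\<integral>\<^sup>+x. f x \<partial>count_space {a})"
    by (rule nn_integral_count_space_eq) (use assms in auto)
  then show ?thesis by (simp add: nn_integral_count_space_finite)
qed

lemma esum_list: "esum f = f [] + esum (\<lambda>x. esum (\<lambda>xs. f (x # xs)))"
proof -
  have "esum f = esum (\<lambda>p. (if p = [] then f p else 0) + (if p \<noteq> [] then f p else 0))" by (rule esum_cong) auto
  also have "\<dots> = esum (\<lambda>p. if p = [] then f p else 0) + esum (\<lambda>p. if p \<noteq> [] then f p else 0)" by (rule esum_add)
  also have "esum (\<lambda>p. if p = [] then f p else 0) = f []" by (subst esum_single[of "[]"]) auto
  also have "esum (\<lambda>p. if p \<noteq> [] then f p else 0) = esum (\<lambda>x. f (fst x # snd x))"
  proof (rule esum_bij_betw[symmetric, of "\<lambda>x. fst x # snd x" UNIV "{p. p \<noteq> []}"])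
    show "bij_betw (\<lambda>x. fst x # snd x) UNIV {p. p \<noteq> []}"
      by (rule bij_betwI[where g = "\<lambda>p. (hd p, tl p)"]) auto
  qed auto
  also have "\<dots> = esum (\<lambda>x. esum (\<lambda>xs. f (x # xs)))" by (subst esum_pair) simp
  finally show ?thesis .
qed

text \<open>The list holds the interior vertices only, so a single edge is the empty list.\<close>

primrec pw :: "('v \<Rightarrow> 'v \<Rightarrow> ennreal) \<Rightarrow> 'v \<Rightarrow> 'v list \<Rightarrow> 'v \<Rightarrow> ennreal" where
  "pw M v [] v' = M v v'"
| "pw M v (y # ys) v' = M v y * pw M y ys v'"

lemma pw_append: "pw M v (a @ r # b) v' = pw M v a r * pw M r b v'"
  by (induction a arbitrary: v) (auto simp: mult.assoc)

lemma pw_prod: "pw M v ys v' = (\<Prod>j<Suc (length ys). M ((v # ys @ [v']) ! j) ((v # ys @ [v']) ! Suc j))"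
proof (induction ys arbitrary: v)
  case (Cons y ys)
  have "(\<Prod>j<Suc (length (y # ys)). M ((v # (y # ys) @ [v']) ! j) ((v # (y # ys) @ [v']) ! Suc j)) =
      M v y * (\<Prod>j<Suc (length ys). M ((y # ys @ [v']) ! j) ((y # ys @ [v']) ! Suc j))"
    by (subst prod.lessThan_Suc_shift) simp
  then show ?case using Cons by simp
qed simp

lemma cyc_Cons: "cyc M (v # ys) = pw M v ys v"
  unfolding pw_prod cyc_def
proof (rule prod.cong)
  fix j assume j: "j \<in> {..<Suc (length ys)}"
  then have "(v # ys) ! j = (v # ys @ [v]) ! j" by (cases j) (auto simp: nth_append)
  moreover have "(v # ys) ! (Suc j mod length (v # ys)) = (v # ys @ [v]) ! Suc j"
    using j by (cases "j = length ys") (auto simp: nth_append)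
  ultimately show "M ((v # ys) ! j) ((v # ys) ! (Suc j mod length (v # ys))) = M ((v # ys @ [v]) ! j) ((v # ys @ [v]) ! Suc j)"
    by simp
qed simp

text \<open>Formally \<open>- log det (1 - M)\<close> on \<open>R\<close>. The empty word is
  harmless because \<open>1 / 0 = 0\<close>.\<close>

definition cycsum :: "'v set \<Rightarrow> ('v \<Rightarrow> 'v \<Rightarrow> ennreal) \<Rightarrow> ennreal" where
  "cycsum R M = esum (\<lambda>p. of_bool (set p \<subseteq> R) * (ennreal (1 / length p) * cyc M p))"

text \<open>For \<open>r\<close>, \<open>r'\<close> outside \<open>Q\<close> an entry of the Schur
  complement \<open>M_RR + M_RQ (1 - M_QQ)^-1 M_QR\<close>, with the inverse written as a Neumann
  series over words in \<open>Q\<close>; in \<open>[0, \<infinity>]\<close> it always makes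
  sense.\<close>

definition kern :: "'v set \<Rightarrow> ('v \<Rightarrow> 'v \<Rightarrow> ennreal) \<Rightarrow> 'v \<Rightarrow> 'v \<Rightarrow> ennreal" where
  "kern Q M r r' = esum (\<lambda>ys. of_bool (set ys \<subseteq> Q) * pw M r ys r')"

text \<open>Split off the first interior vertex.\<close>

lemma kern_rec: "kern Q M y r = M y r + esum (\<lambda>y'. of_bool (y' \<in> Q) * M y y' * kern Q M y' r)"
  unfolding kern_def
  by (subst esum_list) (simp add: mult.assoc esum_cmult of_bool_conj mult.left_commute flip: esum_cmult)

text \<open>Induction on \<open>rs\<close>, cutting \<open>ys\<close> at its first letter in
  \<open>R\<close>: the letters before it lie outside \<open>R\<close> and sum to one entry of the
  kernel.\<close>

lemma pw_filter:
  assumes "set rs \<subseteq> R"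
  shows "esum (\<lambda>ys. of_bool (filter (\<lambda>x. x \<in> R) ys = rs) * pw M v ys v') = pw (kern (- R) M) v rs v'"
  using assms
proof (induction rs arbitrary: v)
  case Nil
  have "filter (\<lambda>x. x \<in> R) ys = [] \<longleftrightarrow> set ys \<subseteq> - R" for ys by (auto simp: filter_empty_conv)
  then show ?case by (simp add: kern_def)
next
  case (Cons r rs)
  let ?F = "filter (\<lambda>x. x \<in> R)"
  have "esum (\<lambda>ys. of_bool (?F ys = r # rs) * pw M v ys v') =
      esum (\<lambda>x. of_bool (set (fst x) \<subseteq> - R \<and> ?F (snd x) = rs) * (pw M v (fst x) r * pw M r (snd x) v'))"
  proof (rule esum_bij_betw[symmetric, of "\<lambda>x. fst x @ r # snd x" "{x. set (fst x) \<subseteq> - R \<and> ?F (snd x) = rs}" "{ys. ?F ys = r # rs}"])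
    show "bij_betw (\<lambda>x. fst x @ r # snd x) {x. set (fst x) \<subseteq> - R \<and> ?F (snd x) = rs} {ys. ?F ys = r # rs}"
    proof (rule bij_betw_imageI)
      show "inj_on (\<lambda>x. fst x @ r # snd x) {x. set (fst x) \<subseteq> - R \<and> ?F (snd x) = rs}"
      proof (rule inj_onI)
        fix x y assume xy: "x \<in> {x. set (fst x) \<subseteq> - R \<and> ?F (snd x) = rs}" "y \<in> {x. set (fst x) \<subseteq> - R \<and> ?F (snd x) = rs}"
          "fst x @ r # snd x = fst y @ r # snd y"
        have r: "r \<in> R" using Cons.prems by simp
        have "takeWhile (\<lambda>z. z \<notin> R) (fst x @ r # snd x) = fst x" using xy(1) r by (subst takeWhile_append2) auto
        moreover have "takeWhile (\<lambda>z. z \<notin> R) (fst y @ r # snd y) = fst y" using xy(2) r by (subst takeWhile_append2) auto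
        ultimately have "fst x = fst y" using xy(3) by simp
        then show "x = y" using xy(3) by (simp add: prod_eq_iff)
      qed
      show "(\<lambda>x. fst x @ r # snd x) ` {x. set (fst x) \<subseteq> - R \<and> ?F (snd x) = rs} = {ys. ?F ys = r # rs}"
      proof (intro equalityI subsetI)
        fix ys assume "ys \<in> (\<lambda>x. fst x @ r # snd x) ` {x. set (fst x) \<subseteq> - R \<and> ?F (snd x) = rs}"
        then show "ys \<in> {ys. ?F ys = r # rs}" using Cons.prems by (auto simp: filter_empty_conv)
      next
        fix ys assume "ys \<in> {ys. ?F ys = r # rs}"
        then obtain us vs where "ys = us @ r # vs" "\<forall>u\<in>set us. u \<notin> R" "?F vs = rs"
          by (auto simp: filter_eq_Cons_iff)
        then show "ys \<in> (\<lambda>x. fst x @ r # snd x) ` {x. set (fst x) \<subseteq> - R \<and> ?F (snd x) = rs}"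
          by (intro image_eqI[of _ _ "(us, vs)"]) auto
      qed
    qed
  qed (use Cons.prems in \<open>auto simp: pw_append filter_empty_conv\<close>)
  also have "\<dots> = esum (\<lambda>a. esum (\<lambda>b. (of_bool (set a \<subseteq> - R) * pw M v a r) * (of_bool (?F b = rs) * pw M r b v')))"
    by (subst esum_pair) (simp add: of_bool_conj mult_ac)
  also have "\<dots> = kern (- R) M v r * esum (\<lambda>b. of_bool (?F b = rs) * pw M r b v')"
    by (simp add: esum_cmult esum_multc kern_def)
  also have "\<dots> = pw (kern (- R) M) v (r # rs) v'" using Cons by simp
  finally show ?case .
qed

lemma esum_rotate: "esum (\<lambda>p. f (rotate i p)) = esum f"
proof -
  have "bij (rotate i :: 'a list \<Rightarrow> _)"
  proof (rule bijI')
    fix x y :: "'a list" show "(rotate i x = rotate i y) = (x = y)"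
    proof
      assume e: "rotate i x = rotate i y"
      then have "length x = length y" by (metis length_rotate)
      have "x = y" if "rotate1 x = rotate1 y" for x y :: "'a list"
        using that by (cases x; cases y) auto
      then have "inj (rotate1 :: 'a list \<Rightarrow> _)" by (rule injI)
      then have "inj (rotate i :: 'a list \<Rightarrow> _)" unfolding rotate_def by (rule inj_fn)
      then show "x = y" using e by (rule injD)
    qed simp
  next
    fix y :: "'a list"
    obtain n where n: "rotate n (rotate i y) = y" using rotate_back by blast
    have "rotate i (rotate n y) = rotate n (rotate i y)" by (simp add: rotate_rotate add.commute)
    then show "\<exists>x. y = rotate i x" using n by metis
  qed
  then show ?thesis by (intro esum_bij_betw[of "rotate i" UNIV UNIV]) auto
qed

lemma ennreal_inverse_mult: "n > 0 \<Longrightarrow> of_nat n * (ennreal (1 / real n) * c) = c"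
  by (simp add: ennreal_of_nat_eq_real_of_nat mult.assoc[symmetric] ennreal_mult[symmetric])

text \<open>Each closed path that meets \<open>R\<close> is rotated to start at one of its visits to \<open>R\<close>; the
  factor \<open>1 / length\<close> then turns into \<open>1 / number of visits\<close>.\<close>

lemma cycsum_eliminate:
  fixes R :: "'v set"
  shows "cycsum UNIV M = cycsum (- R) M + cycsum R (kern (- R) M)"
proof -
  let ?F = "filter (\<lambda>x. x \<in> R)"
  define k where "k p = length (?F p)" for p
  define G where "G p = ennreal (1 / length p) * cyc M p" for p
  have kpos: "k p > 0 \<longleftrightarrow> \<not> set p \<subseteq> - R" for p by (auto simp: k_def filter_empty_conv)
  have kcard: "(\<Sum>i<length p. of_bool (p ! i \<in> R)) = (of_nat (k p) :: ennreal)" for p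
  proof -
    have "k p = card {i. i < length p \<and> p ! i \<in> R}" unfolding k_def by (rule length_filter_conv_card)
    also have "{i. i < length p \<and> p ! i \<in> R} = {i\<in>{..<length p}. p ! i \<in> R}" by auto
    finally show ?thesis by (simp add: of_bool_def sum.If_cases Int_def)
  qed
  have krot: "k (rotate i p) = k p" for i p
  proof -
    have "mset (rotate i p) = mset p" by (metis mset_append append_take_drop_id rotate_drop_take union_commute)
    then have "size (filter_mset (\<lambda>x. x \<in> R) (mset (rotate i p))) = size (filter_mset (\<lambda>x. x \<in> R) (mset p))" by simp
    then show ?thesis unfolding k_def by (simp flip: mset_filter)
  qed
  have "cycsum UNIV M = esum (\<lambda>p. of_bool (set p \<subseteq> - R) * G p + of_bool (k p > 0) * G p)"
    unfolding cycsum_def kpos by (intro esum_cong) (auto simp: G_def)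
  also have "\<dots> = cycsum (- R) M + esum (\<lambda>p. of_bool (k p > 0) * G p)"
    by (subst esum_add) (simp add: cycsum_def G_def)
  also have "esum (\<lambda>p. of_bool (k p > 0) * G p) =
      esum (\<lambda>p. esum (\<lambda>i. of_bool (i < length p \<and> p ! i \<in> R) * (ennreal (1 / k p) * G p)))"
  proof (rule esum_cong)
    fix p
    have "esum (\<lambda>i. of_bool (i < length p \<and> p ! i \<in> R) * (ennreal (1 / k p) * G p)) =
        esum (\<lambda>i. of_bool (i < length p \<and> p ! i \<in> R)) * (ennreal (1 / k p) * G p)" by (rule esum_multc)
    also have "esum (\<lambda>i. of_bool (i < length p \<and> p ! i \<in> R)) = (\<integral>\<^sup>+i. of_bool (p ! i \<in> R) \<partial>count_space {..<length p})"
      by (subst nn_integral_count_space_indicator) (auto intro!: nn_integral_cong simp: indicator_def of_bool_def)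
    also have "\<dots> = of_nat (k p)" by (simp add: nn_integral_count_space_finite kcard)
    also have "of_nat (k p) * (ennreal (1 / k p) * G p) = of_bool (k p > 0) * G p"
      by (cases "k p > 0") (simp_all add: ennreal_inverse_mult)
    finally show "of_bool (k p > 0) * G p = esum (\<lambda>i. of_bool (i < length p \<and> p ! i \<in> R) * (ennreal (1 / k p) * G p))" by simp
  qed
  also have "\<dots> = esum (\<lambda>i. esum (\<lambda>p. of_bool (i < length p \<and> p ! i \<in> R) * (ennreal (1 / k p) * G p)))"
    by (rule esum_swap)
  also have "\<dots> = esum (\<lambda>i. esum (\<lambda>p. of_bool (i < length p \<and> hd p \<in> R) * (ennreal (1 / k p) * G p)))"
  proof (rule esum_cong)
    fix i
    have "esum (\<lambda>p. of_bool (i < length p \<and> p ! i \<in> R) * (ennreal (1 / k p) * G p)) =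
       esum (\<lambda>p. (\<lambda>p. of_bool (i < length p \<and> hd p \<in> R) * (ennreal (1 / k p) * G p)) (rotate i p))"
    proof (rule esum_cong)
      fix p :: "'v list"
      have "i < length p \<Longrightarrow> hd (rotate i p) = p ! i" by (subst hd_rotate_conv_nth) auto
      then show "of_bool (i < length p \<and> p ! i \<in> R) * (ennreal (1 / k p) * G p) =
        (\<lambda>p. of_bool (i < length p \<and> hd p \<in> R) * (ennreal (1 / k p) * G p)) (rotate i p)"
        by (cases "i < length p") (simp_all add: krot G_def cyc_rotate)
    qed
    then show "esum (\<lambda>p. of_bool (i < length p \<and> p ! i \<in> R) * (ennreal (1 / k p) * G p)) =
       esum (\<lambda>p. of_bool (i < length p \<and> hd p \<in> R) * (ennreal (1 / k p) * G p))"
      by (simp only: esum_rotate[of "\<lambda>p. of_bool (i < length p \<and> hd p \<in> R) * (ennreal (1 / k p) * G p)"])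
  qed
  also have "\<dots> = esum (\<lambda>p. esum (\<lambda>i. of_bool (i < length p \<and> hd p \<in> R) * (ennreal (1 / k p) * G p)))"
    by (rule esum_swap)
  also have "\<dots> = esum (\<lambda>p. of_bool (p \<noteq> [] \<and> hd p \<in> R) * (ennreal (1 / k p) * cyc M p))"
  proof (rule esum_cong)
    fix p
    have "esum (\<lambda>i. of_bool (i < length p \<and> hd p \<in> R) * (ennreal (1 / k p) * G p)) =
        esum (\<lambda>i. of_bool (i < length p \<and> hd p \<in> R)) * (ennreal (1 / k p) * G p)" by (rule esum_multc)
    also have "esum (\<lambda>i. of_bool (i < length p \<and> hd p \<in> R)) = (\<integral>\<^sup>+i. of_bool (hd p \<in> R) \<partial>count_space {..<length p})"
      by (subst nn_integral_count_space_indicator) (auto intro!: nn_integral_cong simp: indicator_def of_bool_def)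
    also have "\<dots> = of_nat (length p) * of_bool (hd p \<in> R)" by (simp add: nn_integral_count_space_finite)
    also have "of_nat (length p) * of_bool (hd p \<in> R) * (ennreal (1 / k p) * G p) =
       of_bool (p \<noteq> [] \<and> hd p \<in> R) * (ennreal (1 / k p) * cyc M p)"
    proof (cases "p = []")
      case False
      then have "of_nat (length p) * G p = cyc M p" unfolding G_def by (intro ennreal_inverse_mult) simp
      then have "of_nat (length p) * (ennreal (1 / k p) * G p) = ennreal (1 / k p) * cyc M p"
        unfolding mult.left_commute[of "of_nat (length p)"] by simp
      then show ?thesis using False by (cases "hd p \<in> R") simp_all
    qed simp
    finally show "esum (\<lambda>i. of_bool (i < length p \<and> hd p \<in> R) * (ennreal (1 / k p) * G p)) =
       of_bool (p \<noteq> [] \<and> hd p \<in> R) * (ennreal (1 / k p) * cyc M p)" .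
  qed
  also have "\<dots> = esum (\<lambda>v. esum (\<lambda>ys. of_bool (v \<in> R) * (ennreal (1 / Suc (k ys)) * pw M v ys v)))"
    by (subst esum_list) (auto intro!: esum_cong simp: k_def cyc_Cons)
  \<comment> \<open>Words are grouped by the list \<open>rs\<close> of their later visits to
    \<open>R\<close>; the stretches between consecutive visits sum to kernel entries.\<close>
  also have "\<dots> = esum (\<lambda>v. esum (\<lambda>rs. of_bool (set (v # rs) \<subseteq> R) * (ennreal (1 / length (v # rs)) * cyc (kern (- R) M) (v # rs))))"
  proof (rule esum_cong)
    fix v
    have "esum (\<lambda>ys. of_bool (v \<in> R) * (ennreal (1 / Suc (k ys)) * pw M v ys v)) =
      esum (\<lambda>ys. esum (\<lambda>rs. of_bool (?F ys = rs) * (of_bool (v \<in> R) * (ennreal (1 / Suc (length rs)) * pw M v ys v))))"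
    proof (rule esum_cong)
      fix ys
      show "of_bool (v \<in> R) * (ennreal (1 / Suc (k ys)) * pw M v ys v) =
        esum (\<lambda>rs. of_bool (?F ys = rs) * (of_bool (v \<in> R) * (ennreal (1 / Suc (length rs)) * pw M v ys v)))"
        by (subst esum_single[of "?F ys"]) (auto simp: k_def)
    qed
    also have "\<dots> = esum (\<lambda>rs. esum (\<lambda>ys. of_bool (?F ys = rs) * (of_bool (v \<in> R) * (ennreal (1 / Suc (length rs)) * pw M v ys v))))"
      by (rule esum_swap)
    also have "\<dots> = esum (\<lambda>rs. of_bool (set (v # rs) \<subseteq> R) * (ennreal (1 / length (v # rs)) * cyc (kern (- R) M) (v # rs)))"
    proof (rule esum_cong)
      fix rs
      have "esum (\<lambda>ys. of_bool (?F ys = rs) * (of_bool (v \<in> R) * (ennreal (1 / Suc (length rs)) * pw M v ys v))) =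
        (of_bool (v \<in> R) * ennreal (1 / Suc (length rs))) * esum (\<lambda>ys. of_bool (?F ys = rs) * pw M v ys v)"
        by (subst esum_cmult[symmetric]) (simp only: mult_ac)
      also have "\<dots> = of_bool (set (v # rs) \<subseteq> R) * (ennreal (1 / length (v # rs)) * cyc (kern (- R) M) (v # rs))"
      proof (cases "set rs \<subseteq> R")
        case True
        then show ?thesis by (simp add: pw_filter cyc_Cons mult.assoc)
      next
        case False
        then have "?F ys \<noteq> rs" for ys by auto
        then show ?thesis using False by simp
      qed
      finally show "esum (\<lambda>ys. of_bool (?F ys = rs) * (of_bool (v \<in> R) * (ennreal (1 / Suc (length rs)) * pw M v ys v))) =
        of_bool (set (v # rs) \<subseteq> R) * (ennreal (1 / length (v # rs)) * cyc (kern (- R) M) (v # rs))" .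
    qed
    finally show "esum (\<lambda>ys. of_bool (v \<in> R) * (ennreal (1 / Suc (k ys)) * pw M v ys v)) =
      esum (\<lambda>rs. of_bool (set (v # rs) \<subseteq> R) * (ennreal (1 / length (v # rs)) * cyc (kern (- R) M) (v # rs)))" .
  qed
  also have "\<dots> = cycsum R (kern (- R) M)"
    unfolding cycsum_def by (subst (2) esum_list) simp
  finally show ?thesis .
qed

text \<open>Going around once would make \<open>f\<close> exceed itself. This discards the first
  summand of \<open>cycsum_eliminate\<close> whenever each edge between eliminated vertices raises
  some height.\<close>

lemma cycsum_acyclic:
  fixes f :: "'v \<Rightarrow> int"
  assumes "\<And>y y'. y \<in> Q \<Longrightarrow> y' \<in> Q \<Longrightarrow> M y y' \<noteq> 0 \<Longrightarrow> f y < f y'"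
  shows "cycsum Q M = 0"
proof -
  have "of_bool (set p \<subseteq> Q) * (ennreal (1 / length p) * cyc M p) = 0" for p
  proof (rule ccontr)
    assume "\<not> ?thesis"
    then have p: "set p \<subseteq> Q" "p \<noteq> []" "cyc M p \<noteq> 0" by (auto split: if_splits)
    define n where "n = length p"
    have n: "n > 0" using p by (simp add: n_def)
    have less: "f (p ! j) < f (p ! (Suc j mod n))" if "j < n" for j
      using that p n by (intro assms) (auto simp: cyc_def n_def subset_iff)
    have "f (p ! 0) + int j \<le> f (p ! j)" if "j < n" for j
      using that
    proof (induction j)
      case (Suc j)
      then show ?case using less[of j] by simp
    qed simp
    from this[of "n - 1"] have "f (p ! 0) \<le> f (p ! (n - 1))" using n by simp
    moreover have "f (p ! (n - 1)) < f (p ! 0)" using less[of "n - 1"] n by simp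
    ultimately show False by simp
  qed
  then show ?thesis unfolding cycsum_def by (simp only: nn_integral_const mult_zero_left)
qed

lemma cycsum_reindex:
  assumes bij: "bij_betw g A B" and M: "\<And>x y. x \<in> A \<Longrightarrow> y \<in> A \<Longrightarrow> M' (g x) (g y) = M x y"
  shows "cycsum B M' = cycsum A M"
  unfolding cycsum_def
proof (rule esum_bij_betw[symmetric, of "map g" "lists A" "lists B"])
  show "bij_betw (map g) (lists A) (lists B)" using bij by (rule bij_lists)
  fix p assume p: "p \<in> lists A"
  then have "set (map g p) \<subseteq> B" "set p \<subseteq> A" using bij by (auto simp: bij_betw_def)
  moreover have "cyc M' (map g p) = cyc M p" unfolding cyc_def length_map
  proof (rule prod.cong)
    fix j assume "j \<in> {..<length p}"
    moreover from this have "Suc j mod length p < length p" by (intro mod_less_divisor) auto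
    ultimately show "M' (map g p ! j) (map g p ! (Suc j mod length p)) = M (p ! j) (p ! (Suc j mod length p))"
      using p M by (auto simp: lists_eq_set subset_iff)
  qed simp
  ultimately show "of_bool (set p \<subseteq> A) * (ennreal (1 / length p) * cyc M p) =
      of_bool (set (map g p) \<subseteq> B) * (ennreal (1 / length (map g p)) * cyc M' (map g p))" by simp
qed (auto simp: lists_eq_set)

lemma cycsum_cong:
  "(\<And>x y. x \<in> A \<Longrightarrow> y \<in> A \<Longrightarrow> M' x y = M x y) \<Longrightarrow> cycsum A M' = cycsum A M"
  by (rule cycsum_reindex[of id]) auto


section \<open>Integral matrices and lattices\<close>

lemma int_ring_iff: "f \<in> int_ring \<longleftrightarrow> (\<forall>i<0. fls_nth f i = 0)"
proof
  assume "f \<in> int_ring" then show "\<forall>i<0. fls_nth f i = 0"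
    by (auto simp: int_ring_def)
next
  assume *: "\<forall>i<0. fls_nth f i = 0"
  have "f = fps_to_fls (fls_regpart f)"
    using * by (intro fls_eqI) (auto simp: fps_to_fls_nth)
  then show "f \<in> int_ring" unfolding int_ring_def by blast
qed

lemma int_ring_subdegree: "f \<in> int_ring \<longleftrightarrow> f = 0 \<or> fls_subdegree f \<ge> 0"
  by (metis fls_eq0_below_subdegree fls_subdegree_geI fls_zero_nth int_ring_iff linorder_not_less nth_fls_subdegree_nonzero order_less_le_trans)

lemma int_ring_0 [simp]: "0 \<in> int_ring" and int_ring_1 [simp]: "1 \<in> int_ring"
  by (auto simp: int_ring_subdegree)

lemma int_ring_add: "f \<in> int_ring \<Longrightarrow> g \<in> int_ring \<Longrightarrow> f + g \<in> int_ring"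
  and int_ring_diff: "f \<in> int_ring \<Longrightarrow> g \<in> int_ring \<Longrightarrow> f - g \<in> int_ring"
  and int_ring_uminus: "f \<in> int_ring \<Longrightarrow> - f \<in> int_ring"
  by (auto simp: int_ring_iff)

lemma int_ring_mult: "f \<in> int_ring \<Longrightarrow> g \<in> int_ring \<Longrightarrow> f * g \<in> int_ring"
  by (auto simp: int_ring_def fls_times_fps_to_fls[symmetric])

lemma int_ring_const [simp]: "fls_const c \<in> int_ring"
  by (auto simp: int_ring_iff)

lemma int_ring_X [simp]: "fls_X \<in> int_ring"
  by (auto simp: int_ring_subdegree)

section \<open>Polynomials and powers of \<open>t\<close> inside the field\<close>

definition pol_ring :: "'a::field fls set" where
  "pol_ring = range poly_to_fls"

lemma poly_to_fls_pCons: "poly_to_fls (pCons a p) = fls_const a + fls_X_inv * poly_to_fls p"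
  by (cases "a = 0 \<and> p = 0") (auto simp: poly_to_fls_def map_poly_pCons)

lemma poly_to_fls_0 [simp]: "poly_to_fls 0 = 0"
  by (simp add: poly_to_fls_def)

lemma poly_to_fls_1 [simp]: "poly_to_fls 1 = 1"
  by (simp add: poly_to_fls_def map_poly_1)

lemma poly_to_fls_add: "poly_to_fls (p + q) = poly_to_fls p + poly_to_fls q"
  by (induction p q rule: poly_induct2)
    (auto simp: poly_to_fls_pCons algebra_simps simp flip: fls_plus_const)

lemma poly_to_fls_smult: "poly_to_fls (smult a p) = fls_const a * poly_to_fls p"
  by (induction p) (auto simp: poly_to_fls_pCons algebra_simps simp flip: fls_const_mult_const)

lemma poly_to_fls_mult: "poly_to_fls (p * q) = poly_to_fls p * poly_to_fls q"
  by (induction p)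
    (auto simp: poly_to_fls_pCons poly_to_fls_add poly_to_fls_smult algebra_simps)

lemma fls_nth_poly_to_fls: "fls_nth (poly_to_fls p) i = (if i > 0 then 0 else coeff p (nat (- i)))"
proof (induction p arbitrary: i)
  case (pCons a p)
  show ?case
  proof (cases "i < 0")
    case True
    then have "nat (- i) = Suc (nat (- (i + 1)))" by auto
    then show ?thesis using True pCons by (auto simp: poly_to_fls_pCons fls_X_inv_times_conv_shift)
  qed (use pCons in \<open>auto simp: poly_to_fls_pCons fls_X_inv_times_conv_shift\<close>)
qed auto

text \<open>The series variable is \<open>t^-1\<close>, so polynomials in \<open>t\<close> occupy
  the exponents at most 0, opposite to \<open>int_ring\<close>.\<close>

lemma pol_ring_iff: "f \<in> pol_ring \<longleftrightarrow> (\<forall>i>0. fls_nth f i = 0)"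
proof
  assume "f \<in> pol_ring" then show "\<forall>i>0. fls_nth f i = 0"
    by (auto simp: pol_ring_def fls_nth_poly_to_fls)
next
  assume *: "\<forall>i>0. fls_nth f i = 0"
  define p where "p = Abs_poly (\<lambda>n. fls_nth f (- int n))"
  have c: "coeff p n = fls_nth f (- int n)" for n
  proof -
    have "\<forall>n>nat (- fls_subdegree f). fls_nth f (- int n) = 0"
      by (auto intro!: fls_eq0_below_subdegree)
    then show ?thesis unfolding p_def
      by (subst coeff_Abs_poly[of "nat (- fls_subdegree f)"]) blast+
  qed
  have "f = poly_to_fls p"
    using * by (intro fls_eqI) (auto simp: fls_nth_poly_to_fls c)
  then show "f \<in> pol_ring" by (auto simp: pol_ring_def)
qed

lemma pol_ring_subdegree: "f \<in> pol_ring \<Longrightarrow> f \<noteq> 0 \<Longrightarrow> fls_subdegree f \<le> 0"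
  by (meson linorder_not_le nth_fls_subdegree_nonzero pol_ring_iff)

lemma pol_ring_0 [simp]: "0 \<in> pol_ring" and pol_ring_1 [simp]: "1 \<in> pol_ring"
  by (auto simp: pol_ring_iff)

lemma pol_ring_add: "f \<in> pol_ring \<Longrightarrow> g \<in> pol_ring \<Longrightarrow> f + g \<in> pol_ring"
  and pol_ring_diff: "f \<in> pol_ring \<Longrightarrow> g \<in> pol_ring \<Longrightarrow> f - g \<in> pol_ring"
  and pol_ring_uminus: "f \<in> pol_ring \<Longrightarrow> - f \<in> pol_ring"
  by (auto simp: pol_ring_iff)

lemma pol_ring_mult: "f \<in> pol_ring \<Longrightarrow> g \<in> pol_ring \<Longrightarrow> f * g \<in> pol_ring"
  unfolding pol_ring_def by (metis (no_types, lifting) imageE poly_to_fls_mult rangeI)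

lemma pol_ring_const [simp]: "fls_const c \<in> pol_ring"
  by (auto simp: pol_ring_iff)

unbundle no Formal_Power_Series.fps_syntax

type_synonym 'a mat3 = "'a fls ^ 3 ^ 3"

definition tpow :: "int \<Rightarrow> 'a::field fls" where
  "tpow n = fls_X powi (- n)"

lemma tpow_shift: "tpow n = (fls_shift n 1 :: 'a::field fls)"
  by (simp add: tpow_def)

lemma tpow_nonzero [simp]: "tpow n \<noteq> (0 :: 'a::field fls)"
  using fls_X_intpow_nonzero[of "- n"] by (simp add: tpow_shift)

lemma tpow_0 [simp]: "tpow 0 = (1 :: 'a::field fls)"
  by (simp add: tpow_def)

lemma tpow_neg1 [simp]: "tpow (- 1) = (fls_X :: 'a::field fls)"
  by (simp add: tpow_def del: fls_X_power_int)

lemma tpow_1: "tpow 1 = (fls_X_inv :: 'a::field fls)"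
  by (simp add: tpow_shift fls_X_inv_conv_shift_1)

lemma tpow_add: "tpow (m + n) = tpow m * (tpow n :: 'a::field fls)"
  using fls_X_intpow_times_fls_X_intpow[of "- m" "- n", where 'a='a] by (simp add: tpow_shift add.commute)

lemma tpow_mult_assoc: "tpow m * (tpow n * f) = tpow (m + n) * (f :: 'a::field fls)"
  by (simp add: tpow_add mult.assoc)

lemma subdegree_tpow [simp]: "fls_subdegree (tpow n :: 'a::field fls) = - n"
  using fls_subdegree_fls_X_intpow[of "- n"] by (simp add: tpow_shift)

lemma fls_nth_tpow: "fls_nth (tpow n :: 'a::field fls) i = (if i = - n then 1 else 0)"
  by (auto simp: tpow_shift)

lemma tpow_int_ring: "n \<le> 0 \<Longrightarrow> tpow n \<in> int_ring"
  by (simp add: int_ring_subdegree)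

lemma tpow_pol_ring: "n \<ge> 0 \<Longrightarrow> tpow n \<in> pol_ring"
  by (auto simp: pol_ring_iff fls_nth_tpow)

section \<open>Explicit matrices of size 3\<close>

definition m3 :: "'b \<Rightarrow> 'b \<Rightarrow> 'b \<Rightarrow> 'b \<Rightarrow> 'b \<Rightarrow> 'b \<Rightarrow> 'b \<Rightarrow> 'b \<Rightarrow> 'b \<Rightarrow> 'b::zero ^ 3 ^ 3" where
  "m3 a b c d e f g h i = vector [vector [a, b, c], vector [d, e, f], vector [g, h, i]]"

lemma m3_nth [simp]:
  "m3 a b c d e f g h i $ 1 $ 1 = a" "m3 a b c d e f g h i $ 1 $ 2 = b" "m3 a b c d e f g h i $ 1 $ 3 = c"
  "m3 a b c d e f g h i $ 2 $ 1 = d" "m3 a b c d e f g h i $ 2 $ 2 = e" "m3 a b c d e f g h i $ 2 $ 3 = f"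
  "m3 a b c d e f g h i $ 3 $ 1 = g" "m3 a b c d e f g h i $ 3 $ 2 = h" "m3 a b c d e f g h i $ 3 $ 3 = i"
  by (simp_all add: m3_def)

lemma m3_eta: "A = m3 (A$1$1) (A$1$2) (A$1$3) (A$2$1) (A$2$2) (A$2$3) (A$3$1) (A$3$2) (A$3$3)"
  by (simp add: vec_eq_iff forall_3)

lemma m3_eq_iff [simp]: "m3 a b c d e f g h i = m3 a' b' c' d' e' f' g' h' i' \<longleftrightarrow>
    a = a' \<and> b = b' \<and> c = c' \<and> d = d' \<and> e = e' \<and> f = f' \<and> g = g' \<and> h = h' \<and> i = i'"
  by (auto simp add: vec_eq_iff forall_3)

lemma m3_mult: "m3 a b c d e f g h i ** m3 a' b' c' d' e' f' g' h' (i'::'b::semiring_1) =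
   m3 (a*a'+b*d'+c*g') (a*b'+b*e'+c*h') (a*c'+b*f'+c*i')
      (d*a'+e*d'+f*g') (d*b'+e*e'+f*h') (d*c'+e*f'+f*i')
      (g*a'+h*d'+i*g') (g*b'+h*e'+i*h') (g*c'+h*f'+i*i')"
  by (simp add: vec_eq_iff forall_3 matrix_matrix_mult_def sum_3)

lemma mat_m3: "mat c = m3 c 0 0 0 c 0 0 0 (c::'b::zero)"
  by (simp add: vec_eq_iff forall_3 mat_def)

lemma transpose_m3: "transpose (m3 a b c d e f g h i) = m3 a d g b e h c f i"
  by (simp add: vec_eq_iff forall_3 transpose_def)

lemma det_m3: "det (m3 a b c d e f g h i) = a*e*i + b*f*g + c*d*h - a*f*h - b*d*i - c*e*(g::'b::comm_ring_1)"
  by (simp add: det_3)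

lemma mat_mult_commute: "mat s ** A = A ** mat s" for A :: "'b::comm_semiring_1^'n^'n"
  by (simp add: vec_eq_iff matrix_matrix_mult_def mat_def if_distrib if_distribR mult.commute cong: if_cong)

lemma mat_mult_nth [simp]: "(mat s ** A) $ i $ j = s * A $ i $ j" for A :: "'b::comm_semiring_1^'n^'n"
  by (simp add: matrix_matrix_mult_def mat_def if_distrib if_distribR cong: if_cong)

lemma mat_mult_mat: "mat a ** mat b = (mat (a * b) :: 'b::comm_semiring_1^'n^'n)"
proof -
  have "(mat a ** mat b) $ i $ j = (mat (a * b) :: 'b^'n^'n) $ i $ j" for i j
    by (subst mat_mult_nth) (simp add: mat_def)
  then show ?thesis by (simp only: vec_eq_iff) blast
qed

lemma det_mat3: "det (mat s :: 'b::comm_ring_1^3^3) = s^3"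
  by (simp add: mat_m3 det_m3 power3_eq_cube)

definition adj3 :: "'b::comm_ring_1^3^3 \<Rightarrow> 'b^3^3" where
  "adj3 A = m3 (A$2$2*A$3$3 - A$2$3*A$3$2) (A$1$3*A$3$2 - A$1$2*A$3$3) (A$1$2*A$2$3 - A$1$3*A$2$2)
               (A$2$3*A$3$1 - A$2$1*A$3$3) (A$1$1*A$3$3 - A$1$3*A$3$1) (A$1$3*A$2$1 - A$1$1*A$2$3)
               (A$2$1*A$3$2 - A$2$2*A$3$1) (A$1$2*A$3$1 - A$1$1*A$3$2) (A$1$1*A$2$2 - A$1$2*A$2$1)"

lemma adj3: "A ** adj3 A = mat (det A)" "adj3 A ** A = mat (det A)"
  by (simp_all add: vec_eq_iff forall_3 matrix_matrix_mult_def sum_3 adj3_def mat_def det_3 algebra_simps)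

text \<open>\<open>S\<close> is a subset of the field rather than a type, so that matrices over
  \<open>int_ring\<close> and over \<open>pol_ring\<close> have one type and can be
  multiplied.\<close>

definition GL :: "'b::comm_semiring_1 set \<Rightarrow> ('b^'n^'n) set" where
  "GL S = {A. (\<forall>i j. A$i$j \<in> S) \<and> (\<exists>B. (\<forall>i j. B$i$j \<in> S) \<and> A ** B = mat 1 \<and> B ** A = mat 1)}"

locale subring_set =
  fixes S :: "'a::field fls set"
  assumes S0 [simp]: "0 \<in> S" and S1 [simp]: "1 \<in> S"
    and Sadd: "\<And>x y. x \<in> S \<Longrightarrow> y \<in> S \<Longrightarrow> x + y \<in> S"
    and Smult: "\<And>x y. x \<in> S \<Longrightarrow> y \<in> S \<Longrightarrow> x * y \<in> S"
    and Sdiff: "\<And>x y. x \<in> S \<Longrightarrow> y \<in> S \<Longrightarrow> x - y \<in> S"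
begin

lemma Ssum: "(\<And>i. i \<in> I \<Longrightarrow> f i \<in> S) \<Longrightarrow> sum f I \<in> S"
  by (induction I rule: infinite_finite_induct) (auto intro: Sadd)

lemma entries_mult: "(\<And>i j. A$i$j \<in> S) \<Longrightarrow> (\<And>i j. B$i$j \<in> S) \<Longrightarrow> (A ** B)$i$j \<in> S"
  for A B :: "'a fls ^ 'n ^ 'n"
  by (auto simp: matrix_matrix_mult_def intro!: Ssum Smult)

lemma GL_mult: "A \<in> GL S \<Longrightarrow> B \<in> GL S \<Longrightarrow> A ** B \<in> GL S" for A B :: "'a fls ^ 'n ^ 'n"
proof -
  assume "A \<in> GL S" "B \<in> GL S"
  then obtain A' B' where
    A: "\<And>i j. A$i$j \<in> S" "\<And>i j. A'$i$j \<in> S" "A ** A' = mat 1" "A' ** A = mat 1" and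
    B: "\<And>i j. B$i$j \<in> S" "\<And>i j. B'$i$j \<in> S" "B ** B' = mat 1" "B' ** B = mat 1"
    unfolding GL_def by auto
  have "A ** B ** (B' ** A') = A ** (B ** B') ** A'" "B' ** A' ** (A ** B) = B' ** (A' ** A) ** B"
    by (simp_all add: matrix_mul_assoc)
  then have "A ** B ** (B' ** A') = mat 1" "B' ** A' ** (A ** B) = mat 1"
    using A B by simp_all
  then show ?thesis unfolding GL_def using entries_mult A B by blast
qed

lemma GL_one: "mat 1 \<in> (GL S :: ('a fls ^ 'n ^ 'n) set)"
proof -
  have "mat 1 $ i $ j \<in> S" for i j :: 'n by (simp add: mat_def)
  then show ?thesis unfolding GL_def by (auto intro!: exI[of _ "mat 1"])
qed

lemma det_in: "(\<And>i j. A$i$j \<in> S) \<Longrightarrow> det (A :: 'a mat3) \<in> S"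
  by (auto simp: det_3 intro!: Sadd Sdiff Smult)

lemma GL_det: assumes "A \<in> GL S" shows "det (A :: 'a mat3) \<in> S" "det A \<noteq> 0" "inverse (det A) \<in> S"
proof -
  obtain B where A: "\<And>i j. A$i$j \<in> S" "\<And>i j. B$i$j \<in> S" "A ** B = mat 1"
    using assms unfolding GL_def by auto
  then have "det A * det B = 1" by (metis det_I det_mul)
  then show "det (A :: 'a mat3) \<in> S" "det A \<noteq> 0" "inverse (det A) \<in> S"
    using A det_in inverse_unique by (force+)
qed

lemma GL_detI:
  assumes A: "\<And>i j. A$i$j \<in> S" and "det (A :: 'a mat3) \<noteq> 0" "inverse (det A) \<in> S"
  shows "A \<in> GL S"
proof -
  define B where "B = mat (inverse (det A)) ** adj3 A"
  have "A ** B = mat 1" "B ** A = mat 1"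
    using assms adj3[of A] unfolding B_def
    by (metis (no_types, lifting) mat_mult_commute matrix_mul_assoc mat_mult_mat left_inverse right_inverse)+
  moreover have "B$i$j \<in> S" for i j
    using assms exhaust_3[of i] exhaust_3[of j] unfolding B_def
    by (auto simp: adj3_def intro!: Smult Sdiff)
  ultimately show ?thesis using A unfolding GL_def by blast
qed

end

lemma GL_inverse:
  assumes "A \<in> GL S" obtains B where "B \<in> GL S" "A ** B = mat 1" "B ** A = mat 1"
  using assms unfolding GL_def by blast

lemma GL_transpose:
  assumes "A \<in> GL (S :: 'b::comm_ring_1 set)" shows "transpose A \<in> GL S"
proof -
  obtain B where A: "\<forall>i j. A$i$j \<in> S" "\<forall>i j. B$i$j \<in> S" "A ** B = mat 1" "B ** A = mat 1"
    using assms unfolding GL_def by auto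
  then have "transpose A ** transpose B = mat 1" "transpose B ** transpose A = mat 1"
    by (simp_all add: transpose_mat flip: matrix_transpose_mul)
  moreover have "\<forall>i j. transpose A$i$j \<in> S" "\<forall>i j. transpose B$i$j \<in> S"
    using A by (auto simp: transpose_def)
  ultimately show ?thesis unfolding GL_def by auto
qed

lemma GL_invertible: "A \<in> GL S \<Longrightarrow> invertible A"
  unfolding GL_def invertible_def by auto

interpretation ir: subring_set int_ring
  by unfold_locales (auto intro: int_ring_add int_ring_mult int_ring_diff)

interpretation pr: subring_set pol_ring
  by unfold_locales (auto intro: pol_ring_add pol_ring_mult pol_ring_diff)

lemma GL_int_ring_detI:
  assumes "\<And>i j. A$i$j \<in> int_ring" "det (A :: 'a::field mat3) \<noteq> 0" "fls_subdegree (det A) = 0"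
  shows "A \<in> GL int_ring"
  using assms by (intro ir.GL_detI) (auto simp: int_ring_subdegree fls_inverse_subdegree)

lemma GL_int_ring_det:
  assumes "A \<in> GL int_ring" shows "fls_subdegree (det (A :: 'a::field mat3)) = 0" "det A \<noteq> 0"
  using ir.GL_det[OF assms] by (auto simp: int_ring_subdegree fls_inverse_subdegree)

text \<open>The determinant and its inverse are both polynomials, so both valuations are at most 0,
  and they add up to 0.\<close>

lemma GL_pol_ring_det:
  assumes "A \<in> GL pol_ring" shows "fls_subdegree (det (A :: 'a::field mat3)) = 0" "det A \<noteq> 0"
proof -
  show nz: "det A \<noteq> 0" using pr.GL_det[OF assms] by blast
  have "fls_subdegree (det A) \<le> 0" "fls_subdegree (inverse (det A)) \<le> 0"
    using pr.GL_det[OF assms] pol_ring_subdegree nonzero_imp_inverse_nonzero by blast+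
  then show "fls_subdegree (det A) = 0" by (simp add: fls_inverse_subdegree)
qed

definition inv3 :: "'b::field^3^3 \<Rightarrow> 'b^3^3" where
  "inv3 A = mat (inverse (det A)) ** adj3 A"

lemma inv3:
  assumes "invertible A"
  shows inv3_right [simp]: "A ** inv3 A = mat 1" and inv3_left [simp]: "inv3 A ** A = mat 1"
proof -
  have "det A \<noteq> 0" using assms by (simp add: invertible_det_nz)
  then show "A ** inv3 A = mat 1" "inv3 A ** A = mat 1"
    using adj3[of A] unfolding inv3_def
    by (metis (no_types, lifting) mat_mult_commute matrix_mul_assoc mat_mult_mat left_inverse right_inverse)+
qed

lemma inv3_invertible: "invertible A \<Longrightarrow> invertible (inv3 A)"
  using inv3 unfolding invertible_def by blast

lemma inv3_unique: "A ** B = mat 1 \<Longrightarrow> inv3 A = B" for A :: "'b::field^3^3"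
  by (metis inv3_left invertible_right_inverse matrix_mul_assoc matrix_mul_lid matrix_mul_rid)

lemma inv3_cancel [simp]: assumes "invertible (A :: 'b::field^3^3)"
  shows "inv3 A ** (A ** B) = B" "A ** (inv3 A ** B) = B" "B ** A ** inv3 A = B" "B ** inv3 A ** A = B"
  using assms by (metis inv3 matrix_mul_assoc matrix_mul_lid matrix_mul_rid)+

lemma inv3_GL: "A \<in> GL S \<Longrightarrow> inv3 A \<in> GL S" for A :: "'b::field^3^3"
  by (metis GL_inverse inv3_unique)

lemma inv3_mult: "invertible A \<Longrightarrow> invertible B \<Longrightarrow> inv3 (A ** B) = inv3 B ** inv3 A"
  for A :: "'b::field^3^3"
  by (intro inv3_unique) (metis inv3_cancel(3) inv3_right matrix_mul_assoc)

lemma inv3_inv3 [simp]: "invertible A \<Longrightarrow> inv3 (inv3 A) = A" for A :: "'b::field^3^3"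
  by (intro inv3_unique) simp

lemma invertible_mat3: "s \<noteq> 0 \<Longrightarrow> invertible (mat s :: 'b::field^3^3)"
  by (simp add: invertible_det_nz det_mat3)

lemma inv3_mat: "s \<noteq> 0 \<Longrightarrow> inv3 (mat s) = mat (inverse s)" for s :: "'b::field"
  by (intro inv3_unique) (simp add: mat_mult_mat)

lemma inv3_transpose: "invertible A \<Longrightarrow> inv3 (transpose A) = transpose (inv3 A)" for A :: "'b::field^3^3"
  by (intro inv3_unique) (metis inv3_left matrix_transpose_mul transpose_mat)

section \<open>Lattices \<open>A O^3\<close> and vertices of the building\<close>

definition O3 :: "('a::field fls ^ 3) set" where
  "O3 = {v. \<forall>i. v $ i \<in> int_ring}"

definition lat :: "'a::field mat3 \<Rightarrow> ('a fls ^ 3) set" where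
  "lat A = (\<lambda>v. A *v v) ` O3"

abbreviation vx :: "'a::field mat3 \<Rightarrow> 'a vertex" where
  "vx A \<equiv> homothety_class (lat A)"

abbreviation "K \<equiv> GL int_ring :: 'a::field mat3 set"

lemma O3_mult: "(\<And>i j. A$i$j \<in> int_ring) \<Longrightarrow> v \<in> O3 \<Longrightarrow> A *v v \<in> O3"
  by (auto simp: O3_def matrix_vector_mult_def intro!: ir.Ssum int_ring_mult)

lemma axis_O3: "axis i 1 \<in> O3"
  by (auto simp: O3_def axis_def)

lemma image_lat: "(\<lambda>v. A *v v) ` lat B = lat (A ** B)"
  by (auto simp: lat_def image_image matrix_vector_mul_assoc)

lemma mem_lat: "invertible A \<Longrightarrow> v \<in> lat A \<longleftrightarrow> inv3 A *v v \<in> O3"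
  unfolding lat_def
  by (metis (no_types, lifting) image_iff inv3_left inv3_right matrix_vector_mul_assoc matrix_vector_mul_lid)

lemma mult_axis_nth: "(A *v axis j 1) $ i = A $ i $ j" for A :: "'b::semiring_1 ^ 'n ^ 'm"
  by (simp add: matrix_vector_mult_def axis_def if_distrib cong: if_cong)

text \<open>Inclusion needs testing on the unit vectors only, that is, on the columns of
  \<open>A\<close>.\<close>

lemma lat_subset_iff:
  assumes "invertible B"
  shows "lat A \<subseteq> lat B \<longleftrightarrow> (\<forall>i j. (inv3 B ** A)$i$j \<in> int_ring)"
proof
  assume "lat A \<subseteq> lat B"
  then have "A *v axis j 1 \<in> lat B" for j
    using axis_O3 by (auto simp: lat_def[of A])
  then have "inv3 B *v (A *v axis j 1) \<in> O3" for j
    using mem_lat[OF assms] by blast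
  then show "\<forall>i j. (inv3 B ** A)$i$j \<in> int_ring"
    by (auto simp: matrix_vector_mul_assoc O3_def mult_axis_nth)
next
  assume "\<forall>i j. (inv3 B ** A)$i$j \<in> int_ring"
  then show "lat A \<subseteq> lat B"
    using O3_mult[of "inv3 B ** A"] by (auto simp: lat_def[of A] mem_lat[OF assms] matrix_vector_mul_assoc)
qed

lemma lat_eq_iff:
  assumes "invertible A" "invertible B"
  shows "lat A = lat B \<longleftrightarrow> inv3 B ** A \<in> K"
proof -
  have "inv3 (inv3 B ** A) = inv3 A ** B"
    using assms by (simp add: inv3_mult inv3_invertible)
  moreover have "lat A = lat B \<longleftrightarrow> lat A \<subseteq> lat B \<and> lat B \<subseteq> lat A" by auto
  moreover have "invertible (inv3 B ** A)"
    using assms by (simp add: inv3_invertible invertible_mult)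
  ultimately show ?thesis
    unfolding lat_subset_iff[OF assms(1)] lat_subset_iff[OF assms(2)] GL_def
    by (auto simp: ) (metis inv3_left inv3_right inv3_unique)+
qed

lemma lat_mult_K: assumes "invertible A" "k \<in> K" shows "lat (A ** k) = lat A"
  using assms by (subst lat_eq_iff) (auto intro: invertible_mult GL_invertible)

lemma scale_lat: "scale s (lat A) = lat (mat s ** A)"
proof -
  have "s *s v = mat s *v v" for v :: "'a fls ^ 3"
    by (simp add: vec_eq_iff matrix_vector_mult_def mat_def if_distrib if_distribR cong: if_cong)
  then show ?thesis unfolding scale_def image_lat[symmetric] by simp
qed

text \<open>Injectivity matters: independence speaks of the set \<open>range b\<close>, which does
  not see repetitions.\<close>

lemma columns_invertible:
  fixes b :: "3 \<Rightarrow> 'b::field ^ 3"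
  shows "inj b \<and> vec.independent (range b) \<longleftrightarrow> invertible (\<chi> i j. b j $ i)"
proof -
  let ?A = "(\<chi> i j. b j $ i)"
  have col: "column j ?A = b j" for j by (simp add: column_def vec_eq_iff)
  have "invertible ?A \<longleftrightarrow> (\<forall>c. (\<Sum>i\<in>UNIV. c i *s b i) = 0 \<longrightarrow> (\<forall>i. c i = 0))"
    using matrix_left_invertible_independent_columns[of ?A]
    by (simp add: col invertible_left_inverse)
  also have "\<dots> \<longleftrightarrow> inj b \<and> vec.independent (range b)"
  proof safe
    assume *: "\<forall>c. (\<Sum>i\<in>UNIV. c i *s b i) = 0 \<longrightarrow> (\<forall>i. c i = 0)"
    show inj: "inj b"
    proof (rule injI, rule ccontr)
      fix x y assume xy: "b x = b y" "x \<noteq> y"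
      define c where "c = (\<lambda>i. if i = x then 1 else if i = y then -1 else (0::'b))"
      have "(\<Sum>i\<in>UNIV. c i *s b i) = (\<Sum>i\<in>{x,y}. c i *s b i)"
        by (rule sum.mono_neutral_right) (auto simp: c_def)
      also have "\<dots> = 0" using xy by (auto simp: c_def)
      finally have "c x = 0" using * by blast
      then show False by (simp add: c_def)
    qed
    assume "vec.dependent (range b)"
    then obtain u where u: "\<exists>v\<in>range b. u v \<noteq> 0" "(\<Sum>v\<in>range b. u v *s v) = 0"
      by (auto simp: vec.dependent_finite)
    then have "(\<Sum>i\<in>UNIV. u (b i) *s b i) = 0"
      by (subst (asm) sum.reindex[OF inj]) simp
    then show False using u * by auto
  next
    fix c i assume inj: "inj b" and ind: "vec.independent (range b)" and s: "(\<Sum>i\<in>UNIV. c i *s b i) = 0"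
    have "(\<Sum>v\<in>range b. c (inv b v) *s v) = 0"
      using s by (subst sum.reindex[OF inj]) (simp add: inj)
    then have "\<forall>v\<in>range b. c (inv b v) = 0"
      using ind vec.dependent_finite[of "range b"] by auto
    then show "c i = 0" using inj by simp
  qed
  finally show ?thesis by simp
qed

lemma lattice3_iff: "lattice3 L \<longleftrightarrow> (\<exists>A. invertible A \<and> L = lat A)"
proof -
  have eq: "{\<Sum>i\<in>UNIV. c i *s b i | c. \<forall>i. c i \<in> int_ring} = lat (\<chi> i j. b j $ i)"
    for b :: "3 \<Rightarrow> 'a fls ^ 3"
  proof -
    have "(\<chi> i j. b j $ i) *v v = (\<Sum>i\<in>UNIV. v $ i *s b i)" for v
      by (simp add: matrix_mult_sum column_def)
    then have "lat (\<chi> i j. b j $ i) = {\<Sum>i\<in>UNIV. v $ i *s b i | v. v \<in> O3}"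
      by (auto simp: lat_def)
    also have "\<dots> = {\<Sum>i\<in>UNIV. c i *s b i | c. \<forall>i. c i \<in> int_ring}"
    proof (intro equalityI subsetI; clarify)
      fix v :: "'a fls ^ 3" assume "v \<in> O3"
      then show "\<exists>c. (\<Sum>i\<in>UNIV. v $ i *s b i) = (\<Sum>i\<in>UNIV. c i *s b i) \<and> (\<forall>i. c i \<in> int_ring)"
        by (intro exI[of _ "\<lambda>i. v $ i"]) (auto simp: O3_def)
    next
      fix c :: "3 \<Rightarrow> 'a fls" assume "\<forall>i. c i \<in> int_ring"
      then show "\<exists>v. (\<Sum>i\<in>UNIV. c i *s b i) = (\<Sum>i\<in>UNIV. v $ i *s b i) \<and> v \<in> O3"
        by (intro exI[of _ "\<chi> i. c i"]) (auto simp: O3_def)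
    qed
    finally show ?thesis by simp
  qed
  show ?thesis
  proof
    assume "lattice3 L"
    then show "\<exists>A. invertible A \<and> L = lat A"
      unfolding lattice3_def eq using columns_invertible by blast
  next
    assume "\<exists>A. invertible A \<and> L = lat A"
    then obtain A where A: "invertible A" "L = lat A" by blast
    have "A = (\<chi> i j. (\<lambda>j. column j A) j $ i)" by (simp add: column_def vec_eq_iff)
    then show "lattice3 L" unfolding lattice3_def eq
      using A columns_invertible[of "\<lambda>j. column j A"] by metis
  qed
qed

lemma mem_vx: "L \<in> vx A \<longleftrightarrow> (\<exists>s. s \<noteq> 0 \<and> L = lat (mat s ** A))"
  by (auto simp: homothety_class_def scale_lat)

lemma vertices_eq: "vertices = {vx A | A. invertible A}"
  by (auto simp: vertices_def lattice3_iff)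

lemma invertible_mat_mult: "s \<noteq> 0 \<Longrightarrow> invertible A \<Longrightarrow> invertible (mat s ** A)" for A :: "'a::field fls^3^3"
  by (intro invertible_mult invertible_mat3)

lemma vx_mat: "s \<noteq> 0 \<Longrightarrow> vx (mat s ** A) = vx A"
proof -
  assume s: "s \<noteq> 0"
  have "L \<in> vx (mat s ** A) \<longleftrightarrow> L \<in> vx A" for L
  proof
    assume "L \<in> vx (mat s ** A)"
    then obtain r where "r \<noteq> 0" "L = lat (mat (r * s) ** A)"
      by (auto simp: mem_vx matrix_mul_assoc mat_mult_mat)
    then show "L \<in> vx A"
      using s unfolding mem_vx by (intro exI[of _ "r * s"]) auto
  next
    assume "L \<in> vx A"
    then obtain r where r: "r \<noteq> 0" "L = lat (mat r ** A)" by (auto simp: mem_vx)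
    have "mat r ** A = mat (r / s) ** (mat s ** A)"
      using s by (simp add: matrix_mul_assoc mat_mult_mat)
    then show "L \<in> vx (mat s ** A)"
      using r s unfolding mem_vx by (intro exI[of _ "r / s"]) auto
  qed
  then show ?thesis by blast
qed

lemma vx_K: "invertible A \<Longrightarrow> k \<in> K \<Longrightarrow> vx (A ** k) = vx A"
  by (simp add: lat_mult_K)

text \<open>Identifies the vertices with the cosets \<open>GL(3, F) / F^* K\<close>.\<close>

lemma vx_eq_iff:
  assumes "invertible A" "invertible B"
  shows "vx A = vx B \<longleftrightarrow> (\<exists>s k. s \<noteq> 0 \<and> k \<in> K \<and> A = mat s ** B ** k)"
proof
  assume "vx A = vx B"
  moreover have "lat A \<in> vx A" unfolding mem_vx by (intro exI[of _ 1]) simp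
  ultimately obtain s where s: "s \<noteq> 0" "lat A = lat (mat s ** B)" by (auto simp: mem_vx)
  have inv: "invertible (mat s ** B)" using s assms by (simp add: invertible_mat_mult)
  then have "inv3 (mat s ** B) ** A \<in> K" using s assms lat_eq_iff by blast
  moreover have "A = mat s ** B ** (inv3 (mat s ** B) ** A)" using inv by simp
  ultimately show "\<exists>s k. s \<noteq> 0 \<and> k \<in> K \<and> A = mat s ** B ** k" using s by blast
next
  assume "\<exists>s k. s \<noteq> 0 \<and> k \<in> K \<and> A = mat s ** B ** k"
  then obtain s k where "s \<noteq> 0" "k \<in> K" "A = mat s ** B ** k" by blast
  then show "vx A = vx B" using assms by (simp add: vx_K vx_mat invertible_mat_mult)
qed

lemma vx_in_vertices: "invertible A \<Longrightarrow> vx A \<in> vertices"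
  by (auto simp: vertices_eq)

lemma lat_in_vx: "lat A \<in> vx A"
  unfolding mem_vx by (intro exI[of _ 1]) simp

text \<open>A chamber is a periodic chain of lattices, so any two of its vertices can be scaled into
  this relation, in either order. Its use is negative: it fails for the outer vertices of a geodesic
  pair.\<close>

lemma chamber_adjacent:
  assumes "chamber C" "vx A \<in> C" "vx B \<in> C"
  shows "\<exists>s. s \<noteq> 0 \<and> lat (mat fls_X ** B) \<subseteq> lat (mat s ** A) \<and> lat (mat s ** A) \<subseteq> lat B"
proof -
  have mono: "scale a L \<subseteq> scale a M" if "L \<subseteq> M" for a :: "'a fls" and L M using that by (auto simp: scale_def)
  have sm: "scale a (scale b L) = scale (a * b) L" for a b :: "'a fls" and L
    by (auto simp: scale_def image_image vector_smult_assoc)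
  have s1: "scale 1 L = L" for L :: "('a fls ^ 3) set" by (simp add: scale_def)
  obtain x y z L1 L2 L3 where C: "C = {x,y,z}"
    and L: "L1 \<in> x" "L2 \<in> y" "L3 \<in> z" "scale fls_X L1 \<subset> L3" "L3 \<subset> L2" "L2 \<subset> L1"
    using assms(1) unfolding chamber_def by metis
  define R where "R = (\<lambda>M N. scale fls_X N \<subseteq> M \<and> M \<subseteq> (N :: ('a fls ^ 3) set))"
  have "R L3 L1" "R L2 L1" "R L3 L2"
    using L mono[of L2 L1 fls_X] unfolding R_def by blast+
  moreover have X: "scale fls_X L1 \<subseteq> L1" "scale fls_X L2 \<subseteq> L2" "scale fls_X L3 \<subseteq> L3"
    using L mono[of L2 L1 fls_X] mono[of L3 L2 fls_X] by blast+
  then have "R L1 L1" "R L2 L2" "R L3 L3" by (auto simp: R_def)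
  moreover have rep: "\<exists>s. s \<noteq> 0 \<and> M = scale s (lat A)" if "M \<in> vx A" for A and M :: "('a fls^3) set"
    using that by (auto simp: mem_vx scale_lat)
  moreover obtain M where "M \<in> {L1, L2, L3}" "M \<in> vx A"
    using assms(2) C L by blast
  moreover obtain N where "N \<in> {L1, L2, L3}" "N \<in> vx B"
    using assms(3) C L by blast
  ultimately obtain a b where ab: "a \<noteq> 0" "b \<noteq> 0" "R (scale a (lat A)) (scale b (lat B)) \<or> R (scale b (lat B)) (scale a (lat A))"
    by (smt (verit) insertE singletonD)
  have "\<exists>a b. a \<noteq> 0 \<and> b \<noteq> 0 \<and> R (scale a (lat A)) (scale b (lat B))"
  proof (cases "R (scale a (lat A)) (scale b (lat B))")
    case False
    then have "R (scale b (lat B)) (scale a (lat A))" using ab by blast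
    \<comment> \<open>Multiplying the larger lattice by the uniformizer reverses the
      relation.\<close>
    then have "R (scale fls_X (scale a (lat A))) (scale b (lat B))"
      using mono[of "scale b (lat B)" "scale a (lat A)" fls_X] by (auto simp: R_def)
    then show ?thesis using ab(1,2) by (intro exI[of _ "fls_X * a"] exI[of _ b]) (simp add: sm)
  qed (use ab in blast)
  then have "\<exists>a b. a \<noteq> 0 \<and> b \<noteq> 0 \<and> scale fls_X (scale b (lat B)) \<subseteq> scale a (lat A) \<and> scale a (lat A) \<subseteq> scale b (lat B)"
    unfolding R_def .
  then obtain a b where ab: "a \<noteq> 0" "b \<noteq> 0" "scale fls_X (scale b (lat B)) \<subseteq> scale a (lat A)"
    "scale a (lat A) \<subseteq> scale b (lat B)" by blast
  show ?thesis
    using mono[OF ab(3), of "inverse b"] mono[OF ab(4), of "inverse b"] ab(1,2)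
    by (intro exI[of _ "inverse b * a"]) (simp add: sm s1 scale_lat[symmetric] field_simps)
qed


section \<open>Directed edges of the building\<close>

definition cvec :: "'a::field ^ 3 \<Rightarrow> 'a fls ^ 3" where
  "cvec c = (\<chi> i. fls_const (c $ i))"

definition cmat :: "'a::field ^ 3 ^ 3 \<Rightarrow> 'a mat3" where
  "cmat g = (\<chi> i j. fls_const (g $ i $ j))"

definition cpart :: "'a::field fls ^ 3 \<Rightarrow> 'a ^ 3" where
  "cpart x = (\<chi> i. fls_nth (x $ i) 0)"

definition diagX :: "3 set \<Rightarrow> 'a::field mat3" where
  "diagX s = (\<chi> i j. if i = j then if i \<in> s then fls_X else 1 else 0)"

lemma fls_const_sum: "fls_const (sum f I) = (\<Sum>i\<in>I. fls_const (f i))"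
  by (induction I rule: infinite_finite_induct) (auto simp flip: fls_plus_const)

lemma cmat_mult: "cmat (g ** h) = cmat g ** cmat h"
  by (simp add: vec_eq_iff cmat_def matrix_matrix_mult_def fls_const_sum)

lemma cmat_1: "cmat (mat 1) = mat 1"
  by (simp add: vec_eq_iff cmat_def mat_def)

lemma cmat_GL:
  assumes "invertible g" "\<And>c. fls_const c \<in> S" shows "cmat g \<in> GL S"
proof -
  have "cmat g ** cmat (inv3 g) = mat 1" "cmat (inv3 g) ** cmat g = mat 1"
    using assms by (simp_all add: cmat_1 flip: cmat_mult)
  moreover have "cmat h $ i $ j \<in> S" for h i j using assms by (simp add: cmat_def)
  ultimately show ?thesis unfolding GL_def by blast
qed

lemma cvec_O3: "cvec c \<in> O3" by (simp add: cvec_def O3_def)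

lemma int_ring_nth_0: "f \<in> int_ring \<Longrightarrow> fls_nth f 0 = 0 \<Longrightarrow> \<exists>g\<in>int_ring. f = fls_X * g"
proof -
  assume f: "f \<in> int_ring" "fls_nth f 0 = 0"
  have "f = fls_X * (fls_X_inv * f)" by (simp add: fls_X_times_conv_shift fls_X_inv_times_conv_shift)
  moreover have "fls_X_inv * f \<in> int_ring"
  proof -
    have "fls_nth f (i + 1) = 0" if "i < 0" for i
      using f that by (cases "i + 1 = 0") (auto simp: int_ring_iff)
    then show ?thesis by (auto simp: int_ring_iff fls_X_inv_times_conv_shift)
  qed
  ultimately show ?thesis by blast
qed

lemma O3_cpart_0: assumes "x \<in> O3" "cpart x = 0" shows "\<exists>y\<in>O3. x = fls_X *s y"
proof -
  have "\<forall>i. \<exists>g\<in>int_ring. x $ i = fls_X * g"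
    using assms int_ring_nth_0 by (auto simp: O3_def cpart_def vec_eq_iff)
  then obtain g where "\<forall>i. g i \<in> int_ring \<and> x $ i = fls_X * g i" by metis
  then show ?thesis by (intro bexI[of _ "\<chi> i. g i"]) (auto simp: O3_def vec_eq_iff)
qed

lemma cpart_diff: "cpart (x - y) = cpart x - cpart y"
  and cpart_cvec [simp]: "cpart (cvec c) = c"
  by (simp_all add: cpart_def cvec_def vec_eq_iff)

lemma O3_diff: "x \<in> O3 \<Longrightarrow> y \<in> O3 \<Longrightarrow> x - y \<in> O3"
  by (auto simp: O3_def int_ring_diff)

lemma O3_decompose: assumes "x \<in> O3" shows "\<exists>y\<in>O3. x - cvec (cpart x) = fls_X *s y"
proof (rule O3_cpart_0)
  show "x - cvec (cpart x) \<in> O3" by (intro O3_diff assms cvec_O3)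
  show "cpart (x - cvec (cpart x)) = 0" by (simp add: cpart_diff)
qed

lemma int_ring_mult_nth_0: "f \<in> int_ring \<Longrightarrow> g \<in> int_ring \<Longrightarrow> fls_nth (f * g) 0 = fls_nth f 0 * fls_nth g 0"
proof -
  assume "f \<in> int_ring" "g \<in> int_ring"
  then obtain a b where ab: "f = fps_to_fls a" "g = fps_to_fls b" unfolding int_ring_def by blast
  have "f * g = fps_to_fls (a * b)" unfolding ab by (rule fls_times_fps_to_fls[symmetric])
  then show ?thesis by (simp only: ab fps_to_fls_nth) simp
qed

lemma cpart_cmat: "x \<in> O3 \<Longrightarrow> cpart (cmat g *v x) = g *v cpart x"
  by (simp add: cpart_def vec_eq_iff cmat_def matrix_vector_mult_def fls_nth_sum int_ring_mult_nth_0 O3_def)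

lemma diagX_nth: "(diagX s *v x) $ i = (if i \<in> s then fls_X * x $ i else x $ i)"
proof -
  have "(diagX s *v x) $ i = (\<Sum>j\<in>UNIV. if j = i then (if i \<in> s then fls_X else 1) * x $ j else 0)"
    unfolding diagX_def matrix_vector_mult_def by (simp only: vec_lambda_beta, rule sum.cong) auto
  then show ?thesis by simp
qed

lemma lat_diagX:
  fixes A :: "'a::field mat3"
  shows "lat (A ** diagX s) = {A *v x | x. x \<in> O3 \<and> (\<forall>i\<in>s. cpart x $ i = 0)}"
proof -
  have "lat (A ** diagX s) = (\<lambda>v. A *v v) ` lat (diagX s)" by (simp add: image_lat)
  also have "lat (diagX s :: 'a mat3) = {x. x \<in> O3 \<and> (\<forall>i\<in>s. cpart x $ i = 0)}"
  proof (intro equalityI subsetI)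
    fix x :: "'a fls ^ 3" assume "x \<in> lat (diagX s)"
    then show "x \<in> {x. x \<in> O3 \<and> (\<forall>i\<in>s. cpart x $ i = 0)}"
      by (auto simp: lat_def O3_def diagX_nth cpart_def int_ring_mult int_ring_mult_nth_0)
  next
    fix x :: "'a fls ^ 3" assume x: "x \<in> {x. x \<in> O3 \<and> (\<forall>i\<in>s. cpart x $ i = 0)}"
    have "\<forall>i. \<exists>g\<in>int_ring. x $ i = (if i \<in> s then fls_X * g else g)"
    proof
      fix i show "\<exists>g\<in>int_ring. x $ i = (if i \<in> s then fls_X * g else g)"
        using x int_ring_nth_0[of "x $ i"] by (cases "i \<in> s") (auto simp: O3_def cpart_def)
    qed
    then obtain g where "\<forall>i. g i \<in> int_ring \<and> x $ i = (if i \<in> s then fls_X * g i else g i)" by metis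
    then show "x \<in> lat (diagX s)" unfolding lat_def
      by (intro image_eqI[of _ _ "\<chi> i. g i"]) (auto simp: O3_def vec_eq_iff diagX_nth)
  qed
  finally show ?thesis by blast
qed

text \<open>The last three hypotheses say that \<open>g\<close> on \<open>C\<close> is a system of
  coset representatives.\<close>

lemma lattice_index_eq:
  fixes g :: "'c \<Rightarrow> 'a::field fls ^ 3"
  assumes L: "0 \<in> L" "\<And>v w. v \<in> L \<Longrightarrow> w \<in> L \<Longrightarrow> v - w \<in> L"
    and g: "\<And>c. c \<in> C \<Longrightarrow> g c \<in> L'" "\<And>v. v \<in> L' \<Longrightarrow> \<exists>c\<in>C. v - g c \<in> L"
      "\<And>c d. c \<in> C \<Longrightarrow> d \<in> C \<Longrightarrow> g c - g d \<in> L \<Longrightarrow> c = d"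
  shows "lattice_index L' L = card C"
proof -
  let ?r = "{(v, w). v \<in> L' \<and> w \<in> L' \<and> v - w \<in> L}"
  have sym: "w - v \<in> L" if "v - w \<in> L" for v w using L(2)[OF L(1) that] by simp
  have tr: "u - w \<in> L" if "u - v \<in> L" "v - w \<in> L" for u v w
    using L(2)[OF that(1) sym[OF that(2)]] by simp
  have eq: "equiv L' ?r"
    by (intro equivI refl_onI symI transI) (auto simp: L(1) intro: sym tr)
  have "bij_betw (\<lambda>c. ?r `` {g c}) C (L' // ?r)"
  proof (rule bij_betwI')
    fix c d assume "c \<in> C" "d \<in> C"
    then show "(?r `` {g c} = ?r `` {g d}) = (c = d)"
      using eq_equiv_class[OF _ eq, of "g c" "g d"] g by auto
  next
    fix c assume "c \<in> C" then show "?r `` {g c} \<in> L' // ?r" by (intro quotientI g)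
  next
    fix X assume "X \<in> L' // ?r"
    then obtain v where v: "v \<in> L'" "X = ?r `` {v}" by (auto elim: quotientE)
    then obtain c where c: "c \<in> C" "v - g c \<in> L" using g by blast
    then have "X = ?r `` {g c}" using v g eq_equiv_class_iff[OF eq] by auto
    then show "\<exists>c\<in>C. X = ?r `` {g c}" using c by blast
  qed
  then show ?thesis unfolding lattice_index_def by (simp add: bij_betw_same_card)
qed

lemma card_supported: "card {c :: 'a::finite_field ^ 3. \<forall>i. i \<notin> s \<longrightarrow> c $ i = 0} = CARD('a) ^ card s"
proof -
  have "bij_betw (\<lambda>c. restrict (\<lambda>i. c $ i) s) {c :: 'a ^ 3. \<forall>i. i \<notin> s \<longrightarrow> c $ i = 0} (PiE s (\<lambda>_. UNIV))"
    by (rule bij_betwI[where g = "\<lambda>f. \<chi> i. if i \<in> s then f i else 0"])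
      (auto simp: vec_eq_iff PiE_def extensional_def fun_eq_iff)
  then show ?thesis by (simp add: bij_betw_same_card card_PiE)
qed

lemma lat_diff: "v \<in> lat A \<Longrightarrow> w \<in> lat A \<Longrightarrow> v - w \<in> lat A"
  by (auto simp: lat_def matrix_vector_mult_diff_distrib[symmetric] intro: O3_diff)

lemma lat_0: "0 \<in> lat A"
  unfolding lat_def by (rule image_eqI[of _ _ 0]) (auto simp: O3_def)

lemma lattice_index_diagX:
  assumes "invertible (A :: 'a::finite_field mat3)"
  shows "lattice_index (lat A) (lat (A ** diagX s)) = CARD('a) ^ card s"
proof -
  have inj: "x = y" if "A *v x = A *v y" for x y
    using that assms by (metis inv3_left matrix_vector_mul_assoc matrix_vector_mul_lid)
  define pr where "pr c = (\<chi> i. if i \<in> s then c $ i else 0)" for c :: "'a ^ 3"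
  \<comment> \<open>Coset representatives are the constant vectors supported in \<open>s\<close>;
    \<open>pr\<close> truncates a residue vector to \<open>s\<close>.\<close>
  have "lattice_index (lat A) (lat (A ** diagX s)) = card {c :: 'a ^ 3. \<forall>i. i \<notin> s \<longrightarrow> c $ i = 0}"
  proof (rule lattice_index_eq[where g = "\<lambda>c. A *v cvec c"])
    fix c show "A *v cvec c \<in> lat A" using cvec_O3 by (auto simp: lat_def)
  next
    fix v assume "v \<in> lat A"
    then obtain x where x: "x \<in> O3" "v = A *v x" by (auto simp: lat_def)
    have "v - A *v cvec (pr (cpart x)) = A *v (x - cvec (pr (cpart x)))"
      by (simp add: x matrix_vector_mult_diff_distrib)
    moreover have "x - cvec (pr (cpart x)) \<in> O3" using x by (simp add: O3_diff cvec_O3)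
    ultimately show "\<exists>c\<in>{c. \<forall>i. i \<notin> s \<longrightarrow> c $ i = 0}. v - A *v cvec c \<in> lat (A ** diagX s)"
      unfolding lat_diagX
      by (intro bexI[of _ "pr (cpart x)"]) (auto simp: cpart_diff pr_def)
  next
    fix c d :: "'a ^ 3" assume c: "c \<in> {c. \<forall>i. i \<notin> s \<longrightarrow> c $ i = 0}" "d \<in> {c. \<forall>i. i \<notin> s \<longrightarrow> c $ i = 0}"
    assume "A *v cvec c - A *v cvec d \<in> lat (A ** diagX s)"
    then obtain x where "A *v (cvec c - cvec d) = A *v x" "\<forall>i\<in>s. cpart x $ i = 0"
      unfolding lat_diagX by (auto simp: matrix_vector_mult_diff_distrib)
    then have "\<forall>i\<in>s. cpart (cvec c - cvec d) $ i = 0" using inj by metis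
    then show "c = d" using c by (auto simp: cpart_diff vec_eq_iff)
  qed (auto intro: lat_0 lat_diff)
  then show ?thesis by (simp add: card_supported)
qed

text \<open>Extend a basis of \<open>W\<close>; \<open>s\<close> indexes the added vectors. For
  codimension 1 and 2 its position is prescribed, so that edges of each type get one fixed diagonal
  matrix.\<close>

lemma subspace_adapted_basis:
  fixes W :: "('a::field ^ 3) set"
  assumes "vec.subspace W"
  obtains g s where "invertible g" "W = {g *v c | c. \<forall>i\<in>s. c $ i = 0}"
    "card s = 1 \<longrightarrow> s = {1::3}" "card s = 2 \<longrightarrow> s = {2, 3}"
proof -
  obtain B where B: "B \<subseteq> W" "vec.independent B" "W \<subseteq> vec.span B" "card B = vec.dim W"
    using vec.basis_exists[of W] by metis
  obtain B' where B': "B \<subseteq> B'" "vec.independent B'" "vec.span B' = UNIV"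
    using vec.maximal_independent_subset_extend[OF subset_UNIV B(2)] by (metis top.extremum_uniqueI)
  have fin: "finite B'" using B' vec.finiteI_independent by blast
  have "vec.dim (vec.span B') = 3" using B' vec_dim_card[where 'n = 3 and 'a = 'a] by simp
  then have "card B' = 3"
    using vec.dim_eq_card_independent[OF B'(2)] by simp
  moreover have "card (B' - B) = card B' - card B"
    using B'(1) fin finite_subset by (intro card_Diff_subset) auto
  ultimately have card: "card (B' - B) + card B = 3"
    using card_mono[OF fin B'(1)] by simp
  define n where "n = card (B' - B)"
  define s :: "3 set" where "s = (if n = 0 then {} else if n = 1 then {1} else if n = 2 then {2, 3} else UNIV)"
  have "n \<le> 3" using card by (simp add: n_def)
  then have "n = 0 \<or> n = 1 \<or> n = 2 \<or> n = 3" by linarith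
  then have cs: "card s = n" by (auto simp: s_def)
  have s: "card s = card (B' - B)" "card s = 1 \<longrightarrow> s = {1}" "card s = 2 \<longrightarrow> s = {2,3}"
    unfolding cs by (simp_all add: n_def[symmetric] s_def)
  have "card (- s) = card B"
    using s(1) card by (simp add: Compl_eq_Diff_UNIV card_Diff_subset)
  then obtain h1 h2 where h: "bij_betw h1 s (B' - B)" "bij_betw h2 (- s) B"
    using finite_same_card_bij[of s "B' - B"] finite_same_card_bij[of "- s" B] s(1) fin B'(1)
    by (metis finite finite_Diff finite_subset)
  define h where "h i = (if i \<in> s then h1 i else h2 i)" for i
  have hs: "bij_betw h s (B' - B)" "bij_betw h (- s) B"
    using h bij_betw_cong[of s h h1] bij_betw_cong[of "- s" h h2] by (simp_all add: h_def)
  then have "bij_betw h (s \<union> - s) ((B' - B) \<union> B)" by (intro bij_betw_combine) auto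
  then have hb: "bij_betw h UNIV B'" using B'(1) by (simp add: Un_absorb2)
  then have "inj h" "range h = B'" by (auto simp: bij_betw_def)
  then have inv: "invertible (\<chi> i j. h j $ i)"
    using B'(2) by (subst columns_invertible[symmetric]) simp
  have mv: "(\<chi> i j. h j $ i) *v c = (\<Sum>i\<in>UNIV. c $ i *s h i)" for c
    unfolding matrix_mult_sum by (rule sum.cong) (simp_all add: column_def)
  have "W = {(\<chi> i j. h j $ i) *v c | c. \<forall>i\<in>s. c $ i = 0}"
  proof (intro equalityI subsetI)
    fix w assume "w \<in> W"
    moreover have "finite B" using fin B'(1) finite_subset by blast
    ultimately obtain u where u: "w = (\<Sum>v\<in>B. u v *s v)" using B(3) by (auto simp: vec.span_finite)
    define c where "c = (\<chi> i. if i \<in> s then 0 else u (h i))"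
    have "w = (\<Sum>i\<in>-s. u (h i) *s h i)"
      unfolding u using sum.reindex_bij_betw[OF hs(2), of "\<lambda>v. u v *s v"] by simp
    also have "\<dots> = (\<Sum>i\<in>UNIV. c $ i *s h i)"
      by (intro sum.mono_neutral_cong_left) (auto simp: c_def)
    finally show "w \<in> {(\<chi> i j. h j $ i) *v c | c. \<forall>i\<in>s. c $ i = 0}"
      unfolding mv by (intro CollectI exI[of _ c]) (auto simp: c_def)
  next
    fix w assume "w \<in> {(\<chi> i j. h j $ i) *v c | c. \<forall>i\<in>s. c $ i = 0}"
    then obtain c where c: "w = (\<Sum>i\<in>UNIV. c $ i *s h i)" "\<forall>i\<in>s. c $ i = 0" unfolding mv by blast
    have "c $ i *s h i \<in> W" for i
    proof (cases "i \<in> s")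
      case True then show ?thesis using c assms vec.subspace_0 by simp
    next
      case False then have "h i \<in> W" using hs(2) B(1) by (auto simp: bij_betw_def)
      then show ?thesis using assms vec.subspace_scale by blast
    qed
    then show "w \<in> W" unfolding c(1) using assms by (intro vec.subspace_sum) auto
  qed
  then show ?thesis using that[OF inv _ s(2,3)] by blast
qed

lemma diagX_m3:
  "diagX {} = m3 1 0 0 0 1 0 0 0 1" "diagX {1} = m3 fls_X 0 0 0 1 0 0 0 1"
  "diagX {1, 2} = m3 fls_X 0 0 0 fls_X 0 0 0 1" "diagX {2, 3} = m3 1 0 0 0 fls_X 0 0 0 fls_X"
  by (simp_all add: diagX_def vec_eq_iff forall_3)

lemma diagX_Compl: "diagX s ** diagX (- s) = mat fls_X"
proof -
  have m: "(diagX s ** diagX t) $ i $ j = (if i \<in> s then fls_X * diagX t $ i $ j else diagX t $ i $ j)"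
    for t and i j :: 3
    using diagX_nth[of s "column j (diagX t)" i]
    by (cases "i \<in> s") (simp_all add: matrix_matrix_mult_def matrix_vector_mult_def column_def)
  show ?thesis by (simp only: vec_eq_iff m) (simp add: diagX_def mat_def)
qed

lemma Compl_3: "- {1::3} = {2, 3}" "- {2, 3::3} = {1}"
proof -
  have "x \<in> - {1} \<longleftrightarrow> x \<in> {2, 3}" "x \<in> - {2, 3} \<longleftrightarrow> x \<in> {1}" for x :: 3
    using exhaust_3[of x] by auto
  then show "- {1::3} = {2, 3}" "- {2, 3::3} = {1}" by blast+
qed

lemma subdegree_det_diagX1 [simp]: "fls_subdegree (det (diagX {1} :: 'a::field mat3)) = 1" "det (diagX {1} :: 'a mat3) \<noteq> 0"
  and subdegree_det_diagX12 [simp]: "fls_subdegree (det (diagX {1, 2} :: 'a mat3)) = 2" "det (diagX {1, 2} :: 'a mat3) \<noteq> 0"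
  and subdegree_det_diagX23 [simp]: "fls_subdegree (det (diagX {2, 3} :: 'a mat3)) = 2" "det (diagX {2, 3} :: 'a mat3) \<noteq> 0"
  by (simp_all add: diagX_m3 det_m3)

lemma invertible_diagX1 [simp]: "invertible (diagX {1} :: 'a::field mat3)"
  and invertible_diagX12 [simp]: "invertible (diagX {1, 2} :: 'a mat3)"
  and invertible_diagX23 [simp]: "invertible (diagX {2, 3} :: 'a mat3)"
  by (simp_all add: invertible_det_nz)

text \<open>Lattices between \<open>\<pi> B O^3\<close> and \<open>B O^3\<close> correspond to
  subspaces of the residue space, and a basis adapted to the subspace lifts to a constant matrix
  \<open>k\<close>.\<close>

lemma sublattice_adapted_basis:
  fixes B :: "'a::field mat3"
  assumes "lattice3 L" and B: "invertible B" and L: "lat (mat fls_X ** B) \<subseteq> L" "L \<subseteq> lat B"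
  obtains k and s :: "3 set" where "k \<in> K" "L = lat (B ** k ** diagX s)"
    "card s = 1 \<longrightarrow> s = {1}" "card s = 2 \<longrightarrow> s = {2, 3}"
proof -
  obtain A where A: "invertible A" "L = lat A" using assms by (auto simp: lattice3_iff)
  define W where "W = {c. B *v cvec c \<in> L}"
  have add: "v + w \<in> L" if "v \<in> L" "w \<in> L" for v w
    using lat_diff[of v A "0 - w"] lat_diff[of 0 A w] lat_0[of A] that A by simp
  have smult: "f *s v \<in> L" if "v \<in> L" "f \<in> int_ring" for v f
    using that unfolding A(2) mem_lat[OF A(1)]
    by (auto simp: O3_def vector_scalar_commute int_ring_mult)
  have cv: "cvec (c + d) = cvec c + cvec d" "cvec (a *s c) = fls_const a *s cvec c" "cvec 0 = 0" for a and c d :: "'a ^ 3"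
    by (simp_all add: cvec_def vec_eq_iff flip: fls_plus_const)
  have "vec.subspace W"
  proof (rule vec.subspaceI)
    show "0 \<in> W" using lat_0 A by (simp add: W_def cv)
  next
    fix c d assume "c \<in> W" "d \<in> W" then show "c + d \<in> W"
      using add by (simp add: W_def cv matrix_vector_right_distrib)
  next
    fix a c assume "c \<in> W" then show "a *s c \<in> W"
      using smult by (simp add: W_def cv vector_scalar_commute)
  qed
  then obtain g and s :: "3 set" where g: "invertible g" "W = {g *v c | c. \<forall>i\<in>s. c $ i = 0}"
    "card s = 1 \<longrightarrow> s = {1}" "card s = 2 \<longrightarrow> s = {2, 3}"
    by (rule subspace_adapted_basis) (rule that)
  have gK: "cmat g \<in> K" and giK: "cmat (inv3 g) \<in> K"
    using g(1) by (auto intro!: cmat_GL inv3_invertible)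
  have gi: "cmat g ** cmat (inv3 g) = mat 1" using g(1) by (simp add: cmat_1 flip: cmat_mult)
  \<comment> \<open>\<open>L\<close> contains \<open>\<pi> B O^3\<close>, so membership is decided
    by the residue.\<close>
  have mem: "B *v x \<in> L \<longleftrightarrow> cpart x \<in> W" if x: "x \<in> O3" for x
  proof -
    obtain y where y: "y \<in> O3" "x - cvec (cpart x) = fls_X *s y" using O3_decompose[OF x] by blast
    have "B *v (fls_X *s y) = mat fls_X ** B *v y"
      by (simp add: vec_eq_iff matrix_vector_mult_def sum_distrib_left ac_simps)
    then have z: "B *v (fls_X *s y) \<in> L" using y L(1) by (auto simp: lat_def)
    have "B *v x = B *v cvec (cpart x) + B *v (fls_X *s y)" "B *v cvec (cpart x) = B *v x - B *v (fls_X *s y)"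
      unfolding y(2)[symmetric] by (simp_all add: matrix_vector_mult_diff_distrib)
    then show ?thesis using z add lat_diff A(2) by (metis W_def mem_Collect_eq)
  qed
  have gW: "g *v c \<in> W \<longleftrightarrow> (\<forall>i\<in>s. c $ i = 0)" for c
  proof -
    have "g *v c = g *v d \<Longrightarrow> c = d" for d
      using g(1) by (metis inv3_left matrix_vector_mul_assoc matrix_vector_mul_lid)
    then show ?thesis unfolding g(2) by blast
  qed
  have "L = lat (B ** cmat g ** diagX s)"
  proof (intro equalityI subsetI)
    fix v assume v: "v \<in> L"
    then obtain x where x: "x \<in> O3" "v = B *v x" using L(2) by (auto simp: lat_def)
    define x' where "x' = cmat (inv3 g) *v x"
    have x': "x' \<in> O3" using x giK unfolding x'_def GL_def by (auto intro!: O3_mult)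
    have xx: "x = cmat g *v x'" using gi by (simp add: x'_def matrix_vector_mul_assoc)
    have "cpart x \<in> W" using mem x v by blast
    then have "\<forall>i\<in>s. cpart x' $ i = 0" using xx x' cpart_cmat gW by metis
    then show "v \<in> lat (B ** cmat g ** diagX s)"
      unfolding lat_diagX using x(2) xx x' by (auto simp: matrix_vector_mul_assoc)
  next
    fix v assume "v \<in> lat (B ** cmat g ** diagX s)"
    then obtain x' where x': "v = B *v (cmat g *v x')" "x' \<in> O3" "\<forall>i\<in>s. cpart x' $ i = 0"
      unfolding lat_diagX by (auto simp: matrix_vector_mul_assoc)
    have "cmat g *v x' \<in> O3" using x' gK unfolding GL_def by (auto intro!: O3_mult)
    then show "v \<in> L" using x' mem gW cpart_cmat by metis
  qed
  then show ?thesis using that gK g(3,4) by blast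
qed

section \<open>Edges of types 1 and 2 in terms of matrices\<close>

definition edge :: "'a::field mat3 \<Rightarrow> 'a edge" where
  "edge A = (vx (A ** diagX {1}), vx A)"

text \<open>The valuation of the determinant modulo 3 depends only on the vertex: scalars change it
  by multiples of 3 and \<open>K\<close> not at all.\<close>

lemma vx_distinct:
  assumes "invertible A" "invertible E" "\<not> 3 dvd fls_subdegree (det E)"
  shows "vx (A ** E) \<noteq> vx (A :: 'a::field mat3)"
proof
  assume "vx (A ** E) = vx A"
  then obtain s k where s: "s \<noteq> 0" "k \<in> K" "A ** E = mat s ** A ** k"
    using assms by (auto simp: vx_eq_iff invertible_mult)
  then have "det A * det E = s ^ 3 * det A * det k" by (metis det_mul det_mat3)
  moreover have "det A \<noteq> 0" "det E \<noteq> 0" using assms by (auto simp: invertible_det_nz)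
  ultimately have "det E = s ^ 3 * det k" by simp
  then have "fls_subdegree (det E) = 3 * fls_subdegree s"
    using s GL_int_ring_det[OF s(2)] by (simp add: fls_subdegree_pow)
  then show False using assms(3) by simp
qed

lemma lat_strict:
  assumes "invertible A" "invertible E" "\<And>i j. E$i$j \<in> int_ring" "fls_subdegree (det E) \<noteq> 0"
  shows "lat (A ** E) \<subset> lat (A :: 'a::field mat3)"
proof -
  have "lat (A ** E) \<subseteq> lat A" using assms by (subst lat_subset_iff) auto
  moreover have "lat (A ** E) \<noteq> lat A"
    using assms GL_int_ring_det[of E] by (subst lat_eq_iff) (auto simp: invertible_mult)
  ultimately show ?thesis by blast
qed

lemma mat_diagX: "mat fls_X ** A = A ** diagX {1, 2} ** m3 1 0 0 0 1 0 0 0 fls_X" for A :: "'a::field mat3"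
  unfolding mat_mult_commute by (simp add: matrix_mul_assoc[symmetric] diagX_m3 m3_mult mat_m3)

lemma diagX12: "A ** diagX {1, 2} = A ** diagX {1} ** m3 1 0 0 0 fls_X 0 0 0 1" for A :: "'a::field mat3"
  by (simp add: matrix_mul_assoc[symmetric] diagX_m3 m3_mult)

lemma chamberI:
  "x \<in> vertices \<Longrightarrow> y \<in> vertices \<Longrightarrow> z \<in> vertices \<Longrightarrow> L1 \<in> x \<Longrightarrow> L2 \<in> y \<Longrightarrow> L3 \<in> z \<Longrightarrow>
    scale fls_X L1 \<subset> L3 \<Longrightarrow> L3 \<subset> L2 \<Longrightarrow> L2 \<subset> L1 \<Longrightarrow> chamber {x, y, z}"
  unfolding chamber_def
  by (rule bexI[of _ x], rule bexI[of _ y], rule bexI[of _ z], rule conjI[OF refl],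
      rule bexI[of _ L1], rule bexI[of _ L2], rule bexI[of _ L3]) simp_all

text \<open>The chain is \<open>\<pi>\<close>, \<open>diag(\<pi>, \<pi>, 1)\<close>,
  \<open>diag(\<pi>, 1, 1)\<close>, 1, each applied to \<open>O^3\<close> and followed by
  \<open>A\<close>.\<close>

lemma chamber_standard:
  assumes A: "invertible (A :: 'a::field mat3)"
  shows "chamber {vx A, vx (A ** diagX {1}), vx (A ** diagX {1, 2})}"
proof -
  have i3: "m3 1 0 0 0 1 0 0 0 fls_X $ i $ j \<in> int_ring" "m3 1 0 0 0 fls_X 0 0 0 1 $ i $ j \<in> int_ring"
     "diagX s $ i $ j \<in> int_ring" for i j and s :: "3 set"
    using exhaust_3[of i] exhaust_3[of j] by (auto simp: diagX_def)
  have inv: "invertible (m3 1 0 0 0 1 0 0 0 fls_X :: 'a mat3)" "invertible (m3 1 0 0 0 fls_X 0 0 0 1 :: 'a mat3)"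
    by (auto simp: invertible_det_nz det_m3)
  have "scale fls_X (lat A) \<subset> lat (A ** diagX {1, 2})"
    unfolding scale_lat mat_diagX
    by (rule lat_strict) (use A inv i3 in \<open>auto simp: invertible_mult det_m3\<close>)
  moreover have "lat (A ** diagX {1, 2}) \<subset> lat (A ** diagX {1})"
    unfolding diagX12
    by (rule lat_strict) (use A inv i3 in \<open>auto simp: invertible_mult det_m3\<close>)
  moreover have "lat (A ** diagX {1}) \<subset> lat A"
    by (rule lat_strict) (use A inv i3 in \<open>auto simp: invertible_mult det_m3\<close>)
  moreover have "vx A \<in> vertices" "vx (A ** diagX {1}) \<in> vertices" "vx (A ** diagX {1, 2}) \<in> vertices"
    using A by (auto intro!: vx_in_vertices invertible_mult)
  ultimately show ?thesis by (intro chamberI[OF _ _ _ lat_in_vx lat_in_vx lat_in_vx])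
qed

lemma edge_distinct: "invertible A \<Longrightarrow> vx (A ** diagX {1}) \<noteq> vx (A :: 'a::field mat3)"
  by (rule vx_distinct) auto

lemma edge_directed:
  assumes "invertible A" shows "edge A \<in> directed_edges" "prod.swap (edge A) \<in> directed_edges"
proof -
  note A = assms
  let ?C = "{vx A, vx (A ** diagX {1}), vx (A ** diagX {1, 2})}"
  show "edge A \<in> directed_edges" "prod.swap (edge A) \<in> directed_edges"
    using edge_distinct[OF A] chamber_standard[OF A] unfolding directed_edges_def edge_def
    by (auto intro!: exI[of _ ?C] simp del: insert_iff)
qed

lemma card_field_gt_1: "CARD('a::finite_field) > 1"
proof -
  have "card {0, 1 :: 'a} \<le> CARD('a)" by (rule card_mono) auto
  then show ?thesis by simp
qed

text \<open>The index of the two lattices counts the entries \<open>\<pi>\<close> of the adapted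
  basis, hence fixes \<open>card t\<close>.\<close>

lemma typed_edge_basis:
  assumes "(x, y) \<in> typed_edges k"
  obtains A :: "'a::finite_field mat3" and t where "invertible A" "x = vx (A ** diagX t)" "y = vx A"
    "card t = k" "k = 1 \<longrightarrow> t = {1}" "k = 2 \<longrightarrow> t = {2, 3}"
proof -
  obtain L L' where e: "(x, y) \<in> directed_edges" "L \<in> x" "L' \<in> y"
    "scale fls_X L' \<subseteq> L" "L \<subseteq> L'" "lattice_index L' L = CARD('a) ^ k"
    using assms unfolding typed_edges_def by blast
  then have "x \<in> vertices" "y \<in> vertices" by (auto simp: directed_edges_def chamber_def)
  then obtain A0 B0 where AB: "x = vx A0" "invertible A0" "y = vx B0" "invertible B0" by (auto simp: vertices_eq)
  then obtain sa sb where s: "sa \<noteq> 0" "L = lat (mat sa ** A0)" "sb \<noteq> 0" "L' = lat (mat sb ** B0)"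
    using e by (auto simp: mem_vx)
  define B where "B = mat sb ** B0"
  have B: "invertible B" "L' = lat B" "y = vx B"
    using s AB by (auto simp: B_def invertible_mat_mult vx_mat)
  have L: "lattice3 L" "x = homothety_class L"
    using s AB by (auto simp: lattice3_iff intro: invertible_mat_mult simp: vx_mat)
  obtain k' t where k': "k' \<in> K" "L = lat (B ** k' ** diagX t)" "card t = 1 \<longrightarrow> t = {1}" "card t = 2 \<longrightarrow> t = {2, 3}"
    using sublattice_adapted_basis[OF L(1) B(1)] e B scale_lat by metis
  have Bk: "invertible (B ** k')" using B k' by (auto intro: invertible_mult GL_invertible)
  have L': "L' = lat (B ** k')" using B k' by (simp add: lat_mult_K)
  have "CARD('a) ^ card t = CARD('a) ^ k"
    using e(6) lattice_index_diagX[OF Bk, of t] L' k' by simp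
  then have "card t = k" using card_field_gt_1 power_inject_exp by blast
  then show ?thesis using that[OF Bk] L k' L' B(2,3) by metis
qed

lemma lat_mult_subset: "invertible A \<Longrightarrow> (\<And>i j. E$i$j \<in> int_ring) \<Longrightarrow> lat (A ** E) \<subseteq> lat A"
  by (subst lat_subset_iff) auto

lemma diagX_int_ring: "diagX s $ i $ j \<in> int_ring"
  by (simp add: diagX_def)

lemma typed_edgeI:
  assumes A: "invertible (A :: 'a::finite_field mat3)" "invertible (A ** diagX t)"
    and "(vx (A ** diagX t), vx A) \<in> directed_edges"
  shows "(vx (A ** diagX t), vx A) \<in> typed_edges (card t)"
proof -
  have "mat fls_X ** A = A ** diagX t ** diagX (- t)"
    unfolding mat_mult_commute by (simp add: diagX_Compl matrix_mul_assoc[symmetric])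
  then have "scale fls_X (lat A) \<subseteq> lat (A ** diagX t)" "lat (A ** diagX t) \<subseteq> lat A"
    using lat_mult_subset[OF A(1) diagX_int_ring] lat_mult_subset[OF A(2) diagX_int_ring]
    by (simp_all add: scale_lat)
  moreover have "lattice_index (lat A) (lat (A ** diagX t)) = CARD('a) ^ card t"
    by (rule lattice_index_diagX[OF A(1)])
  ultimately show ?thesis
    using assms lat_in_vx unfolding typed_edges_def by blast
qed

lemma mat_X_diagX: "A ** diagX {1} ** diagX {2, 3} = mat fls_X ** A" "A ** diagX {2, 3} ** diagX {1} = mat fls_X ** A"
  for A :: "'a::field mat3"
  using diagX_Compl[of "{1}", where 'a = 'a] diagX_Compl[of "{2, 3}", where 'a = 'a]
  by (simp_all add: Compl_3 matrix_mul_assoc[symmetric] mat_mult_commute[of fls_X A])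

lemma typed_edges_1: "typed_edges 1 = {edge A | A :: 'a::finite_field mat3. invertible A}"
proof (intro equalityI subsetI)
  fix e :: "'a edge" assume "e \<in> typed_edges 1"
  then obtain A :: "'a mat3" where "invertible A" "e = (vx (A ** diagX {1}), vx A)"
    by (cases e) (metis typed_edge_basis)
  then show "e \<in> {edge A | A :: 'a mat3. invertible A}" by (auto simp: edge_def)
next
  fix e :: "'a edge" assume "e \<in> {edge A | A :: 'a mat3. invertible A}"
  then obtain A where A: "e = edge A" "invertible A" by blast
  then show "e \<in> typed_edges 1"
    using typed_edgeI[of A "{1}"] edge_directed(1)[OF A(2)] unfolding edge_def
    by (simp add: invertible_mult)
qed

text \<open>\<open>diag(1, \<pi>, \<pi>)\<close> times \<open>diag(\<pi>, 1, 1)\<close> is the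
  scalar \<open>\<pi>\<close>, so an edge of type 2, described by the matrix of its source, is a
  reversed edge of type 1.\<close>

lemma typed_edges_2: "typed_edges 2 = {prod.swap (edge A) | A :: 'a::finite_field mat3. invertible A}"
proof (intro equalityI subsetI)
  fix e :: "'a edge" assume "e \<in> typed_edges 2"
  then obtain A :: "'a mat3" where A: "invertible A" "e = (vx (A ** diagX {2, 3}), vx A)"
    by (cases e) (metis typed_edge_basis)
  define A' where "A' = A ** diagX {2, 3}"
  have "invertible A'" "e = prod.swap (edge A')"
    using A by (simp_all add: A'_def invertible_mult edge_def mat_X_diagX vx_mat)
  then show "e \<in> {prod.swap (edge A) | A :: 'a mat3. invertible A}" by blast
next
  fix e :: "'a edge" assume "e \<in> {prod.swap (edge A) | A :: 'a mat3. invertible A}"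
  then obtain A where A: "e = prod.swap (edge A)" "invertible A" by blast
  have "vx (A ** diagX {1} ** diagX {2, 3}) = vx A"
    by (simp add: mat_X_diagX vx_mat)
  then show "e \<in> typed_edges 2"
    using typed_edgeI[of "A ** diagX {1}" "{2, 3}"] edge_directed(2)[OF A(2)] A unfolding edge_def
    by (simp add: invertible_mult numeral_2_eq_2)
qed


section \<open>Orbits of edges as double cosets\<close>

lemma inj_poly_to_fls: "poly_to_fls p = poly_to_fls q \<Longrightarrow> p = q"
proof (rule poly_eqI)
  fix n assume "poly_to_fls p = poly_to_fls q"
  then have "fls_nth (poly_to_fls p) (- int n) = fls_nth (poly_to_fls q) (- int n)" by simp
  then show "coeff p n = coeff q n" by (simp add: fls_nth_poly_to_fls)
qed

lemma poly_to_fls_sum: "poly_to_fls (sum f I) = (\<Sum>i\<in>I. poly_to_fls (f i))"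
  by (induction I rule: infinite_finite_induct) (auto simp: poly_to_fls_add)

lemma map_matrix_mult: "map_matrix poly_to_fls (A ** B) = map_matrix poly_to_fls A ** map_matrix poly_to_fls B"
  by (simp add: vec_eq_iff matrix_matrix_mult_def poly_to_fls_sum poly_to_fls_mult)

lemma map_matrix_mat: "map_matrix poly_to_fls (mat c) = mat (poly_to_fls c)"
  by (simp add: vec_eq_iff mat_def)

lemma inj_map_matrix: "map_matrix poly_to_fls A = map_matrix poly_to_fls B \<Longrightarrow> A = B"
  unfolding vec_eq_iff nth_map_matrix by (metis inj_poly_to_fls)

definition proj_class :: "'a::field mat3 \<Rightarrow> 'a mat3 set" where
  "proj_class A = {mat c ** A | c. c \<noteq> 0}"

lemma PGL_eq: "(PGL :: 'a::field mat3 set set) = {proj_class A | A. invertible A}"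
  by (auto simp: PGL_def quotient_def proj_class_def dvd_field_iff)

lemma mat_mult_left: "A ** (mat s ** B) = mat s ** (A ** B)" for A :: "'b::comm_semiring_1^'n^'n"
proof -
  have "A ** (mat s ** B) = (A ** mat s) ** B" by (simp add: matrix_mul_assoc)
  also have "A ** mat s = mat s ** A" by (rule mat_mult_commute[symmetric])
  finally show ?thesis by (simp add: matrix_mul_assoc)
qed

lemma proj_class_mat: assumes "c \<noteq> 0" shows "proj_class (mat c ** A) = proj_class A"
proof (intro equalityI subsetI)
  fix X assume "X \<in> proj_class (mat c ** A)"
  then obtain d where "d \<noteq> 0" "X = mat (d * c) ** A"
    by (auto simp: proj_class_def matrix_mul_assoc mat_mult_mat)
  then show "X \<in> proj_class A" using assms unfolding proj_class_def
    by (intro CollectI exI[of _ "d * c"]) auto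
next
  fix X assume "X \<in> proj_class A"
  then obtain d where "d \<noteq> 0" "X = mat d ** A" by (auto simp: proj_class_def)
  then show "X \<in> proj_class (mat c ** A)" using assms unfolding proj_class_def
    by (intro CollectI exI[of _ "d / c"]) (auto simp: matrix_mul_assoc mat_mult_mat)
qed

text \<open>The inverse is carried along: it is again polynomial by definition of
  \<open>GL pol_ring\<close>, and this makes the lift to polynomial matrices invertible.\<close>

lemma PGL3_poly_eq: "PGL3_poly = {proj_class G | G :: 'a::field mat3. G \<in> GL pol_ring}"
proof (intro equalityI subsetI)
  fix h :: "'a mat3 set" assume "h \<in> PGL3_poly"
  then obtain g where h: "h \<in> PGL" "g \<in> PGL" "map_matrix poly_to_fls ` g \<subseteq> h"
    unfolding PGL3_poly_def by blast
  obtain M where M: "invertible M" "g = {B. \<exists>c. c dvd 1 \<and> B = mat c ** M}"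
    using h(2) unfolding PGL_def quotient_def by auto
  have "M \<in> g" unfolding M(2) by (intro CollectI exI[of _ 1]) simp
  obtain M' where "M ** M' = mat 1" "M' ** M = mat 1" using M(1) unfolding invertible_def by blast
  then have "map_matrix poly_to_fls M ** map_matrix poly_to_fls M' = mat 1"
     "map_matrix poly_to_fls M' ** map_matrix poly_to_fls M = mat 1"
    by (simp_all add: map_matrix_mat flip: map_matrix_mult)
  then have "map_matrix poly_to_fls M \<in> GL pol_ring"
    unfolding GL_def
    by (intro CollectI conjI exI[of _ "map_matrix poly_to_fls M'"]) (auto simp: pol_ring_def)
  moreover obtain H where H: "h = proj_class H" using h by (auto simp: PGL_eq)
  have "map_matrix poly_to_fls M \<in> h" using h \<open>M \<in> g\<close> by blast
  then obtain c where c: "c \<noteq> 0" "map_matrix poly_to_fls M = mat c ** H" unfolding H proj_class_def by blast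
  have "h = proj_class (map_matrix poly_to_fls M)"
    unfolding c(2) H using c(1) by (rule proj_class_mat[symmetric])
  ultimately show "h \<in> {proj_class G | G :: 'a mat3. G \<in> GL pol_ring}" by blast
next
  fix h :: "'a mat3 set" assume "h \<in> {proj_class G | G :: 'a mat3. G \<in> GL pol_ring}"
  then obtain G where G: "h = proj_class G" "G \<in> GL pol_ring" by blast
  obtain G' where G': "G' \<in> GL pol_ring" "G ** G' = mat 1" "G' ** G = mat 1"
    using G(2) by (rule GL_inverse) (rule that)
  have lift: "\<exists>M. map_matrix poly_to_fls M = N" if "\<And>i j. N $ i $ j \<in> pol_ring" for N :: "'a mat3"
  proof -
    have "\<forall>i j. \<exists>p. N $ i $ j = poly_to_fls p" using that by (auto simp: pol_ring_def image_iff)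
    then obtain m where "\<forall>i j. N $ i $ j = poly_to_fls (m i j)" by metis
    then show ?thesis by (intro exI[of _ "\<chi> i j. m i j"]) (simp add: vec_eq_iff)
  qed
  have "G $ i $ j \<in> pol_ring" "G' $ i $ j \<in> pol_ring" for i j
    using G(2) G'(1) by (auto simp: GL_def)
  then obtain M M' where M: "map_matrix poly_to_fls M = G" "map_matrix poly_to_fls M' = G'"
    using lift[of G] lift[of G'] by auto
  have "M ** M' = mat 1" "M' ** M = mat 1"
    using M G' by (auto intro!: inj_map_matrix simp: map_matrix_mult map_matrix_mat)
  then have inv: "invertible M" unfolding invertible_def by blast
  define g where "g = {B. \<exists>c. c dvd 1 \<and> B = mat c ** M}"
  have "g \<in> PGL" unfolding PGL_def g_def quotient_def using inv by auto
  moreover have "map_matrix poly_to_fls ` g \<subseteq> h"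
  proof clarify
    fix B assume "B \<in> g"
    then obtain c where c: "c dvd 1" "B = mat c ** M" unfolding g_def by blast
    then have "poly_to_fls c \<noteq> 0" using inj_poly_to_fls[of c 0] by auto
    then show "map_matrix poly_to_fls B \<in> h"
      using c M by (auto simp: G proj_class_def map_matrix_mult map_matrix_mat)
  qed
  moreover have "h \<in> PGL" using G GL_invertible by (auto simp: PGL_eq)
  ultimately show "h \<in> PGL3_poly" unfolding PGL3_poly_def by blast
qed

lemma act_vertex_vx: "act_vertex (proj_class G) (vx A) = vx (G ** A)"
proof -
  have m: "mat c ** G ** (mat s ** A) = mat (c * s) ** (G ** A)" for c s
    by (simp only: mat_mult_mat[symmetric] matrix_mul_assoc[symmetric] mat_mult_left[of G])
  show ?thesis
  proof (intro equalityI subsetI)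
    fix L assume "L \<in> act_vertex (proj_class G) (vx A)"
    then obtain c s where "c \<noteq> 0" "s \<noteq> 0" "L = lat (mat c ** G ** (mat s ** A))"
      unfolding act_vertex_def proj_class_def mem_vx by (auto simp: image_lat)
    then show "L \<in> vx (G ** A)"
      unfolding m mem_vx by (intro exI[of _ "c * s"]) auto
  next
    fix L assume "L \<in> vx (G ** A)"
    then obtain s where s: "s \<noteq> 0" "L = lat (mat s ** (G ** A))" by (auto simp: mem_vx)
    have "G \<in> proj_class G" unfolding proj_class_def by (intro CollectI exI[of _ 1]) simp
    moreover have "lat (mat s ** A) \<in> vx A" using s mem_vx by blast
    moreover have "L = (\<lambda>v. G *v v) ` lat (mat s ** A)" using s by (simp only: image_lat mat_mult_left)
    ultimately show "L \<in> act_vertex (proj_class G) (vx A)" unfolding act_vertex_def by blast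
  qed
qed

lemma act_edge_edge: "act_edge (proj_class G) (edge A) = edge (G ** A)"
  by (simp add: act_edge_def edge_def act_vertex_vx matrix_mul_assoc)

abbreviation orbit :: "'a::field edge \<Rightarrow> 'a edge set" where
  "orbit e \<equiv> {act_edge g e | g. g \<in> PGL3_poly}"

lemma orbit_edge: "orbit (edge A) = {edge (G ** A) | G. G \<in> GL pol_ring}"
proof -
  have "orbit (edge A) = {act_edge (proj_class G) (edge A) | G. G \<in> GL pol_ring}"
    unfolding PGL3_poly_eq by blast
  then show ?thesis by (simp only: act_edge_edge)
qed

text \<open>The intersection of \<open>K\<close> and \<open>D K D^-1\<close>, which is the
  stabilizer of the standard edge up to scalars.\<close>

definition parahoric :: "'a::field mat3 set" where
  "parahoric = {p \<in> K. inv3 (diagX {1}) ** p ** diagX {1} \<in> K}"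

lemma tpow_fls_X [simp]: "tpow 1 * fls_X = (1 :: 'a::field fls)" "fls_X * tpow 1 = (1 :: 'a::field fls)"
  "fls_X * (tpow 1 * f) = (f :: 'a::field fls)" "tpow 1 * (fls_X * f) = (f :: 'a::field fls)"
proof -
  show *: "tpow 1 * fls_X = (1 :: 'a::field fls)" using tpow_add[of 1 "-1"] by simp
  then show "fls_X * tpow 1 = (1 :: 'a::field fls)" by (simp add: mult.commute)
  then show "fls_X * (tpow 1 * f) = f" "tpow 1 * (fls_X * f) = f"
    using * by (simp_all add: mult.assoc[symmetric])
qed

lemma inv3_diagX1: "inv3 (diagX {1}) = (m3 (tpow 1) 0 0 0 1 0 0 0 1 :: 'a::field mat3)"
  by (rule inv3_unique) (simp add: diagX_m3 m3_mult mat_m3)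

lemma parahoric_mult: "p \<in> parahoric \<Longrightarrow> p' \<in> parahoric \<Longrightarrow> p ** p' \<in> parahoric"
proof -
  assume "p \<in> parahoric" "p' \<in> parahoric"
  moreover have "inv3 (diagX {1}) ** (p ** p') ** diagX {1} =
      (inv3 (diagX {1}) ** p ** diagX {1}) ** (inv3 (diagX {1}) ** p' ** diagX {1})"
    by (simp add: matrix_mul_assoc)
  ultimately show ?thesis unfolding parahoric_def by (auto intro: ir.GL_mult)
qed

lemma parahoric_inv: "p \<in> parahoric \<Longrightarrow> inv3 p \<in> parahoric"
proof -
  assume p: "p \<in> parahoric"
  then have "invertible p" by (auto simp: parahoric_def GL_invertible)
  then have "inv3 (diagX {1}) ** inv3 p ** diagX {1} = inv3 (inv3 (diagX {1}) ** p ** diagX {1})"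
    by (simp add: inv3_mult invertible_mult inv3_invertible matrix_mul_assoc)
  then show ?thesis using p unfolding parahoric_def by (auto intro: inv3_GL)
qed

lemma edge_parahoric: "invertible A \<Longrightarrow> p \<in> parahoric \<Longrightarrow> edge (A ** p) = edge A"
proof -
  assume A: "invertible A" "p \<in> parahoric"
  have "A ** p ** diagX {1} = A ** diagX {1} ** (inv3 (diagX {1}) ** p ** diagX {1})"
    by (simp add: matrix_mul_assoc)
  then show ?thesis using A by (simp add: edge_def parahoric_def vx_K invertible_mult)
qed

lemma edge_mat: "s \<noteq> 0 \<Longrightarrow> edge (mat s ** A) = edge A"
  by (simp add: edge_def vx_mat flip: matrix_mul_assoc)

lemma mat_K:
  assumes "s \<noteq> 0" "fls_subdegree s = 0" shows "mat s \<in> (K :: 'a::field mat3 set)"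
proof (rule GL_int_ring_detI)
  show "(mat s :: 'a mat3) $ i $ j \<in> int_ring" for i j using assms by (simp add: mat_def int_ring_subdegree)
  show "det (mat s :: 'a mat3) \<noteq> 0" "fls_subdegree (det (mat s :: 'a mat3)) = 0"
    using assms by (simp_all add: det_mat3 fls_subdegree_pow)
qed

text \<open>Source and target each supply a scalar. Comparing determinants shows that the two have
  equal valuation, so their quotient is a unit and can be absorbed into \<open>K\<close>.\<close>

lemma edge_eqD:
  assumes "invertible A" "invertible B" "edge A = edge B"
  obtains s p where "s \<noteq> 0" "p \<in> parahoric" "A = mat s ** B ** p"
proof -
  obtain s k where k: "s \<noteq> 0" "k \<in> K" "A = mat s ** B ** k"
    using assms by (auto simp: edge_def vx_eq_iff)
  obtain r k' where k': "r \<noteq> 0" "k' \<in> K" "A ** diagX {1} = mat r ** (B ** diagX {1}) ** k'"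
    using assms by (auto simp: edge_def vx_eq_iff invertible_mult)
  have "mat s ** B ** k ** diagX {1} = B ** (mat s ** k ** diagX {1})"
    by (simp add: matrix_mul_assoc[symmetric] mat_mult_left)
  moreover have "mat r ** (B ** diagX {1}) ** k' = B ** (diagX {1} ** (mat r ** k'))"
    by (simp add: matrix_mul_assoc[symmetric] mat_mult_left)
  ultimately have "B ** (mat s ** k ** diagX {1}) = B ** (diagX {1} ** (mat r ** k'))" using k k' by simp
  then have "mat s ** k ** diagX {1} = diagX {1} ** (mat r ** k')"
    by (metis assms(2) inv3_cancel(1))
  then have "inv3 (diagX {1}) ** (mat s ** k ** diagX {1}) = mat r ** k'" by simp
  then have e: "mat s ** (inv3 (diagX {1}) ** k ** diagX {1}) = mat r ** k'"
    by (metis mat_mult_commute matrix_mul_assoc)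
  define m where "m = inv3 (diagX {1}) ** k ** diagX {1}"
  have "det (inv3 (diagX {1} :: 'a mat3)) * det (diagX {1} :: 'a mat3) = 1"
    by (metis det_I det_mul inv3_left invertible_diagX1)
  then have dm: "det m = det k"
    unfolding m_def det_mul by (metis mult.assoc mult.commute mult_1)
  have "s ^ 3 * det k = r ^ 3 * det k'"
    using arg_cong[OF e, of det] dm unfolding m_def[symmetric] by (simp only: det_mul det_mat3)
  then have "fls_subdegree (s ^ 3 * det k) = fls_subdegree (r ^ 3 * det k')" by simp
  then have "fls_subdegree s = fls_subdegree r"
    using k(1) k'(1) GL_int_ring_det[OF k(2)] GL_int_ring_det[OF k'(2)] by (simp add: fls_subdegree_pow)
  then have rs: "fls_subdegree (r / s) = 0" using k k' by (simp add: fls_divide_subdegree)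
  have "m = mat (r / s) ** k'"
  proof -
    have "mat (inverse s) ** (mat s ** m) = mat (inverse s) ** (mat r ** k')" using e m_def by simp
    then show ?thesis using k by (simp add: matrix_mul_assoc mat_mult_mat field_simps)
  qed
  moreover have "mat (r / s) \<in> K" using rs k(1) k'(1) by (intro mat_K) auto
  ultimately have "m \<in> K" using k' by (simp add: ir.GL_mult)
  then show ?thesis using that[OF k(1) _ k(3)] k by (simp add: parahoric_def m_def)
qed

definition eqv :: "'a::field mat3 \<Rightarrow> 'a mat3 \<Rightarrow> bool" where
  "eqv A B \<longleftrightarrow> (\<exists>s G p. s \<noteq> 0 \<and> G \<in> GL pol_ring \<and> p \<in> parahoric \<and> B = mat s ** (G ** A ** p))"

lemma eqvI: "G \<in> GL pol_ring \<Longrightarrow> p \<in> parahoric \<Longrightarrow> s \<noteq> 0 \<Longrightarrow> mat s ** (G ** A ** p) = B \<Longrightarrow> eqv A B"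
  unfolding eqv_def by blast

lemma one_parahoric: "mat 1 \<in> parahoric"
  by (simp add: parahoric_def ir.GL_one)

lemma eqv_refl: "eqv A A"
  by (rule eqvI[where s = 1 and G = "mat 1" and p = "mat 1"]) (simp_all add: pr.GL_one one_parahoric)

lemma eqv_trans: assumes "eqv A B" "eqv B C" shows "eqv A C"
proof -
  obtain s G p where 1: "s \<noteq> 0" "G \<in> GL pol_ring" "p \<in> parahoric" "B = mat s ** (G ** A ** p)"
    using assms by (auto simp: eqv_def)
  obtain s' G' p' where 2: "s' \<noteq> 0" "G' \<in> GL pol_ring" "p' \<in> parahoric" "C = mat s' ** (G' ** B ** p')"
    using assms by (auto simp: eqv_def)
  have "C = mat (s' * s) ** ((G' ** G) ** A ** (p ** p'))"
    unfolding 1(4) 2(4) by (simp only: mat_mult_mat[symmetric] matrix_mul_assoc[symmetric] mat_mult_left[of G'])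
  then show ?thesis using 1 2 by (intro eqvI[where s = "s' * s" and G = "G' ** G" and p = "p ** p'"])
    (auto intro: pr.GL_mult parahoric_mult)
qed

lemma eqv_sym: assumes "eqv A B" shows "eqv B A"
proof -
  obtain s G p where 1: "s \<noteq> 0" "G \<in> GL pol_ring" "p \<in> parahoric" "B = mat s ** (G ** A ** p)"
    using assms by (auto simp: eqv_def)
  have inv: "invertible G" "invertible p" using 1 by (auto simp: GL_invertible parahoric_def)
  have "inv3 G ** B ** inv3 p = mat s ** (inv3 G ** (G ** A ** p)) ** inv3 p"
    by (simp only: 1(4) mat_mult_left[of "inv3 G"])
  also have "\<dots> = mat s ** A" using inv by (simp add: matrix_mul_assoc[symmetric])
  finally have "mat (inverse s) ** (inv3 G ** B ** inv3 p) = A"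
    using 1(1) by (simp add: matrix_mul_assoc mat_mult_mat)
  then show ?thesis using 1 by (intro eqvI[where s = "inverse s" and G = "inv3 G" and p = "inv3 p"])
    (auto intro: inv3_GL parahoric_inv)
qed

lemma mem_orbit_iff:
  assumes "invertible A" "invertible B"
  shows "edge B \<in> orbit (edge A) \<longleftrightarrow> eqv A B"
proof
  assume "edge B \<in> orbit (edge A)"
  then obtain G where G: "G \<in> GL pol_ring" "edge B = edge (G ** A)" by (auto simp: orbit_edge)
  then obtain s p where "s \<noteq> 0" "p \<in> parahoric" "B = mat s ** (G ** A) ** p"
    using edge_eqD assms by (metis GL_invertible invertible_mult)
  then show "eqv A B" using G unfolding eqv_def by (metis matrix_mul_assoc)
next
  assume "eqv A B"
  then obtain s G p where "s \<noteq> 0" "G \<in> GL pol_ring" "p \<in> parahoric" "B = mat s ** (G ** A ** p)"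
    by (auto simp: eqv_def)
  moreover from this have "edge B = edge (G ** A)"
    using assms by (simp add: edge_mat edge_parahoric invertible_mult GL_invertible)
  ultimately show "edge B \<in> orbit (edge A)" by (auto simp: orbit_edge)
qed

lemma orbit_eq_iff:
  assumes "invertible A" "invertible B"
  shows "orbit (edge A) = orbit (edge B) \<longleftrightarrow> eqv A B"
proof
  assume "orbit (edge A) = orbit (edge B)"
  moreover have "edge B \<in> orbit (edge B)" using mem_orbit_iff assms eqv_refl by blast
  ultimately show "eqv A B" using mem_orbit_iff assms by blast
next
  assume e: "eqv A B"
  have "x \<in> orbit (edge A) \<longleftrightarrow> x \<in> orbit (edge B)" for x
  proof -
    have C: "\<exists>C. invertible C \<and> x = edge C" if xA: "x \<in> orbit (edge A')" "invertible A'" for A'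
    proof -
      obtain G where "G \<in> GL pol_ring" "x = edge (G ** A')" using xA(1) unfolding orbit_edge by blast
      then show ?thesis using GL_invertible invertible_mult xA(2) by blast
    qed
    have iff: "edge C \<in> orbit (edge A) \<longleftrightarrow> edge C \<in> orbit (edge B)" if "invertible C" for C
      unfolding mem_orbit_iff[OF assms(1) that] mem_orbit_iff[OF assms(2) that]
      using e eqv_sym eqv_trans by blast
    show ?thesis
    proof
      assume x: "x \<in> orbit (edge A)"
      from C[OF x assms(1)] obtain D where "invertible D" "x = edge D" by blast
      then show "x \<in> orbit (edge B)" using x iff[of D] by simp
    next
      assume x: "x \<in> orbit (edge B)"
      from C[OF x assms(2)] obtain D where "invertible D" "x = edge D" by blast
      then show "x \<in> orbit (edge A)" using x iff[of D] by simp
    qed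
  qed
  then show "orbit (edge A) = orbit (edge B)" by (rule set_eqI)
qed


section \<open>Geodesic successors\<close>

definition umat :: "'a \<times> 'a \<Rightarrow> 'a::field mat3" where
  "umat c = m3 1 0 0 (fls_const (fst c)) 1 0 (fls_const (snd c)) 0 1"

abbreviation "Dinv \<equiv> inv3 (diagX {1}) :: 'a::field mat3"

lemma det_umat [simp]: "det (umat c) = 1"
  by (simp add: umat_def det_m3)

lemma invertible_umat [simp]: "invertible (umat c)"
  by (simp add: invertible_det_nz)

lemma umat_mult: "umat c ** umat d = umat (fst c + fst d, snd c + snd d)"
  by (simp add: umat_def m3_mult fls_plus_const add.commute)

lemma inv3_umat: "inv3 (umat c) = umat (- fst c, - snd c)"
  by (rule inv3_unique) (simp add: umat_mult, simp add: umat_def mat_m3)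

lemma m3_int_ring:
  "(\<forall>i j. m3 a b c d e f g h i' $ i $ j \<in> S) \<longleftrightarrow>
    a \<in> S \<and> b \<in> S \<and> c \<in> S \<and> d \<in> S \<and> e \<in> S \<and> f \<in> S \<and> g \<in> S \<and> h \<in> S \<and> i' \<in> S"
  by (auto simp: forall_3)

lemma m3_in: "a \<in> S \<Longrightarrow> b \<in> S \<Longrightarrow> c \<in> S \<Longrightarrow> d \<in> S \<Longrightarrow> e \<in> S \<Longrightarrow> f \<in> S \<Longrightarrow> g \<in> S \<Longrightarrow> h \<in> S \<Longrightarrow>
    k \<in> S \<Longrightarrow> m3 a b c d e f g h k $ i $ j \<in> S"
  using m3_int_ring[of a b c d e f g h k S] by blast

lemma m3_K: "a \<in> int_ring \<Longrightarrow> b \<in> int_ring \<Longrightarrow> c \<in> int_ring \<Longrightarrow> d \<in> int_ring \<Longrightarrow> e \<in> int_ring \<Longrightarrow>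
   f \<in> int_ring \<Longrightarrow> g \<in> int_ring \<Longrightarrow> h \<in> int_ring \<Longrightarrow> i' \<in> int_ring \<Longrightarrow>
   det (m3 a b c d e f g h i') \<noteq> 0 \<Longrightarrow> fls_subdegree (det (m3 a b c d e f g h i')) = 0 \<Longrightarrow> m3 a b c d e f g h i' \<in> K"
  using m3_int_ring[of a b c d e f g h i' int_ring] by (intro GL_int_ring_detI) auto

lemma umat_K: "umat c \<in> K"
  unfolding umat_def by (rule m3_K) (simp_all add: det_m3)

lemma umat_parahoric: "umat c \<in> parahoric"
proof -
  have "inv3 (diagX {1}) ** umat c ** diagX {1} =
      m3 1 0 0 (fls_X * fls_const (fst c)) 1 0 (fls_X * fls_const (snd c)) 0 1"
    unfolding inv3_diagX1 unfolding umat_def diagX_m3 by (simp add: m3_mult mult.commute)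
  also have "\<dots> \<in> K" by (rule m3_K) (simp_all add: det_m3 int_ring_mult)
  finally show ?thesis using umat_K by (simp add: parahoric_def)
qed

text \<open>\<open>umat c\<close> clears the residue of the first column below its unit entry.
  Conjugation by \<open>D\<close> then divides these entries by \<open>\<pi>\<close>, and the result
  is still integral.\<close>

lemma K_unit_decompose:
  assumes k: "k \<in> K" and unit: "fls_nth (k $ 1 $ 1) 0 \<noteq> 0"
  obtains c p where "p \<in> parahoric" "k ** Dinv = umat c ** Dinv ** (p :: 'a::field mat3)"
proof -
  define c where "c = (fls_nth (k $ 2 $ 1) 0 / fls_nth (k $ 1 $ 1) 0, fls_nth (k $ 3 $ 1) 0 / fls_nth (k $ 1 $ 1) 0)"
  define m where "m = inv3 (umat c) ** k"
  have mK: "m \<in> K" unfolding m_def by (intro ir.GL_mult inv3_GL umat_K k)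
  have kint: "k $ i $ j \<in> int_ring" and mint: "m $ i $ j \<in> int_ring" for i j
    using k mK by (auto simp: GL_def)
  have "m = m3 1 0 0 (- fls_const (fst c)) 1 0 (- fls_const (snd c)) 0 1 ** k"
    by (simp only: m_def inv3_umat) (simp add: umat_def)
  then have "m $ 2 $ 1 = k $ 2 $ 1 - fls_const (fst c) * k $ 1 $ 1"
     "m $ 3 $ 1 = k $ 3 $ 1 - fls_const (snd c) * k $ 1 $ 1"
    by (simp_all add: matrix_matrix_mult_def sum_3)
  then have "fls_nth (m $ 2 $ 1) 0 = 0" "fls_nth (m $ 3 $ 1) 0 = 0"
    using unit by (simp_all add: c_def)
  then obtain y z where yz: "y \<in> int_ring" "z \<in> int_ring" "m $ 2 $ 1 = fls_X * y" "m $ 3 $ 1 = fls_X * z"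
    using int_ring_nth_0 mint by metis
  define p where "p = diagX {1} ** m ** Dinv"
  have "p = m3 (m$1$1) (fls_X * m$1$2) (fls_X * m$1$3) y (m$2$2) (m$2$3) z (m$3$2) (m$3$3)"
    unfolding p_def inv3_diagX1 unfolding diagX_m3
    by (subst m3_eta[of m]) (simp add: m3_mult yz ac_simps)
  moreover have "det p = det m"
  proof -
    have "det (Dinv :: 'a mat3) * det (diagX {1} :: 'a mat3) = 1"
      by (metis det_I det_mul inv3_left invertible_diagX1)
    then show ?thesis unfolding p_def det_mul by (metis mult.assoc mult.commute mult_1)
  qed
  ultimately have "p \<in> K"
    using mint yz GL_int_ring_det[OF mK] by (auto intro!: m3_K int_ring_mult)
  moreover have "Dinv ** p ** diagX {1} = m" by (simp add: p_def matrix_mul_assoc)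
  ultimately have "p \<in> parahoric" using mK by (simp add: parahoric_def)
  moreover have "k ** Dinv = umat c ** Dinv ** p"
    by (simp add: p_def m_def matrix_mul_assoc)
  ultimately show ?thesis using that by blast
qed

lemma invertible_Dinv [simp]: "invertible Dinv"
  by (simp add: inv3_invertible)

lemma geodesic_path_2:
  "geodesic_path k [e, d] \<longleftrightarrow> e \<in> typed_edges k \<and> d \<in> typed_edges k \<and> snd e = fst d \<and>
     \<not> chamber {fst e, snd e, snd d}"
  by (auto simp: geodesic_path_def less_Suc_eq)

text \<open>Without a unit in the corner, \<open>\<pi> A k D^-1 O^3\<close> lies in
  \<open>A D O^3\<close>: the corner of \<open>E\<close> is \<open>t\<close> times that of
  \<open>k\<close>, hence integral. The other inclusions of the chain need no condition on
  \<open>k\<close>.\<close>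

lemma chamber_nonunit:
  assumes A: "invertible (A :: 'a::field mat3)" and k: "k \<in> K" "fls_nth (k $ 1 $ 1) 0 = 0"
  shows "chamber {vx (A ** diagX {1}), vx A, vx (A ** k ** Dinv)}"
proof -
  have kint: "k $ i $ j \<in> int_ring" for i j using k by (auto simp: GL_def)
  then obtain y where y: "y \<in> int_ring" "k $ 1 $ 1 = fls_X * y" using int_ring_nth_0 k by metis
  have ik: "invertible k" using k GL_invertible by blast
  have detk: "fls_subdegree (det k) = 0" "det k \<noteq> 0" using GL_int_ring_det k by auto
  have "det (Dinv :: 'a mat3) * det (diagX {1} :: 'a mat3) = 1"
    by (metis det_I det_mul inv3_left invertible_diagX1)
  then have detD: "fls_subdegree (det (Dinv :: 'a mat3)) = - 1" "det (Dinv :: 'a mat3) \<noteq> 0"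
    by (simp_all add: inv3_diagX1 det_m3)
  define E where "E = Dinv ** k ** Dinv ** mat fls_X"
  have iE: "invertible E" unfolding E_def by (intro invertible_mult invertible_mat3 ik) auto
  have "E = m3 y (k$1$2) (k$1$3) (k$2$1) (fls_X * k$2$2) (fls_X * k$2$3) (k$3$1) (fls_X * k$3$2) (fls_X * k$3$3)"
    unfolding E_def inv3_diagX1
    by (subst m3_eta[of k]) (simp add: m3_mult mat_m3 y ac_simps)
  then have Eint: "E $ i $ j \<in> int_ring" for i j
    using y kint by (simp only:) (intro m3_in int_ring_mult int_ring_X)
  have "det E = det Dinv * det k * det Dinv * fls_X ^ 3" by (simp add: E_def det_mul det_mat3)
  then have Edet: "fls_subdegree (det E) = 1" using detk detD by (simp add: fls_subdegree_pow)
  define E2 where "E2 = diagX {1} ** inv3 k"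
  have iE2: "invertible E2" unfolding E2_def by (intro invertible_mult inv3_invertible ik) auto
  have E2int: "E2 $ i $ j \<in> int_ring" for i j
    unfolding E2_def using inv3_GL[OF k(1)] by (intro ir.entries_mult) (auto simp: GL_def diagX_int_ring)
  have E2det: "fls_subdegree (det E2) = 1"
    using GL_int_ring_det[OF inv3_GL[OF k(1)]] by (simp add: E2_def det_mul)
  have "scale fls_X (lat (A ** k ** Dinv)) \<subset> lat (A ** diagX {1})"
  proof -
    have "mat fls_X ** (A ** k ** Dinv) = A ** diagX {1} ** E"
      unfolding mat_mult_commute[of fls_X "A ** k ** Dinv"] by (simp add: E_def matrix_mul_assoc)
    then show ?thesis unfolding scale_lat using lat_strict[of "A ** diagX {1}" E] Eint Edet iE A
      by (simp add: invertible_mult)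
  qed
  moreover have "lat (A ** diagX {1}) \<subset> lat A"
    using A diagX_int_ring by (intro lat_strict) auto
  moreover have "lat A \<subset> lat (A ** k ** Dinv)"
  proof -
    have "A = A ** k ** Dinv ** E2" using ik by (simp add: E2_def matrix_mul_assoc)
    then show ?thesis using lat_strict[of "A ** k ** Dinv" E2] E2int E2det iE2 A ik
      by (simp add: invertible_mult)
  qed
  moreover have "vx A \<in> vertices" "vx (A ** diagX {1}) \<in> vertices" "vx (A ** k ** Dinv) \<in> vertices"
    using A ik by (auto intro!: vx_in_vertices invertible_mult)
  ultimately have "chamber {vx (A ** k ** Dinv), vx A, vx (A ** diagX {1})}"
    by (intro chamberI[OF _ _ _ lat_in_vx lat_in_vx lat_in_vx])
  then show ?thesis by (simp add: insert_commute)
qed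

text \<open>Seen from \<open>M = A u\<close> the outer vertices are given by \<open>D\<close> and
  \<open>D^-1\<close>, as \<open>u\<close> fixes the edge. Adjacency would require of a scalar
  \<open>s\<close> valuation at most -1 by the entry \<open>(1, 1)\<close> and at least 0 by the
  entry \<open>(2, 2)\<close>.\<close>

lemma not_chamber_unit:
  assumes A: "invertible (A :: 'a::field mat3)"
  shows "\<not> chamber {vx (A ** diagX {1}), vx A, vx (A ** umat c ** Dinv)}"
proof
  define M where "M = A ** umat c"
  assume ch: "chamber {vx (A ** diagX {1}), vx A, vx (A ** umat c ** Dinv)}"
  have iM: "invertible M" using A by (simp add: M_def invertible_mult)
  have "vx (A ** diagX {1}) = vx (M ** diagX {1})"
    using edge_parahoric[OF A umat_parahoric, of c] by (simp add: edge_def M_def)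
  then obtain s where s: "s \<noteq> 0" "lat (mat fls_X ** (M ** Dinv)) \<subseteq> lat (mat s ** (M ** diagX {1}))"
     "lat (mat s ** (M ** diagX {1})) \<subseteq> lat (M ** Dinv)"
    using chamber_adjacent[OF ch, of "M ** diagX {1}" "M ** Dinv"] unfolding M_def by auto
  have "inv3 (mat s ** (M ** diagX {1})) = inv3 (M ** diagX {1}) ** inv3 (mat s)"
    using iM s(1) by (intro inv3_mult invertible_mat3 invertible_mult) auto
  also have "\<dots> = mat (inverse s) ** (Dinv ** inv3 M)"
    using iM s(1) by (simp add: inv3_mult inv3_mat mat_mult_commute)
  finally have "inv3 (mat s ** (M ** diagX {1})) ** (mat fls_X ** (M ** Dinv)) =
      mat fls_X ** (mat (inverse s) ** ((Dinv ** inv3 M) ** (M ** Dinv)))"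
    by (subst mat_mult_left) (simp only: matrix_mul_assoc)
  also have "(Dinv ** inv3 M) ** (M ** Dinv) = Dinv ** Dinv"
    using iM by (simp add: matrix_mul_assoc)
  finally have e: "inv3 (mat s ** (M ** diagX {1})) ** (mat fls_X ** (M ** Dinv)) =
      mat fls_X ** (mat (inverse s) ** (Dinv ** Dinv))" .
  have "(Dinv ** Dinv :: 'a mat3) $ 1 $ 1 = tpow 1 * tpow 1"
    unfolding inv3_diagX1 by (simp add: m3_mult)
  then have f1: "(mat fls_X ** (mat (inverse s) ** (Dinv ** Dinv))) $ 1 $ 1 = inverse s * tpow 1"
    by (simp add: mult.left_commute[of fls_X])
  have "(mat fls_X ** (mat (inverse s) ** (Dinv ** Dinv))) $ 1 $ 1 \<in> int_ring"
    using s(2) lat_subset_iff[of "mat s ** (M ** diagX {1})" "mat fls_X ** (M ** Dinv)"] iM s(1)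
    unfolding e by (simp only: invertible_mult invertible_mat_mult invertible_diagX1 simp_thms)
  then have "inverse s * tpow 1 \<in> int_ring" unfolding f1 .
  then have "fls_subdegree s \<le> - 1" using s(1) by (simp add: int_ring_subdegree fls_inverse_subdegree)
  have "inv3 (M ** Dinv) ** (mat s ** (M ** diagX {1})) = mat s ** ((diagX {1} ** inv3 M) ** (M ** diagX {1}))"
    using iM by (simp only: mat_mult_left) (simp add: inv3_mult)
  also have "(diagX {1} ** inv3 M) ** (M ** diagX {1}) = diagX {1} ** diagX {1}"
    using iM by (simp add: matrix_mul_assoc)
  finally have e2: "inv3 (M ** Dinv) ** (mat s ** (M ** diagX {1})) = mat s ** (diagX {1} ** diagX {1})" .
  have f2: "(mat s ** (diagX {1} ** diagX {1})) $ 2 $ 2 = s"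
    by (simp add: diagX_m3 m3_mult)
  have "(mat s ** (diagX {1} ** diagX {1})) $ 2 $ 2 \<in> int_ring"
    using s(3) lat_subset_iff[of "M ** Dinv" "mat s ** (M ** diagX {1})"] iM
    unfolding e2 by (simp add: invertible_mult)
  then have "s \<in> int_ring" unfolding f2 .
  then have "fls_subdegree s \<ge> 0" using s(1) by (simp add: int_ring_subdegree)
  then show False using \<open>fls_subdegree s \<le> - 1\<close> by simp
qed

text \<open>An edge that starts where the edge of \<open>A\<close> ends has, up to a scalar, the
  matrix \<open>A k D^-1\<close> with \<open>k\<close> in \<open>K\<close>. If the corner of
  \<open>k\<close> is not a unit, a chamber arises; otherwise \<open>k\<close> can be replaced by
  some \<open>umat c\<close>.\<close>

lemma geodesic_successors:
  assumes A: "invertible (A :: 'a::finite_field mat3)"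
  shows "{d. geodesic_path 1 [edge A, d]} = range (\<lambda>c. edge (A ** umat c ** Dinv))"
proof (intro equalityI subsetI)
  fix d assume "d \<in> {d. geodesic_path 1 [edge A, d]}"
  then obtain B where B: "invertible B" "d = edge B" "vx A = vx (B ** diagX {1})"
    and nc: "\<not> chamber {vx (A ** diagX {1}), vx A, vx B}"
    by (auto simp: geodesic_path_2 typed_edges_1 edge_def simp del: One_nat_def)
  obtain s k where s: "s \<noteq> 0" "k \<in> K" "B ** diagX {1} = mat s ** A ** k"
    using vx_eq_iff[of "B ** diagX {1}" A] A B by (auto simp: invertible_mult)
  have BB: "B = mat s ** (A ** k ** Dinv)"
    using arg_cong[OF s(3), of "\<lambda>m. m ** Dinv"] by (simp add: matrix_mul_assoc)
  have ik: "invertible k" using s GL_invertible by blast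
  show "d \<in> range (\<lambda>c. edge (A ** umat c ** Dinv))"
  proof (cases "fls_nth (k $ 1 $ 1) 0 = 0")
    case True
    then show ?thesis using nc chamber_nonunit[OF A s(2)] s(1) by (simp add: BB vx_mat)
  next
    case False
    then obtain c p where c: "p \<in> parahoric" "k ** Dinv = umat c ** Dinv ** p"
      using K_unit_decompose s(2) by metis
    have "A ** k ** Dinv = A ** umat c ** Dinv ** p" using c(2) by (metis matrix_mul_assoc)
    then have "d = edge (A ** umat c ** Dinv)"
      using s(1) A c(1) by (simp add: B(2) BB edge_mat edge_parahoric invertible_mult)
    then show ?thesis by blast
  qed
next
  fix d assume "d \<in> range (\<lambda>c. edge (A ** umat c ** Dinv))"
  then obtain c where c: "d = edge (A ** umat c ** Dinv)" by blast
  have inv: "invertible (A ** umat c ** Dinv)" using A by (simp add: invertible_mult)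
  have "fst d = vx A"
    using vx_K[OF A umat_K] by (simp add: c edge_def)
  moreover have "edge A \<in> typed_edges 1" "d \<in> typed_edges 1"
    unfolding typed_edges_1 using A inv c by blast+
  moreover have "\<not> chamber {fst (edge A), snd (edge A), snd d}"
    using not_chamber_unit[OF A, of c] by (simp only: c edge_def fst_conv snd_conv not_False_eq_True)
  ultimately show "d \<in> {d. geodesic_path 1 [edge A, d]}"
    by (simp only: geodesic_path_2 mem_Collect_eq) (simp add: edge_def)
qed

lemma const_tpow_int_ring: "fls_const c * tpow 1 \<in> int_ring \<Longrightarrow> c = (0 :: 'a::field)"
  by (rule ccontr) (simp add: int_ring_subdegree)

text \<open>Already the targets differ: equality would make \<open>D u_d^-1 u_c D^-1\<close>
  integral up to a scalar of valuation 0, but its lower entries in the first column are constants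
  times \<open>t\<close>.\<close>

lemma inj_successors:
  assumes A: "invertible (A :: 'a::field mat3)"
  shows "inj (\<lambda>c. edge (A ** umat c ** Dinv))"
proof (rule injI)
  fix c d assume "edge (A ** umat c ** Dinv) = edge (A ** umat d ** Dinv)"
  then obtain s k where s: "s \<noteq> 0" "k \<in> K" "A ** umat c ** Dinv = mat s ** (A ** umat d ** Dinv) ** k"
    using vx_eq_iff[of "A ** umat c ** Dinv" "A ** umat d ** Dinv"] A by (auto simp: edge_def invertible_mult)
  have "A ** (umat c ** Dinv) = (mat s ** (A ** umat d ** Dinv)) ** k"
    using s(3) by (simp only: matrix_mul_assoc)
  also have "\<dots> = A ** (umat d ** (Dinv ** (mat s ** k)))"
    by (simp only: mat_mult_left matrix_mul_assoc[symmetric])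
  finally have "inv3 A ** (A ** (umat c ** Dinv)) = inv3 A ** (A ** (umat d ** (Dinv ** (mat s ** k))))"
    by (rule arg_cong)
  then have "umat c ** Dinv = umat d ** (Dinv ** (mat s ** k))"
    unfolding inv3_cancel(1)[OF A] .
  then have "inv3 (umat d) ** (umat c ** Dinv) = inv3 (umat d) ** (umat d ** (Dinv ** (mat s ** k)))"
    by (rule arg_cong)
  then have "inv3 (umat d) ** (umat c ** Dinv) = Dinv ** (mat s ** k)"
    unfolding inv3_cancel(1)[OF invertible_umat] .
  then have "diagX {1} ** (inv3 (umat d) ** (umat c ** Dinv)) = mat s ** k"
    using inv3_cancel(2)[of "diagX {1}"] by simp
  moreover define x where "x = fls_const (fst c - fst d)"
  moreover define y where "y = fls_const (snd c - snd d)"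
  moreover have "inv3 (umat d) ** umat c = m3 1 0 0 x 1 0 y 0 1"
    unfolding inv3_umat umat_mult by (simp add: x_def y_def umat_def)
  moreover have "diagX {1} ** (m3 1 0 0 x 1 0 y 0 1 ** Dinv) = m3 1 0 0 (x * tpow 1) 1 0 (y * tpow 1) 0 1"
    unfolding inv3_diagX1 by (simp add: diagX_m3 m3_mult)
  ultimately have e: "m3 1 0 0 (x * tpow 1) 1 0 (y * tpow 1) 0 1 = mat s ** k"
    by (simp add: matrix_mul_assoc)
  have "1 = s ^ 3 * det k"
    using arg_cong[OF e, of det] by (simp only: det_mul det_mat3 det_m3) simp
  then have "fls_subdegree (s ^ 3 * det k) = 0" by (simp flip: \<open>1 = s ^ 3 * det k\<close>)
  then have "fls_subdegree s = 0"
    using s GL_int_ring_det[OF s(2)] by (simp add: fls_subdegree_pow)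
  then have "s \<in> int_ring" by (simp add: int_ring_subdegree)
  then have "(mat s ** k) $ i $ j \<in> int_ring" for i j
    using s(2) by (auto simp: GL_def intro!: int_ring_mult)
  then have "x * tpow 1 \<in> int_ring" "y * tpow 1 \<in> int_ring"
    using m3_int_ring[of 1 0 0 "x * tpow 1" 1 0 "y * tpow 1" 0 1 int_ring] unfolding e[symmetric] by auto
  then have "fst c - fst d = 0" "snd c - snd d = 0"
    unfolding x_def y_def by (blast intro: const_tpow_int_ring)+
  then show "c = d" by (simp add: prod_eq_iff)
qed


section \<open>Representatives of the orbits\<close>

text \<open>Scalars normalize the first exponent; the value 1 puts the boundary between
  \<open>step_std_stay\<close> and \<open>step_std_jump\<close> between the exponents 0 and
  1.\<close>

definition std :: "int \<times> int \<Rightarrow> 'a::field mat3" where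
  "std v = m3 (tpow 1) 0 0 0 (tpow (fst v)) 0 0 0 (tpow (snd v))"

lemma det_std: "det (std v) \<noteq> 0" "fls_subdegree (det (std v :: 'a::field mat3)) = - (1 + fst v + snd v)"
  by (simp_all add: std_def det_m3)

lemma invertible_std [simp]: "invertible (std v)"
  by (simp add: invertible_det_nz det_std)

lemma GL_pol_ring_m3:
  "a \<in> pol_ring \<Longrightarrow> b \<in> pol_ring \<Longrightarrow> c \<in> pol_ring \<Longrightarrow> d \<in> pol_ring \<Longrightarrow> e \<in> pol_ring \<Longrightarrow>
   f \<in> pol_ring \<Longrightarrow> g \<in> pol_ring \<Longrightarrow> h \<in> pol_ring \<Longrightarrow> k \<in> pol_ring \<Longrightarrow>
   det (m3 a b c d e f g h k) \<in> {1, - 1} \<Longrightarrow> m3 a b c d e f g h k \<in> GL pol_ring"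
  by (rule pr.GL_detI) (auto intro: m3_in pol_ring_uminus[OF pol_ring_1])

lemma tpow_add_eq: "m + n = k \<Longrightarrow> tpow m * (tpow n :: 'a::field fls) = tpow k"
  by (simp flip: tpow_add)

lemma tpow_add_eq': "m + n = k \<Longrightarrow> tpow m * (tpow n * f) = tpow k * (f :: 'a::field fls)"
  by (simp add: tpow_mult_assoc)

definition swap23 :: "'a::field mat3" where
  "swap23 = m3 1 0 0 0 0 1 0 1 0"

text \<open>Membership in both groups allows the last two exponents to be sorted, while
  \<open>parahoric\<close> singles out the first one.\<close>

lemma swap23_GL: "(swap23 :: 'a::field mat3) \<in> GL pol_ring" "(swap23 :: 'a mat3) \<in> K" "(swap23 :: 'a mat3) \<in> parahoric"
proof -
  show "(swap23 :: 'a mat3) \<in> GL pol_ring" unfolding swap23_def by (rule GL_pol_ring_m3) (simp_all add: det_m3)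
  show K: "(swap23 :: 'a mat3) \<in> K" unfolding swap23_def by (rule m3_K) (simp_all add: det_m3)
  have "Dinv ** swap23 ** diagX {1} = (swap23 :: 'a mat3)"
    unfolding inv3_diagX1 unfolding swap23_def diagX_m3 by (simp add: m3_mult)
  then show "(swap23 :: 'a mat3) \<in> parahoric" using K by (simp add: parahoric_def)
qed

lemma eqv_std_swap: "eqv (std (a, b)) (std (b, a))"
  by (rule eqvI[OF swap23_GL(1,3), of 1]) (simp_all add: swap23_def std_def m3_mult)

lemma step_std_swap:
  "eqv (std (a, b) ** umat (c, d) ** Dinv) (std (b, a) ** umat (d, c) ** (Dinv :: 'a::field mat3))"
  by (rule eqvI[OF swap23_GL(1,3), of 1])
    (simp_all add: swap23_def std_def m3_mult inv3_diagX1 umat_def)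

text \<open>The first column of the product is \<open>(t^2, c t^(a+1), d t^(b+1))\<close>. Its lower
  entries are cleared by the first row, with multipliers \<open>c t^(a-1)\<close> and
  \<open>d t^(b-1)\<close> that are polynomials here.\<close>

lemma step_std_stay:
  assumes "c = 0 \<or> a \<ge> 1" "d = 0 \<or> b \<ge> 1"
  shows "eqv (std (a, b) ** umat (c, d) ** Dinv) (std (a - 1, b - 1) :: 'a::field mat3)"
proof (rule eqvI)
  let ?G = "m3 1 0 0 (- fls_const c * tpow (a - 1)) 1 0 (- fls_const d * tpow (b - 1)) 0 1 :: 'a mat3"
  have "- fls_const c * tpow (a - 1) \<in> pol_ring"
    using assms(1) by (cases "c = 0") (auto intro!: pol_ring_uminus pol_ring_mult tpow_pol_ring)
  moreover have "- fls_const d * tpow (b - 1) \<in> pol_ring"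
    using assms(2) by (cases "d = 0") (auto intro!: pol_ring_uminus pol_ring_mult tpow_pol_ring)
  ultimately show "?G \<in> GL pol_ring" by (intro GL_pol_ring_m3) (auto simp: det_m3)
  show "mat 1 \<in> parahoric" by (rule one_parahoric)
  show "mat (tpow (- 1)) ** (?G ** (std (a, b) ** umat (c, d) ** Dinv) ** mat 1) = std (a - 1, b - 1)"
    unfolding std_def umat_def inv3_diagX1 mat_m3
    by (simp add: m3_mult algebra_simps tpow_add_eq tpow_add_eq' flip: tpow_neg1 tpow_add)
qed simp

text \<open>Now \<open>t^(a-1)\<close> is not a polynomial, and the second entry
  \<open>c t^(a+1)\<close> of the first column becomes the pivot: the first two rows are exchanged,
  and the third is cleared with a multiple of \<open>t^(b-a)\<close>.\<close>

lemma step_std_jump: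
  assumes c: "c \<noteq> 0" "a \<le> 0" and d: "d = 0 \<or> a \<le> b"
  shows "eqv (std (a, b) ** umat (c, d) ** Dinv) (std (1 - a, b - a) :: 'a::field mat3)"
proof (rule eqvI)
  let ?G = "m3 0 1 0 1 (- fls_const (1 / c) * tpow (1 - a)) 0 0 (- fls_const (d / c) * tpow (b - a)) 1 :: 'a mat3"
  \<comment> \<open>These column operations clear what remains; \<open>tpow (- 1)\<close> in the
    first row is \<open>\<pi>\<close>, as membership in \<open>parahoric\<close> demands.\<close>
  let ?p = "m3 (fls_const (1 / c)) (tpow (- 1)) 0 0 (- fls_const c) 0 0 (- fls_const d) 1 :: 'a mat3"
  have "- fls_const (d / c) * tpow (b - a) \<in> pol_ring"
    using d by (cases "d = 0") (auto intro!: pol_ring_uminus pol_ring_mult tpow_pol_ring)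
  moreover have "- fls_const (1 / c) * tpow (1 - a) \<in> pol_ring"
    using c by (auto intro!: pol_ring_uminus pol_ring_mult tpow_pol_ring)
  ultimately show "?G \<in> GL pol_ring" by (intro GL_pol_ring_m3) (auto simp: det_m3)
  have cc: "fls_const (1 / c) * fls_const c = 1" "fls_const (d / c) * fls_const c = fls_const d"
    using c by simp_all
  have K: "?p \<in> K"
    by (rule m3_K) (use c in \<open>auto simp: det_m3 intro!: int_ring_uminus tpow_int_ring\<close>)
  have "Dinv ** ?p ** diagX {1} = m3 (fls_const (1 / c)) 1 0 0 (- fls_const c) 0 0 (- fls_const d) 1"
    unfolding inv3_diagX1 unfolding diagX_m3 by (simp add: m3_mult)
  also have "\<dots> \<in> K"
    by (rule m3_K) (use c in \<open>auto simp: det_m3 intro!: int_ring_uminus\<close>)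
  finally show "?p \<in> parahoric" using K by (simp add: parahoric_def)
  have cc': "fls_const c * (x * (fls_const (1 / c) * y)) = x * y" for x y :: "'a fls"
  proof -
    have "fls_const c * (x * (fls_const (1 / c) * y)) = (fls_const (1 / c) * fls_const c) * (x * y)"
      by (simp only: mult_ac)
    then show ?thesis by (simp only: cc(1) mult_1)
  qed
  show "mat (tpow (- a)) ** (?G ** (std (a, b) ** umat (c, d) ** Dinv) ** ?p) = std (1 - a, b - a)"
    using c unfolding std_def umat_def inv3_diagX1 mat_m3
    by (simp add: cc' m3_mult algebra_simps tpow_add_eq tpow_add_eq' flip: tpow_neg1 tpow_add)
qed simp

text \<open>On sorted pairs \<open>b \<le> 0\<close> implies \<open>a \<le> 0\<close>, so the middle
  case has \<open>c = 0\<close>; there the pivot sits in the third row.\<close>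

fun nxt :: "int \<times> int \<Rightarrow> 'a::field \<times> 'a \<Rightarrow> int \<times> int" where
  "nxt (a, b) (c, d) =
    (if a \<le> 0 \<and> c \<noteq> 0 then (min (1 - a) (b - a), max (1 - a) (b - a))
     else if b \<le> 0 \<and> d \<noteq> 0 then (a - b, 1 - b)
     else (a - 1, b - 1))"

definition sorted_pairs :: "(int \<times> int) set" where
  "sorted_pairs = {(a, b). a \<le> b}"

lemma nxt_sorted: "v \<in> sorted_pairs \<Longrightarrow> nxt v c \<in> sorted_pairs"
  by (cases v; cases c) (auto simp: sorted_pairs_def)

lemma step_std:
  assumes "v \<in> sorted_pairs"
  shows "eqv (std v ** umat c ** Dinv) (std (nxt v c) :: 'a::field mat3)"
proof -
  obtain a b x y where v: "v = (a, b)" "c = (x, y)" by (cases v; cases c)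
  then have ab: "a \<le> b" using assms by (simp add: sorted_pairs_def)
  consider "a \<le> 0" "x \<noteq> 0" | "\<not> (a \<le> 0 \<and> x \<noteq> 0)" "b \<le> 0" "y \<noteq> 0" | "\<not> (a \<le> 0 \<and> x \<noteq> 0)" "\<not> (b \<le> 0 \<and> y \<noteq> 0)"
    by blast
  then show ?thesis
  proof cases
    case 1
    have "eqv (std (1 - a, b - a)) (std (nxt v c) :: 'a mat3)"
      using 1 v eqv_std_swap[of "1 - a" "b - a"] eqv_refl[of "std (1 - a, b - a)"] by (auto simp: min_def max_def)
    then show ?thesis using step_std_jump[of x a y b] 1 ab v eqv_trans by blast
  next
    case 2
    have "eqv (std (b, a) ** umat (y, x) ** Dinv) (std (1 - b, a - b) :: 'a mat3)"
      using 2 ab by (intro step_std_jump) auto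
    note eqv_trans[OF step_std_swap this]
    note eqv_trans[OF this eqv_std_swap]
    moreover have "nxt v c = (a - b, 1 - b)" using 2 v by auto
    ultimately show ?thesis using v by (simp del: nxt.simps)
  next
    case 3
    have "nxt v c = (a - 1, b - 1)" using 3 v by auto
    moreover have "x = 0 \<or> a \<ge> 1" "y = 0 \<or> b \<ge> 1" using 3 by auto
    ultimately show ?thesis using step_std_stay[of x a y b] v by simp
  qed
qed

text \<open>Compare entries of \<open>std v' ** r\<close> and \<open>s G std v\<close>: polynomials
  have valuation at most 0, entries of \<open>r\<close> at least 0, and at least 1 in the first row
  off the diagonal. A nonzero term of \<open>det G\<close> yields three inequalities whose sum has
  no slack by determinants, so its permutation fixes the first index; sortedness settles a possible
  exchange of the other two.\<close>

lemma eqv_std_unique: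
  assumes v: "v \<in> sorted_pairs" "v' \<in> sorted_pairs" and e: "eqv (std v) (std v' :: 'a::field mat3)"
  shows "v = v'"
proof -
  obtain s G p where s: "s \<noteq> 0" "G \<in> GL pol_ring" "p \<in> parahoric" "(std v' :: 'a mat3) = mat s ** (G ** std v ** p)"
    using e by (auto simp: eqv_def)
  define r where "r = inv3 p"
  have r: "r \<in> parahoric" unfolding r_def by (rule parahoric_inv[OF s(3)])
  have ip: "invertible p" using s(3) by (auto simp: parahoric_def GL_invertible)
  have eq: "std v' ** r = mat s ** (G ** std v)"
    unfolding r_def s(4) using ip by (simp add: matrix_mul_assoc[symmetric])
  have rint: "r $ i $ j \<in> int_ring" for i j using r by (auto simp: parahoric_def GL_def)
  have xr: "fls_X_inv * r $ 1 $ j \<in> int_ring" if "j \<noteq> 1" for j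
  proof -
    have "(Dinv ** r ** diagX {1}) $ 1 $ j = fls_X_inv * r $ 1 $ j"
      using that exhaust_3[of j] unfolding inv3_diagX1 unfolding diagX_m3
      by (subst m3_eta[of r]) (auto simp: m3_mult tpow_1)
    moreover have "(Dinv ** r ** diagX {1}) $ 1 $ j \<in> int_ring" using r by (auto simp: parahoric_def GL_def)
    ultimately show ?thesis by simp
  qed
  have r1: "fls_subdegree (r $ 1 $ j) \<ge> 1" if j: "j \<noteq> 1" "r $ 1 $ j \<noteq> 0" for j
  proof -
    have "fls_X_inv * r $ 1 $ j \<noteq> 0" using j(2) by (simp add: fls_X_inv_times_conv_shift fls_shift_eq0_iff)
    then have "fls_subdegree (fls_X_inv * r $ 1 $ j) \<ge> 0" using xr[OF j(1)] by (simp add: int_ring_subdegree)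
    then show ?thesis unfolding fls_subdegree_mult_fls_X_inv(1)[OF j(2)] by simp
  qed
  define m m' where "m = (\<lambda>i::3. if i = 1 then 1 else if i = 2 then fst v else snd v)"
    and "m' = (\<lambda>i::3. if i = 1 then 1 else if i = 2 then fst v' else snd v')"
  have ent: "tpow (m' i) * r $ i $ j = s * (G $ i $ j * tpow (m j))" for i j
  proof -
    have "(std v' ** r) $ i $ j = tpow (m' i) * r $ i $ j"
      using exhaust_3[of i] by (auto simp: matrix_matrix_mult_def sum_3 std_def m'_def)
    moreover have "(mat s ** (G ** std v)) $ i $ j = s * (G $ i $ j * tpow (m j))"
      using exhaust_3[of j] by (auto simp: matrix_matrix_mult_def[of G] sum_3 std_def m_def)
    ultimately show ?thesis using eq by simp
  qed
  define e where "e = fls_subdegree s"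
  have ineq: "m j + (if i = 1 \<and> j \<noteq> 1 then 1 else 0) \<le> e + m' i" if G: "G $ i $ j \<noteq> 0" for i j
  proof -
    have "r $ i $ j \<noteq> 0" using ent[of i j] G s(1) by auto
    then have "fls_subdegree (r $ i $ j) - m' i = e + (fls_subdegree (G $ i $ j) - m j)"
      using arg_cong[OF ent[of i j], of fls_subdegree] G s(1) by (simp add: e_def)
    moreover have "fls_subdegree (G $ i $ j) \<le> 0" using G s(2) pol_ring_subdegree by (auto simp: GL_def)
    moreover have "fls_subdegree (r $ i $ j) \<ge> (if i = 1 \<and> j \<noteq> 1 then 1 else 0)"
      using r1 rint[of i j] \<open>r $ i $ j \<noteq> 0\<close> by (auto simp: int_ring_subdegree)
    ultimately show ?thesis by linarith
  qed
  have dr: "fls_subdegree (det r) = 0" "det r \<noteq> 0"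
    using r GL_int_ring_det by (auto simp: parahoric_def)
  have dG: "fls_subdegree (det G) = 0" "det G \<noteq> 0" using s(2) GL_pol_ring_det by auto
  have "det (std v' :: 'a mat3) * det r = s ^ 3 * (det G * det (std v))"
    using arg_cong[OF eq, of det] by (simp only: det_mul det_mat3)
  then have "fls_subdegree (det (std v' :: 'a mat3) * det r) = fls_subdegree (s ^ 3 * (det G * det (std v)))" by simp
  then have sum: "- (1 + fst v' + snd v') = 3 * e - (1 + fst v + snd v)"
    using dr dG s(1) by (simp add: det_std fls_subdegree_pow e_def)
  have ms: "m 1 = 1" "m 2 = fst v" "m 3 = snd v" "m' 1 = 1" "m' 2 = fst v'" "m' 3 = snd v'"
    by (simp_all add: m_def m'_def)
  have "G $ 1 $ 1 * G $ 2 $ 2 * G $ 3 $ 3 \<noteq> 0 \<or> G $ 1 $ 2 * G $ 2 $ 3 * G $ 3 $ 1 \<noteq> 0 \<or>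
        G $ 1 $ 3 * G $ 2 $ 1 * G $ 3 $ 2 \<noteq> 0 \<or> G $ 1 $ 1 * G $ 2 $ 3 * G $ 3 $ 2 \<noteq> 0 \<or>
        G $ 1 $ 2 * G $ 2 $ 1 * G $ 3 $ 3 \<noteq> 0 \<or> G $ 1 $ 3 * G $ 2 $ 2 * G $ 3 $ 1 \<noteq> 0"
    using dG(2) unfolding det_3 by fastforce
  then consider "G $ 1 $ 1 \<noteq> 0" "G $ 2 $ 2 \<noteq> 0" "G $ 3 $ 3 \<noteq> 0" | "G $ 1 $ 2 \<noteq> 0" "G $ 2 $ 3 \<noteq> 0" "G $ 3 $ 1 \<noteq> 0"
    | "G $ 1 $ 3 \<noteq> 0" "G $ 2 $ 1 \<noteq> 0" "G $ 3 $ 2 \<noteq> 0" | "G $ 1 $ 1 \<noteq> 0" "G $ 2 $ 3 \<noteq> 0" "G $ 3 $ 2 \<noteq> 0"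
    | "G $ 1 $ 2 \<noteq> 0" "G $ 2 $ 1 \<noteq> 0" "G $ 3 $ 3 \<noteq> 0" | "G $ 1 $ 3 \<noteq> 0" "G $ 2 $ 2 \<noteq> 0" "G $ 3 $ 1 \<noteq> 0"
    by auto
  then have "fst v = fst v' \<and> snd v = snd v'"
  proof cases
    case 1 then show ?thesis using ineq[of 1 1] ineq[of 2 2] ineq[of 3 3] sum ms by simp
  next
    case 2 then show ?thesis using ineq[of 1 2] ineq[of 2 3] ineq[of 3 1] sum ms by simp
  next
    case 3 then show ?thesis using ineq[of 1 3] ineq[of 2 1] ineq[of 3 2] sum ms by simp
  next
    case 4 then show ?thesis using ineq[of 1 1] ineq[of 2 3] ineq[of 3 2] sum ms v
      by (auto simp: sorted_pairs_def)
  next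
    case 5 then show ?thesis using ineq[of 1 2] ineq[of 2 1] ineq[of 3 3] sum ms by simp
  next
    case 6 then show ?thesis using ineq[of 1 3] ineq[of 2 2] ineq[of 3 1] sum ms by simp
  qed
  then show ?thesis by (simp add: prod_eq_iff)
qed

section \<open>Reduction theory: every vertex and edge has a diagonal representative\<close>

definition swap12 :: "'a::field mat3" where "swap12 = m3 0 1 0 1 0 0 0 0 1"
definition swap13 :: "'a::field mat3" where "swap13 = m3 0 0 1 0 1 0 1 0 0"
definition diag3 :: "int \<Rightarrow> int \<Rightarrow> int \<Rightarrow> 'a::field mat3" where
  "diag3 i j l = m3 (tpow i) 0 0 0 (tpow j) 0 0 0 (tpow l)"

lemma swap1_GL:
  "(swap12 :: 'a::field mat3) \<in> GL pol_ring" "(swap13 :: 'a mat3) \<in> GL pol_ring"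
  "(swap12 :: 'a mat3) \<in> K" "(swap13 :: 'a mat3) \<in> K"
  unfolding swap12_def swap13_def by (intro GL_pol_ring_m3 m3_K; simp add: det_m3)+

lemma swap_diag3:
  "diag3 i j l ** swap12 = swap12 ** diag3 j i l" "diag3 i j l ** swap13 = swap13 ** diag3 l j i"
  "swap12 ** swap12 = mat 1" "swap13 ** swap13 = mat 1"
  by (simp_all add: diag3_def swap12_def swap13_def m3_mult mat_m3)

text \<open>If all residues of the first column vanished, so would that of the determinant;
  \<open>q\<close> moves a unit entry to the corner.\<close>

lemma K_pivot:
  assumes "k \<in> (K :: 'a::field mat3 set)"
  obtains q where "q \<in> {mat 1, swap12, swap13}" "fls_nth ((q ** k) $ 1 $ 1) 0 \<noteq> 0"
proof -
  have kint: "k $ i $ j \<in> int_ring" for i j using assms by (auto simp: GL_def)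
  have "fls_nth (k $ 1 $ 1) 0 \<noteq> 0 \<or> fls_nth (k $ 2 $ 1) 0 \<noteq> 0 \<or> fls_nth (k $ 3 $ 1) 0 \<noteq> 0"
  proof (rule ccontr)
    assume *: "\<not> ?thesis"
    have d: "fls_subdegree (det k) = 0" "det k \<noteq> 0" using GL_int_ring_det assms by auto
    have "fls_nth (det k) 0 = 0"
      using * kint unfolding det_3 by (simp add: int_ring_mult_nth_0 int_ring_mult)
    then show False using d nth_fls_subdegree_nonzero[of "det k"] by simp
  qed
  moreover have "(swap12 ** k) $ 1 $ 1 = k $ 2 $ 1" "(swap13 ** k) $ 1 $ 1 = k $ 3 $ 1"
    by (simp_all add: swap12_def swap13_def matrix_matrix_mult_def sum_3)
  ultimately show ?thesis using that[of "mat 1"] that[of swap12] that[of swap13] by auto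
qed

text \<open>Standard position of a vertex instead of an edge: \<open>K\<close> replaces
  \<open>parahoric\<close>, and all three exponents are free.\<close>

definition vstd :: "'a::field mat3 \<Rightarrow> bool" where
  "vstd A \<longleftrightarrow> (\<exists>s G k i j l. s \<noteq> 0 \<and> G \<in> GL pol_ring \<and> k \<in> K \<and> mat s ** (G ** A ** k) = diag3 i j l)"

lemma diag3_std: "diag3 i j l = mat (tpow (i - 1)) ** std (j - i + 1, l - i + 1)"
  by (simp add: diag3_def std_def mat_m3 m3_mult tpow_add_eq)

lemma ex_step_std: "\<exists>v\<in>sorted_pairs. eqv (std w ** umat c ** Dinv) (std v :: 'a::field mat3)"
proof -
  obtain a b x y where w: "w = (a, b)" "c = (x, y)" by (cases w; cases c)
  show ?thesis
  proof (cases "a \<le> b")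
    case True
    then have "w \<in> sorted_pairs" using w by (simp add: sorted_pairs_def)
    then show ?thesis using step_std nxt_sorted by blast
  next
    case False
    then have "(b, a) \<in> sorted_pairs" by (simp add: sorted_pairs_def)
    then show ?thesis using step_std[of "(b, a)" "(y, x)"] nxt_sorted[of "(b, a)" "(y, x)"] step_std_swap[of a b x y] eqv_trans w
      by blast
  qed
qed

text \<open>The edge of \<open>A\<close> leaves the vertex of \<open>A D\<close>. Once that vertex
  is diagonal, a row permutation \<open>q\<close> and \<open>K_unit_decompose\<close> turn
  \<open>k^-1 D^-1\<close> into a step \<open>umat c ** Dinv\<close> from a standard matrix, whose
  outcome is known.\<close>

lemma vstd_eqv_std:
  assumes A: "invertible (A :: 'a::field mat3)" and v: "vstd (A ** diagX {1})"
  shows "\<exists>v\<in>sorted_pairs. eqv A (std v)"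
proof -
  obtain s G k i j l where s: "s \<noteq> 0" "G \<in> GL pol_ring" "k \<in> K" "mat s ** (G ** (A ** diagX {1}) ** k) = diag3 i j l"
    using v by (auto simp: vstd_def)
  have inv: "invertible G" "invertible k" using s(2,3) by (auto simp: GL_invertible)
  have kK: "inv3 k \<in> K" using s(3) by (rule inv3_GL)
  obtain q where q: "q \<in> {mat 1, swap12, swap13}" "fls_nth ((q ** inv3 k) $ 1 $ 1) 0 \<noteq> 0"
    using K_pivot[OF kK] .
  have qGL: "q \<in> GL pol_ring" "q \<in> K" "q ** q = mat 1"
    using q(1) swap1_GL swap_diag3(3,4) ir.GL_one pr.GL_one by auto
  obtain i' j' l' where d: "diag3 i j l ** q = q ** diag3 i' j' l'"
    using q(1) swap_diag3(1,2) by (metis insertE matrix_mul_lid matrix_mul_rid singletonD)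
  have "q ** inv3 k \<in> K" using qGL kK by (intro ir.GL_mult)
  then obtain c p where c: "p \<in> parahoric" "(q ** inv3 k) ** Dinv = umat c ** Dinv ** p"
    using K_unit_decompose q(2) by metis
  have "mat s ** (G ** A) = mat s ** (G ** (A ** diagX {1}) ** k) ** inv3 k ** Dinv"
    using inv by (simp add: matrix_mul_assoc)
  also have "\<dots> = diag3 i j l ** (q ** q) ** inv3 k ** Dinv"
    unfolding s(4) qGL(3) by simp
  also have "\<dots> = (diag3 i j l ** q) ** ((q ** inv3 k) ** Dinv)" by (simp only: matrix_mul_assoc)
  also have "\<dots> = q ** (diag3 i' j' l' ** umat c ** Dinv) ** p" unfolding d c(2) by (simp only: matrix_mul_assoc)
  finally have e: "mat s ** (G ** A ** mat 1) = q ** (diag3 i' j' l' ** umat c ** Dinv) ** p" by simp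
  let ?w = "(j' - i' + 1, l' - i' + 1)"
  have "eqv A (q ** (diag3 i' j' l' ** umat c ** Dinv) ** p)"
    by (rule eqvI[OF s(2) one_parahoric s(1) e])
  moreover have "eqv (std ?w ** umat c ** Dinv) (q ** (diag3 i' j' l' ** umat c ** Dinv) ** p)"
  proof (rule eqvI[OF qGL(1) c(1), of "tpow (i' - 1)"])
    show "mat (tpow (i' - 1)) ** (q ** (std ?w ** umat c ** Dinv) ** p) = q ** (diag3 i' j' l' ** umat c ** Dinv) ** p"
      unfolding diag3_std by (simp only: matrix_mul_assoc[symmetric] mat_mult_left[of q])
  qed simp
  ultimately show ?thesis using ex_step_std eqv_trans eqv_sym by blast
qed

lemma eqv_std_vstd: "eqv A (std v) \<Longrightarrow> vstd A"
proof -
  assume "eqv A (std v)"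
  then obtain s G p where "s \<noteq> 0" "G \<in> GL pol_ring" "p \<in> parahoric" "std v = mat s ** (G ** A ** p)"
    by (auto simp: eqv_def)
  moreover have "std v = diag3 1 (fst v) (snd v)" by (simp add: std_def diag3_def)
  ultimately show ?thesis unfolding vstd_def parahoric_def by (metis (no_types, lifting) mem_Collect_eq)
qed

lemma vstd_K: assumes "vstd A" "k \<in> K" shows "vstd (A ** k)"
proof -
  obtain s G k' i j l where s: "s \<noteq> 0" "G \<in> GL pol_ring" "k' \<in> K" "mat s ** (G ** A ** k') = diag3 i j l"
    using assms by (auto simp: vstd_def)
  have "invertible k" using assms GL_invertible by blast
  then have "G ** (A ** k) ** (inv3 k ** k') = G ** A ** k'" by (simp add: matrix_mul_assoc)
  moreover have "inv3 k ** k' \<in> K" using s assms by (intro ir.GL_mult inv3_GL)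
  ultimately show ?thesis unfolding vstd_def using s by metis
qed

lemma vstd_mat: assumes "vstd A" "r \<noteq> 0" shows "vstd (A ** mat r)"
proof -
  obtain s G k' i j l where s: "s \<noteq> 0" "G \<in> GL pol_ring" "k' \<in> K" "mat s ** (G ** A ** k') = diag3 i j l"
    using assms by (auto simp: vstd_def)
  have "G ** (A ** mat r) ** k' = mat r ** (G ** A ** k')"
    by (simp only: mat_mult_commute[of r A, symmetric] mat_mult_left[of G] matrix_mul_assoc[symmetric])
  then have "mat (s / r) ** (G ** (A ** mat r) ** k') = diag3 i j l"
    using s assms(2) by (simp add: matrix_mul_assoc mat_mult_mat)
  then show ?thesis unfolding vstd_def using s assms(2) by (metis divide_eq_0_iff)
qed

text \<open>Standard position propagates along edges. With \<open>vstd_K\<close> and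
  \<open>vstd_mat\<close> this lets the connectedness of the building replace a reduction
  algorithm.\<close>

lemma vstd_Dinv: assumes "invertible A" "vstd A" shows "vstd (A ** Dinv)"
proof -
  have "A ** Dinv ** diagX {1} = A" by simp
  then obtain v where "eqv (A ** Dinv) (std v)"
    using vstd_eqv_std[of "A ** Dinv"] assms by (auto simp: invertible_mult)
  then show ?thesis by (rule eqv_std_vstd)
qed

lemma det_diag3 [simp]: "det (diag3 i j l :: 'a::field mat3) \<noteq> 0"
  by (simp add: diag3_def det_m3)

lemma invertible_diag3 [simp]: "invertible (diag3 i j l)"
  by (simp add: invertible_det_nz)

lemma diag3_mult: "diag3 i j l ** diag3 i' j' l' = diag3 (i + i') (j + j') (l + l')"
  by (simp add: diag3_def m3_mult tpow_add)

lemma vstd_diag3_unit: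
  assumes "invertible (A :: 'a::field mat3)" "vstd A"
  shows "vstd (A ** diag3 1 0 0)" "vstd (A ** diag3 0 1 0)" "vstd (A ** diag3 0 0 1)"
proof -
  have D: "diag3 1 0 0 = Dinv" by (simp add: diag3_def inv3_diagX1)
  show "vstd (A ** diag3 1 0 0)" unfolding D by (rule vstd_Dinv[OF assms])
  have "diag3 0 1 0 = swap12 ** Dinv ** (swap12 :: 'a mat3)" "diag3 0 0 1 = swap13 ** Dinv ** (swap13 :: 'a mat3)"
    by (simp_all add: diag3_def inv3_diagX1 swap12_def swap13_def m3_mult)
  then have e: "A ** diag3 0 1 0 = A ** swap12 ** Dinv ** swap12" "A ** diag3 0 0 1 = A ** swap13 ** Dinv ** swap13"
    by (simp_all only: matrix_mul_assoc)
  show "vstd (A ** diag3 0 1 0)" "vstd (A ** diag3 0 0 1)"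
    unfolding e using assms swap1_GL
    by (auto intro!: vstd_K vstd_Dinv invertible_mult intro: GL_invertible[OF swap1_GL(3)] GL_invertible[OF swap1_GL(4)])
qed

lemma vstd_diag3_nat:
  assumes "invertible (A :: 'a::field mat3)" "vstd A" shows "vstd (A ** diag3 (int i) (int j) (int l))"
proof (induction i)
  case 0
  show ?case
  proof (induction j)
    case 0
    show ?case
    proof (induction l)
      case 0
      have "diag3 0 0 0 = (mat 1 :: 'a mat3)" by (simp add: diag3_def mat_m3)
      then show ?case using assms by simp
    next
      case (Suc l)
      have "A ** diag3 (int 0) (int 0) (int (Suc l)) = A ** diag3 (int 0) (int 0) (int l) ** diag3 0 0 1"
        by (simp add: diag3_mult add.commute flip: matrix_mul_assoc)
      then show ?case using vstd_diag3_unit(3)[OF _ Suc] assms by (simp only: invertible_mult invertible_diag3 simp_thms)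
    qed
  next
    case (Suc j)
    have "A ** diag3 (int 0) (int (Suc j)) (int l) = A ** diag3 (int 0) (int j) (int l) ** diag3 0 1 0"
      by (simp add: diag3_mult add.commute flip: matrix_mul_assoc)
    then show ?case using vstd_diag3_unit(2)[OF _ Suc] assms by (simp only: invertible_mult invertible_diag3 simp_thms)
  qed
next
  case (Suc i)
  have "A ** diag3 (int (Suc i)) (int j) (int l) = A ** diag3 (int i) (int j) (int l) ** diag3 1 0 0"
    by (simp add: diag3_mult add.commute flip: matrix_mul_assoc)
  then show ?case using vstd_diag3_unit(1)[OF _ Suc] assms by (simp only: invertible_mult invertible_diag3 simp_thms)
qed

lemma vstd_diag3:
  assumes "invertible (A :: 'a::field mat3)" "vstd A" shows "vstd (A ** diag3 i j l)"
proof -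
  \<comment> \<open>Adding \<open>N\<close> makes all exponents nonnegative; the scalar
    \<open>tpow (- N)\<close> undoes it.\<close>
  define N where "N = \<bar>i\<bar> + \<bar>j\<bar> + \<bar>l\<bar>"
  have "vstd (A ** diag3 (int (nat (i + N))) (int (nat (j + N))) (int (nat (l + N))) ** mat (tpow (- N)))"
    by (intro vstd_mat vstd_diag3_nat assms) simp
  moreover have "int (nat (i + N)) = i + N" "int (nat (j + N)) = j + N" "int (nat (l + N)) = l + N"
    by (auto simp: N_def)
  moreover have "diag3 (i + N) (j + N) (l + N) ** mat (tpow (- N)) = (diag3 i j l :: 'a mat3)"
    by (simp add: diag3_def mat_m3 m3_mult tpow_add_eq)
  ultimately show ?thesis by (simp only: matrix_mul_assoc[symmetric])
qed

lemma pivot_row: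
  fixes x y z :: "'a::field fls"
  assumes "x \<noteq> 0 \<or> y \<noteq> 0 \<or> z \<noteq> 0"
  shows "(x \<noteq> 0 \<and> y / x \<in> int_ring \<and> z / x \<in> int_ring) \<or> (y \<noteq> 0 \<and> x / y \<in> int_ring \<and> z / y \<in> int_ring) \<or>
     (z \<noteq> 0 \<and> x / z \<in> int_ring \<and> y / z \<in> int_ring)"
proof -
  have q: "f / g \<in> int_ring" if "g \<noteq> 0" "f = 0 \<or> fls_subdegree g \<le> fls_subdegree f" for f g :: "'a fls"
    using that by (cases "f = 0") (auto simp: int_ring_subdegree fls_divide_subdegree)
  define a b c where "a = fls_subdegree x" "b = fls_subdegree y" "c = fls_subdegree z"
  note abc = this
  have "(x \<noteq> 0 \<and> (y = 0 \<or> a \<le> b) \<and> (z = 0 \<or> a \<le> c)) \<or> (y \<noteq> 0 \<and> (x = 0 \<or> b \<le> a) \<and> (z = 0 \<or> b \<le> c)) \<or>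
      (z \<noteq> 0 \<and> (x = 0 \<or> c \<le> a) \<and> (y = 0 \<or> c \<le> b))"
    using assms by (cases "x = 0"; cases "y = 0"; cases "z = 0") (simp_all; linarith)+
  then show ?thesis unfolding abc using q by blast
qed

lemma K_shear: "y \<in> int_ring \<Longrightarrow> z \<in> int_ring \<Longrightarrow> w \<in> int_ring \<Longrightarrow> m3 1 y z 0 1 w 0 0 1 \<in> K"
  by (rule m3_K) (simp_all add: det_m3)

text \<open>Iwasawa decomposition by column operations: the entry of least valuation in a row serves
  as pivot, so that the quotients are integral.\<close>

lemma K_triangular:
  assumes "invertible (A :: 'a::field mat3)"
  shows "\<exists>k\<in>K. (A ** k) $ 1 $ 2 = 0 \<and> (A ** k) $ 1 $ 3 = 0 \<and> (A ** k) $ 2 $ 3 = 0"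
proof -
  have dA: "det A \<noteq> 0" using assms by (simp add: invertible_det_nz)
  have shear: "\<exists>k\<in>K. (A ** q ** k) $ 1 $ 2 = 0 \<and> (A ** q ** k) $ 1 $ 3 = 0"
    if "(A ** q) $ 1 $ 1 \<noteq> 0" "(A ** q) $ 1 $ 2 / (A ** q) $ 1 $ 1 \<in> int_ring" "(A ** q) $ 1 $ 3 / (A ** q) $ 1 $ 1 \<in> int_ring" for q
  proof -
    let ?k = "m3 1 (- ((A ** q) $ 1 $ 2 / (A ** q) $ 1 $ 1)) (- ((A ** q) $ 1 $ 3 / (A ** q) $ 1 $ 1)) 0 1 0 0 0 1"
    have "?k \<in> K" using that by (intro K_shear int_ring_uminus) auto
    moreover have "(A ** q ** ?k) $ 1 $ 2 = 0" "(A ** q ** ?k) $ 1 $ 3 = 0"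
      using that(1) by (simp_all add: matrix_matrix_mult_def[of "A ** q"] sum_3)
    ultimately show ?thesis by blast
  qed
  have sw: "(A ** swap12) $ 1 $ 1 = A $ 1 $ 2" "(A ** swap12) $ 1 $ 2 = A $ 1 $ 1" "(A ** swap12) $ 1 $ 3 = A $ 1 $ 3"
    "(A ** swap13) $ 1 $ 1 = A $ 1 $ 3" "(A ** swap13) $ 1 $ 2 = A $ 1 $ 2" "(A ** swap13) $ 1 $ 3 = A $ 1 $ 1"
    by (simp_all add: matrix_matrix_mult_def sum_3 swap12_def swap13_def)
  have "A $ 1 $ 1 \<noteq> 0 \<or> A $ 1 $ 2 \<noteq> 0 \<or> A $ 1 $ 3 \<noteq> 0" using dA by (auto simp: det_3)
  then have "\<exists>q\<in>{mat 1, swap12, swap13}. (A ** q) $ 1 $ 1 \<noteq> 0 \<and> (A ** q) $ 1 $ 2 / (A ** q) $ 1 $ 1 \<in> int_ring \<and> (A ** q) $ 1 $ 3 / (A ** q) $ 1 $ 1 \<in> int_ring"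
    using pivot_row by (auto simp: sw)
  then obtain q k where q: "q \<in> K" "k \<in> K" "(A ** q ** k) $ 1 $ 2 = 0" "(A ** q ** k) $ 1 $ 3 = 0"
    using shear swap1_GL ir.GL_one by (metis (no_types, lifting) empty_iff insert_iff)
  define B where "B = A ** q ** k"
  have B: "B $ 1 $ 2 = 0" "B $ 1 $ 3 = 0" using q by (simp_all add: B_def)
  have "\<exists>k'\<in>K. (B ** k') $ 1 $ 2 = 0 \<and> (B ** k') $ 1 $ 3 = 0 \<and> (B ** k') $ 2 $ 3 = 0"
  proof -
    consider "B $ 2 $ 3 = 0" | "B $ 2 $ 2 \<noteq> 0" "B $ 2 $ 3 / B $ 2 $ 2 \<in> int_ring" | "B $ 2 $ 3 \<noteq> 0" "B $ 2 $ 2 / B $ 2 $ 3 \<in> int_ring"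
      using pivot_row[of "B $ 2 $ 2" "B $ 2 $ 3" 0] by auto
    then show ?thesis
    proof cases
      case 1 then show ?thesis using B ir.GL_one by (intro bexI[of _ "mat 1"]) auto
    next
      case 2
      let ?k = "m3 1 0 0 0 1 (- (B $ 2 $ 3 / B $ 2 $ 2)) 0 0 1"
      have "?k \<in> K" using 2 by (intro K_shear int_ring_uminus) auto
      then show ?thesis using B 2 by (intro bexI[of _ ?k]) (simp_all add: matrix_matrix_mult_def[of B] sum_3)
    next
      case 3
      let ?k = "m3 1 0 0 0 0 1 0 1 (- (B $ 2 $ 2 / B $ 2 $ 3))"
      have "?k \<in> K" using 3 by (intro m3_K int_ring_uminus) (auto simp: det_m3)
      then show ?thesis using B 3 by (intro bexI[of _ ?k]) (simp_all add: matrix_matrix_mult_def[of B] sum_3)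
    qed
  qed
  then obtain k' where k': "k' \<in> K" "(B ** k') $ 1 $ 2 = 0" "(B ** k') $ 1 $ 3 = 0" "(B ** k') $ 2 $ 3 = 0" by blast
  have "q ** k ** k' \<in> K" using q k' by (intro ir.GL_mult)
  moreover have "A ** (q ** k ** k') = B ** k'" by (simp add: B_def matrix_mul_assoc)
  ultimately show ?thesis using k' by metis
qed

lemma fls_unit_factor: assumes "f \<noteq> 0" shows "\<exists>i u. f = tpow i * u \<and> u \<noteq> 0 \<and> fls_subdegree u = 0"
proof (intro exI conjI)
  let ?u = "tpow (fls_subdegree f) * f"
  show "f = tpow (- fls_subdegree f) * ?u" by (simp add: tpow_mult_assoc)
  show "?u \<noteq> 0" "fls_subdegree ?u = 0" using assms by simp_all
qed

text \<open>From the identity, \<open>A\<close> is reached by right multiplication with diagonal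
  matrices and elements of \<open>K\<close>: the lower unipotent factor becomes integral after
  conjugation with \<open>diag(1, t^n, t^(2n))\<close> for large \<open>n\<close>.\<close>

lemma vstd_all: assumes "invertible (A :: 'a::field mat3)" shows "vstd A"
proof -
  obtain k where k: "k \<in> K" "(A ** k) $ 1 $ 2 = 0" "(A ** k) $ 1 $ 3 = 0" "(A ** k) $ 2 $ 3 = 0"
    using K_triangular[OF assms] by blast
  have ik: "invertible k" using k GL_invertible by blast
  define x a y b c z where "x = (A ** k) $ 1 $ 1" "a = (A ** k) $ 2 $ 1" "y = (A ** k) $ 2 $ 2"
    "b = (A ** k) $ 3 $ 1" "c = (A ** k) $ 3 $ 2" "z = (A ** k) $ 3 $ 3"
  note defs = this
  have Ak: "A ** k = m3 x 0 0 a y 0 b c z" by (subst m3_eta) (simp add: defs k)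
  have "det (A ** k) \<noteq> 0" using assms ik by (metis invertible_det_nz invertible_mult)
  then have nz: "x \<noteq> 0" "y \<noteq> 0" "z \<noteq> 0" by (auto simp: Ak det_m3)
  obtain i j l ux uy uz where u: "x = tpow i * ux" "ux \<noteq> 0" "fls_subdegree ux = 0"
    "y = tpow j * uy" "uy \<noteq> 0" "fls_subdegree uy = 0" "z = tpow l * uz" "uz \<noteq> 0" "fls_subdegree uz = 0"
    using fls_unit_factor nz by metis
  \<comment> \<open>The absolute values make \<open>n\<close> nonnegative, so that
    \<open>2 * n\<close> suffices for \<open>b / x\<close> as well.\<close>
  define n where "n = \<bar>fls_subdegree (a / x)\<bar> + \<bar>fls_subdegree (b / x)\<bar> + \<bar>fls_subdegree (c / y)\<bar>"
  have sh: "f * tpow (- m) \<in> int_ring" if "- fls_subdegree f \<le> m" for f :: "'a fls" and m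
    using that by (cases "f = 0") (auto simp: int_ring_subdegree)
  have n: "- fls_subdegree (a / x) \<le> n" "- fls_subdegree (b / x) \<le> 2 * n" "- fls_subdegree (c / y) \<le> n"
    unfolding n_def
    using abs_ge_minus_self[of "fls_subdegree (a / x)"] abs_ge_minus_self[of "fls_subdegree (b / x)"]
      abs_ge_minus_self[of "fls_subdegree (c / y)"] abs_ge_zero[of "fls_subdegree (a / x)"]
      abs_ge_zero[of "fls_subdegree (b / x)"] abs_ge_zero[of "fls_subdegree (c / y)"]
    by (simp_all only: distrib_left mult_2)
  let ?N = "m3 1 0 0 (a / x * tpow (- n)) 1 0 (b / x * tpow (- (2 * n))) (c / y * tpow (- n)) 1"
  have NK: "?N \<in> K" using n by (intro m3_K sh) (auto simp: det_m3)
  let ?u = "m3 ux 0 0 0 uy 0 0 0 uz"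
  have uK: "?u \<in> K" using u by (intro m3_K) (auto simp: det_m3 int_ring_subdegree)
  have e1: "diag3 i j l ** ?u = m3 x 0 0 0 y 0 0 0 z"
    by (simp add: diag3_def m3_mult u)
  have "diag3 0 n (2 * n) ** ?N ** diag3 0 (- n) (- (2 * n)) = m3 1 0 0 (a / x) 1 0 (b / x) (c / y) 1"
    by (simp add: diag3_def m3_mult mult.left_commute[of "tpow n"] mult.left_commute[of "tpow (2 * n)"] mult.assoc tpow_add_eq flip: tpow_add)
  then have "A ** k = diag3 0 n (2 * n) ** ?N ** diag3 0 (- n) (- (2 * n)) ** (diag3 i j l ** ?u)"
    using nz by (simp add: e1 Ak m3_mult)
  then have "A = mat 1 ** diag3 0 n (2 * n) ** ?N ** diag3 0 (- n) (- (2 * n)) ** diag3 i j l ** ?u ** inv3 k"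
    using inv3_cancel(3)[OF ik, of A] by (simp add: matrix_mul_assoc)
  moreover have "vstd (mat 1 ** diag3 0 n (2 * n) ** ?N ** diag3 0 (- n) (- (2 * n)) ** diag3 i j l ** ?u ** inv3 k)"
  proof -
    have "mat 1 ** (mat 1 ** mat 1 ** mat 1) = (diag3 0 0 0 :: 'a mat3)" by (simp add: diag3_def mat_m3 m3_mult)
    then have "vstd (mat 1 :: 'a mat3)" unfolding vstd_def
      using pr.GL_one ir.GL_one one_neq_zero by blast
    moreover have iN: "invertible ?N" using NK GL_invertible by blast
    moreover have "invertible (mat 1 :: 'a mat3)" by (simp add: invertible_mat3)
    ultimately show ?thesis
      using NK uK inv3_GL[OF k(1)] by (intro vstd_K vstd_diag3 invertible_mult) auto
  qed
  ultimately show ?thesis by simp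
qed

lemma ex_eqv_std: "invertible (A :: 'a::field mat3) \<Longrightarrow> \<exists>v\<in>sorted_pairs. eqv A (std v)"
  by (intro vstd_eqv_std vstd_all invertible_mult) auto


section \<open>Transition numbers and duality of types\<close>

definition std_orbit :: "int \<times> int \<Rightarrow> 'a::finite_field edge set" where
  "std_orbit v = orbit (edge (std v))"

lemma edge_orbits_1: "edge_orbits PGL3_poly 1 = (std_orbit ` sorted_pairs :: 'a::finite_field edge set set)"
proof (intro equalityI subsetI)
  fix x :: "'a edge set" assume "x \<in> edge_orbits PGL3_poly 1"
  then obtain A :: "'a mat3" where A: "invertible A" "x = orbit (edge A)"
    unfolding edge_orbits_def typed_edges_1 by blast
  then obtain v where "v \<in> sorted_pairs" "eqv A (std v)" using ex_eqv_std by blast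
  then show "x \<in> std_orbit ` sorted_pairs"
    using A orbit_eq_iff[of A "std v"] by (auto simp: std_orbit_def)
next
  fix x :: "'a edge set" assume "x \<in> std_orbit ` sorted_pairs"
  then obtain v where "x = orbit (edge (std v))" by (auto simp: std_orbit_def)
  moreover have "edge (std v) \<in> (typed_edges 1 :: 'a edge set)" unfolding typed_edges_1 using invertible_std by blast
  ultimately show "x \<in> edge_orbits PGL3_poly 1" unfolding edge_orbits_def by blast
qed

lemma inj_std_orbit: "inj_on (std_orbit :: _ \<Rightarrow> 'a::finite_field edge set) sorted_pairs"
proof (rule inj_onI)
  fix v w assume vw: "v \<in> sorted_pairs" "w \<in> sorted_pairs" "std_orbit v = (std_orbit w :: 'a edge set)"
  then have "eqv (std v) (std w :: 'a mat3)"
    using orbit_eq_iff[OF invertible_std invertible_std, of v w, where 'a = 'a] by (simp only: std_orbit_def)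
  then show "v = w" using eqv_std_unique vw by blast
qed

text \<open>The lift \<open>l\<close> is arbitrary since \<open>edge_weight\<close> picks one by
  \<open>SOME\<close>. It is a translate of the standard lift by some \<open>G\<close>, and left
  translation does not change the orbits of the successors.\<close>

lemma card_successors:
  assumes v: "v \<in> sorted_pairs" "v' \<in> sorted_pairs" and l: "l \<in> (std_orbit v :: 'a::finite_field edge set)"
  shows "card {d \<in> std_orbit v'. geodesic_path 1 [l, d]} = card {c :: 'a \<times> 'a. nxt v c = v'}"
proof -
  obtain G where G: "G \<in> GL pol_ring" "l = edge (G ** std v)"
    using l unfolding std_orbit_def orbit_edge by blast
  define A where "A = G ** (std v :: 'a mat3)"
  have A: "invertible A" using G(1) by (simp add: A_def invertible_mult GL_invertible)
  have mem: "edge (A ** umat c ** Dinv) \<in> std_orbit v' \<longleftrightarrow> nxt v c = v'" for c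
  proof -
    have "eqv (std v ** umat c ** Dinv) (A ** umat c ** Dinv)"
      by (rule eqvI[OF G(1) one_parahoric, of 1]) (simp_all add: A_def matrix_mul_assoc)
    then have e: "eqv (std (nxt v c)) (A ** umat c ** Dinv)"
      using step_std[OF v(1)] eqv_sym eqv_trans by blast
    have "invertible (A ** umat c ** Dinv)" using A by (simp add: invertible_mult)
    then have "edge (A ** umat c ** Dinv) \<in> std_orbit v' \<longleftrightarrow> eqv (std v') (A ** umat c ** Dinv)"
      unfolding std_orbit_def by (intro mem_orbit_iff) simp
    also have "\<dots> \<longleftrightarrow> eqv (std v') (std (nxt v c) :: 'a mat3)" using e eqv_sym eqv_trans by blast
    also have "\<dots> \<longleftrightarrow> nxt v c = v'" using eqv_std_unique[OF v(2) nxt_sorted[OF v(1)]] eqv_refl by metis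
    finally show ?thesis .
  qed
  have "{d \<in> std_orbit v'. geodesic_path 1 [l, d]} = std_orbit v' \<inter> range (\<lambda>c. edge (A ** umat c ** Dinv))"
    using geodesic_successors[OF A] G by (auto simp: A_def)
  also have "\<dots> = (\<lambda>c. edge (A ** umat c ** Dinv)) ` {c. nxt v c = v'}"
    using mem by blast
  finally show ?thesis
    using inj_successors[OF A] by (simp only: card_image inj_on_subset[OF _ subset_UNIV])
qed

lemma mem_std_orbit: "edge (std v) \<in> std_orbit v"
  unfolding std_orbit_def by (subst mem_orbit_iff) (auto intro: eqv_refl)

lemma edge_weight_1:
  assumes "v \<in> sorted_pairs" "v' \<in> sorted_pairs"
  shows "edge_weight 1 (std_orbit v) (std_orbit v' :: 'a::finite_field edge set) = card {c :: 'a \<times> 'a. nxt v c = v'}"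
proof -
  have "(SOME l. l \<in> (std_orbit v :: 'a edge set)) \<in> std_orbit v" using mem_std_orbit by (rule someI)
  then show ?thesis unfolding edge_weight_def by (rule card_successors[OF assms])
qed

section \<open>Dual lattices and the exchange of the two types\<close>

definition dual :: "('a::field fls ^ 3) set \<Rightarrow> ('a fls ^ 3) set" where
  "dual L = {w. \<forall>v\<in>L. (\<Sum>i\<in>UNIV. w $ i * v $ i) \<in> int_ring}"

definition cotr :: "'a::field mat3 \<Rightarrow> 'a mat3" where
  "cotr A = transpose (inv3 A)"

lemma cotr_invertible: "invertible A \<Longrightarrow> invertible (cotr A)"
  using inv3_invertible[of A] by (simp add: cotr_def invertible_det_nz)

lemma cotr_cotr [simp]: "invertible A \<Longrightarrow> cotr (cotr A) = A"
  by (simp add: cotr_def inv3_transpose inv3_invertible)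

lemma cotr_mult: "invertible A \<Longrightarrow> invertible B \<Longrightarrow> cotr (A ** B) = cotr A ** cotr B"
  by (simp add: cotr_def inv3_mult matrix_transpose_mul)

lemma cotr_mat: "s \<noteq> 0 \<Longrightarrow> cotr (mat s) = mat (inverse s)"
  by (simp add: cotr_def inv3_mat transpose_mat)

lemma cotr_diagX1: "cotr (diagX {1}) = Dinv"
  unfolding cotr_def inv3_diagX1 by (simp add: transpose_m3)

lemma cotr_GL: "G \<in> GL S \<Longrightarrow> cotr G \<in> GL S"
  unfolding cotr_def by (intro GL_transpose inv3_GL)

text \<open>Adjunction moves \<open>A\<close> to the other side of the pairing; integrality against
  \<open>O^3\<close> is then tested on unit vectors.\<close>

lemma dual_lat:
  assumes A: "invertible (A :: 'a::field mat3)" shows "dual (lat A) = lat (cotr A)"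
proof -
  have pair: "(\<Sum>i\<in>UNIV. w $ i * (A *v x) $ i) = (\<Sum>j\<in>UNIV. (transpose A *v w) $ j * x $ j)" for w x
    unfolding sum_3 by (simp add: matrix_vector_mult_def transpose_def sum_3 algebra_simps)
  have inv: "inv3 (cotr A) = transpose A" using A by (simp add: cotr_def inv3_transpose inv3_invertible)
  have "w \<in> dual (lat A) \<longleftrightarrow> transpose A *v w \<in> O3" for w
  proof
    assume w: "w \<in> dual (lat A)"
    have "(transpose A *v w) $ j \<in> int_ring" for j
    proof -
      have "(\<Sum>i\<in>UNIV. (transpose A *v w) $ i * axis j 1 $ i) \<in> int_ring"
        using w axis_O3[of j] unfolding pair[symmetric] by (auto simp: dual_def lat_def)
      then show ?thesis by (simp add: axis_def if_distrib cong: if_cong)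
    qed
    then show "transpose A *v w \<in> O3" by (simp add: O3_def)
  next
    assume "transpose A *v w \<in> O3"
    then show "w \<in> dual (lat A)"
      by (auto simp: dual_def lat_def pair O3_def intro!: ir.Ssum int_ring_mult)
  qed
  then show ?thesis using mem_lat[OF cotr_invertible[OF A]] inv by auto
qed

definition dvx :: "'a::field vertex \<Rightarrow> 'a vertex" where
  "dvx x = dual ` x"

lemma dvx_vx:
  assumes A: "invertible (A :: 'a::field mat3)" shows "dvx (vx A) = vx (cotr A)"
proof -
  have d: "dual (lat (mat s ** A)) = lat (mat (inverse s) ** cotr A)" if "s \<noteq> 0" for s
    using A that by (simp add: dual_lat invertible_mat_mult cotr_mult invertible_mat3 cotr_mat)
  have "L \<in> dvx (vx A) \<longleftrightarrow> L \<in> vx (cotr A)" for L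
  proof
    assume "L \<in> dvx (vx A)"
    then obtain s where "s \<noteq> 0" "L = dual (lat (mat s ** A))" unfolding dvx_def by (auto simp: mem_vx)
    then show "L \<in> vx (cotr A)" unfolding mem_vx using d by (intro exI[of _ "inverse s"]) simp
  next
    assume "L \<in> vx (cotr A)"
    then obtain s where s: "s \<noteq> 0" "L = lat (mat s ** cotr A)" by (auto simp: mem_vx)
    then have "L = dual (lat (mat (inverse s) ** A))" using d[of "inverse s"] by simp
    moreover have "lat (mat (inverse s) ** A) \<in> vx A"
      unfolding mem_vx using s(1) by (intro exI[of _ "inverse s"]) simp
    ultimately show "L \<in> dvx (vx A)" unfolding dvx_def by blast
  qed
  then show ?thesis by blast
qed

lemma dual_antimono: "L \<subseteq> M \<Longrightarrow> dual M \<subseteq> dual L"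
  by (auto simp: dual_def)

lemma dual_strict:
  assumes "lat A \<subset> lat B" "invertible A" "invertible B" shows "dual (lat B) \<subset> dual (lat A)"
proof -
  have "dual (dual (lat A)) = lat A" "dual (dual (lat B)) = lat B"
    using assms by (simp_all add: dual_lat cotr_invertible)
  then have "dual (lat B) \<noteq> dual (lat A)" using assms(1) by force
  moreover have "dual (lat B) \<subseteq> dual (lat A)" using assms(1) by (intro dual_antimono) blast
  ultimately show ?thesis by blast
qed

text \<open>Duality reverses the chain, and scaling by the uniformizer closes it up again, so the
  first and the third lattice exchange their roles.\<close>

lemma chamber_dual:
  assumes "chamber C" shows "chamber (dvx ` C)"
proof -
  obtain x y z L1 L2 L3 where C: "C = {x, y, z}" "x \<in> vertices" "y \<in> vertices" "z \<in> vertices"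
    "L1 \<in> x" "L2 \<in> y" "L3 \<in> z" "scale fls_X L1 \<subset> L3" "L3 \<subset> L2" "L2 \<subset> L1"
    using assms unfolding chamber_def by metis
  have rep: "\<exists>A. invertible A \<and> L = lat A \<and> x = vx A" if "x \<in> vertices" "L \<in> x" for x and L :: "('a fls^3) set"
  proof -
    obtain A where A: "invertible A" "x = vx A" using \<open>x \<in> vertices\<close> by (auto simp: vertices_eq)
    then obtain s where "s \<noteq> 0" "L = lat (mat s ** A)" using \<open>L \<in> x\<close> by (auto simp: mem_vx)
    then show ?thesis using A by (intro exI[of _ "mat s ** A"]) (simp add: invertible_mat_mult vx_mat)
  qed
  obtain A1 A2 A3 where A: "invertible A1" "L1 = lat A1" "x = vx A1" "invertible A2" "L2 = lat A2" "y = vx A2"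
    "invertible A3" "L3 = lat A3" "z = vx A3"
    using rep C(2-7) by metis
  have inv1: "invertible (mat fls_X ** A1)" using A by (simp add: invertible_mat_mult)
  have s: "dual L1 \<subset> dual L2" "dual L2 \<subset> dual L3" "dual L3 \<subset> dual (scale fls_X L1)"
    using C(8-10) A inv1 dual_strict[of A2 A1] dual_strict[of A3 A2] dual_strict[of "mat fls_X ** A1" A3]
    by (simp_all only: scale_lat)
  have sd: "scale fls_X (dual (scale fls_X L1)) = dual L1"
    using A inv1 by (simp add: scale_lat dual_lat cotr_mult invertible_mat3 cotr_mat matrix_mul_assoc mat_mult_mat)
  have "scale fls_X (dual L3) \<subset> scale fls_X (dual (scale fls_X L1))"
  proof -
    have "inj (\<lambda>v :: 'a fls ^ 3. fls_X *s v)" by (rule injI) (simp add: vec_eq_iff)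
    then show ?thesis using s(3) unfolding scale_def by (simp add: image_strict_mono inj_on_subset)
  qed
  then have "scale fls_X (dual L3) \<subset> dual L1" using sd by simp
  moreover have "dvx x \<in> vertices" "dvx y \<in> vertices" "dvx z \<in> vertices"
    using A by (simp_all add: dvx_vx vx_in_vertices cotr_invertible)
  moreover have "dual L1 \<in> dvx x" "dual L2 \<in> dvx y" "dual L3 \<in> dvx z" using C(5-7) by (auto simp: dvx_def)
  ultimately have "chamber {dvx z, dvx y, dvx x}" using s(1,2)
    by (metis chamberI[of "dvx z" "dvx y" "dvx x" "dual L3" "dual L2" "dual L1"])
  then show ?thesis unfolding C(1) by (simp add: insert_commute)
qed

lemma dvx_dvx: "x \<in> vertices \<Longrightarrow> dvx (dvx x) = x"
  by (auto simp: vertices_eq dvx_vx cotr_invertible)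

lemma chamber_dual_iff:
  assumes "C \<subseteq> vertices" shows "chamber (dvx ` C) \<longleftrightarrow> chamber C"
proof -
  have "dvx ` dvx ` C = C" using assms dvx_dvx by (force simp: image_image)
  then show ?thesis using chamber_dual by metis
qed

definition dedge :: "'a::field edge \<Rightarrow> 'a edge" where
  "dedge e = (dvx (fst e), dvx (snd e))"

text \<open>With \<open>A' = cotr A\<close> the dual of the reversed edge runs from the vertex of
  \<open>A'\<close> to that of \<open>A' D^-1\<close>, which is an edge of type 1.\<close>

lemma dedge_swap: "invertible A \<Longrightarrow> dedge (prod.swap (edge A)) = edge (cotr A ** Dinv)"
  by (simp add: dedge_def edge_def dvx_vx cotr_mult invertible_mult cotr_diagX1)

lemma typed_edges_2_dual: "(e :: 'a::finite_field edge) \<in> typed_edges 2 \<Longrightarrow> dedge e \<in> typed_edges 1"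
proof -
  assume "e \<in> typed_edges 2"
  then obtain A :: "'a mat3" where "invertible A" "e = prod.swap (edge A)" unfolding typed_edges_2 by blast
  moreover from this have "invertible (cotr A ** Dinv)" by (simp add: invertible_mult cotr_invertible)
  ultimately show ?thesis unfolding typed_edges_1 using dedge_swap by blast
qed

lemma typed_edges_vertices: "e \<in> typed_edges k \<Longrightarrow> fst e \<in> vertices \<and> snd e \<in> vertices"
  unfolding typed_edges_def directed_edges_def chamber_def by fastforce

lemma inj_dedge: "inj_on dedge (typed_edges k)"
proof (rule inj_onI)
  fix e d :: "'a edge" assume "e \<in> typed_edges k" "d \<in> typed_edges k" "dedge e = dedge d"
  then show "e = d" using typed_edges_vertices dvx_dvx unfolding dedge_def prod_eq_iff
    by (metis fst_conv snd_conv)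
qed

lemma geodesic_dual:
  assumes "e \<in> typed_edges 2" "d \<in> typed_edges 2"
  shows "geodesic_path 1 [dedge e, dedge d] \<longleftrightarrow> geodesic_path 2 [e, d]"
proof -
  have v: "fst e \<in> vertices" "snd e \<in> vertices" "fst d \<in> vertices" "snd d \<in> vertices"
    using typed_edges_vertices assms by blast+
  have "chamber (dvx ` {fst e, snd e, snd d}) \<longleftrightarrow> chamber {fst e, snd e, snd d}"
    using v by (intro chamber_dual_iff) auto
  moreover have "dvx (snd e) = dvx (fst d) \<longleftrightarrow> snd e = fst d" using v dvx_dvx by metis
  ultimately show ?thesis
    unfolding geodesic_path_2 using assms typed_edges_2_dual[OF assms(1)] typed_edges_2_dual[OF assms(2)]
    by (simp add: dedge_def del: One_nat_def)
qed

lemma orbit_swap: "orbit (prod.swap (edge A)) = {prod.swap (edge (G ** A)) | G. G \<in> GL pol_ring}"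
proof -
  have "act_edge h (prod.swap e) = prod.swap (act_edge h e)" for h and e :: "'a edge"
    by (simp add: act_edge_def)
  then have "orbit (prod.swap (edge A)) = {prod.swap (act_edge (proj_class G) (edge A)) | G. G \<in> GL pol_ring}"
    unfolding PGL3_poly_eq by auto
  then show ?thesis by (simp only: act_edge_edge)
qed

lemma dedge_orbit:
  assumes A: "invertible A"
  shows "dedge ` orbit (prod.swap (edge A)) = orbit (edge (cotr A ** Dinv))"
proof -
  have e: "dedge (prod.swap (edge (G ** A))) = edge (cotr G ** (cotr A ** Dinv))" if "G \<in> GL pol_ring" for G
    using A GL_invertible[OF that] by (simp add: dedge_swap invertible_mult cotr_mult matrix_mul_assoc)
  have cc: "cotr (cotr G) = G" if "G \<in> GL pol_ring" for G :: "'a mat3" using GL_invertible[OF that] by simp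
  show ?thesis
  proof (intro equalityI subsetI)
    fix d assume "d \<in> dedge ` orbit (prod.swap (edge A))"
    then obtain G where "G \<in> GL pol_ring" "d = edge (cotr G ** (cotr A ** Dinv))"
      unfolding orbit_swap using e by blast
    then show "d \<in> orbit (edge (cotr A ** Dinv))" unfolding orbit_edge using cotr_GL by blast
  next
    fix d assume "d \<in> orbit (edge (cotr A ** Dinv))"
    then obtain G where G: "G \<in> GL pol_ring" "d = edge (G ** (cotr A ** Dinv))" unfolding orbit_edge by blast
    then have "d = dedge (prod.swap (edge (cotr G ** A)))" using e[OF cotr_GL[OF G(1)]] cc by simp
    then show "d \<in> dedge ` orbit (prod.swap (edge A))"
      unfolding orbit_swap using cotr_GL[OF G(1)] by blast
  qed
qed

text \<open>Chosen so that \<open>dedge\<close> maps it onto \<open>std_orbit v\<close>; the factor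
  \<open>diagX {1}\<close> compensates the \<open>Dinv\<close> in \<open>dedge_swap\<close>.\<close>

definition std_orbit2 :: "int \<times> int \<Rightarrow> 'a::finite_field edge set" where
  "std_orbit2 v = orbit (prod.swap (edge (cotr (std v ** diagX {1}))))"

lemma std_orbit2_typed: "(std_orbit2 v :: 'a::finite_field edge set) \<subseteq> typed_edges 2"
proof
  fix e :: "'a edge" assume "e \<in> std_orbit2 v"
  then obtain G where G: "G \<in> GL pol_ring" "e = prod.swap (edge (G ** cotr (std v ** diagX {1})))"
    unfolding std_orbit2_def orbit_swap by blast
  have "invertible (G ** cotr (std v ** diagX {1}))"
    using G(1) by (simp add: invertible_mult GL_invertible cotr_invertible)
  then show "e \<in> typed_edges 2" unfolding typed_edges_2 G(2) by blast
qed

lemma dedge_std_orbit2: "dedge ` std_orbit2 v = (std_orbit v :: 'a::finite_field edge set)"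
proof -
  have e: "cotr (cotr (std v ** diagX {1})) ** Dinv = (std v :: 'a mat3)"
    by (simp add: invertible_mult)
  have "invertible (cotr (std v ** diagX {1}) :: 'a mat3)" by (simp add: cotr_invertible invertible_mult)
  from dedge_orbit[OF this] show ?thesis unfolding std_orbit2_def std_orbit_def e .
qed

lemma edge_orbits_2: "edge_orbits PGL3_poly 2 = (std_orbit2 ` sorted_pairs :: 'a::finite_field edge set set)"
proof (intro equalityI subsetI)
  fix x :: "'a edge set" assume "x \<in> edge_orbits PGL3_poly 2"
  then obtain A :: "'a mat3" where A: "invertible A" "x = orbit (prod.swap (edge A))"
    unfolding edge_orbits_def typed_edges_2 by blast
  have inv: "invertible (cotr A ** Dinv)" using A by (simp add: invertible_mult cotr_invertible)
  then obtain v where v: "v \<in> sorted_pairs" "eqv (cotr A ** Dinv) (std v)" using ex_eqv_std by blast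
  have "dedge ` x = dedge ` std_orbit2 v"
    unfolding A(2) dedge_orbit[OF A(1)] dedge_std_orbit2
    using orbit_eq_iff[OF inv, of "std v"] v by (simp add: std_orbit_def)
  moreover have "x \<subseteq> typed_edges 2"
    unfolding A(2) orbit_swap typed_edges_2 using A(1) GL_invertible invertible_mult by blast
  ultimately have "x = std_orbit2 v" using inj_dedge std_orbit2_typed by (metis inj_on_image_eq_iff)
  then show "x \<in> std_orbit2 ` sorted_pairs" using v by blast
next
  fix x :: "'a edge set" assume "x \<in> std_orbit2 ` sorted_pairs"
  then obtain v where "x = orbit (prod.swap (edge (cotr (std v ** diagX {1}))))" by (auto simp: std_orbit2_def)
  moreover have "prod.swap (edge (cotr (std v ** diagX {1}))) \<in> (typed_edges 2 :: 'a edge set)"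
    unfolding typed_edges_2 using invertible_std invertible_mult invertible_diagX1 cotr_invertible by blast
  ultimately show "x \<in> edge_orbits PGL3_poly 2" unfolding edge_orbits_def by blast
qed

lemma inj_std_orbit2: "inj_on (std_orbit2 :: _ \<Rightarrow> 'a::finite_field edge set) sorted_pairs"
proof (rule inj_onI)
  fix v w assume vw: "v \<in> sorted_pairs" "w \<in> sorted_pairs" "std_orbit2 v = (std_orbit2 w :: 'a edge set)"
  then have "std_orbit v = (std_orbit w :: 'a edge set)" by (simp flip: dedge_std_orbit2)
  then show "v = w" using vw inj_std_orbit by (blast dest: inj_onD)
qed

lemma edge_weight_2:
  assumes v: "v \<in> sorted_pairs" "v' \<in> sorted_pairs"
  shows "edge_weight 2 (std_orbit2 v) (std_orbit2 v' :: 'a::finite_field edge set) = card {c :: 'a \<times> 'a. nxt v c = v'}"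
proof -
  define l where "l = (SOME l. l \<in> (std_orbit2 v :: 'a edge set))"
  have "std_orbit2 v \<noteq> ({} :: 'a edge set)" using dedge_std_orbit2[of v, where 'a = 'a] mem_std_orbit by blast
  then have l: "l \<in> std_orbit2 v" unfolding l_def by (simp add: some_in_eq)
  have "dedge ` {d \<in> std_orbit2 v'. geodesic_path 2 [l, d]} = {d \<in> std_orbit v'. geodesic_path 1 [dedge l, d]}"
  proof -
    have "geodesic_path 1 [dedge l, dedge d] \<longleftrightarrow> geodesic_path 2 [l, d]" if "d \<in> std_orbit2 v'" for d
      using geodesic_dual l that std_orbit2_typed by blast
    then show ?thesis unfolding dedge_std_orbit2[of v', symmetric] by blast
  qed
  moreover have inj: "inj_on dedge {d \<in> std_orbit2 v'. geodesic_path 2 [l, d]}"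
    using std_orbit2_typed by (intro inj_on_subset[OF inj_dedge]) blast
  ultimately have "card {d \<in> std_orbit2 v'. geodesic_path 2 [l, d]} = card {d \<in> std_orbit v'. geodesic_path 1 [dedge l, d]}"
    using card_image[OF inj] by simp
  also have "\<dots> = card {c :: 'a \<times> 'a. nxt v c = v'}"
    using l dedge_std_orbit2 by (intro card_successors v) blast
  finally show ?thesis unfolding edge_weight_def l_def .
qed


section \<open>Closed paths of the reduced kernel\<close>

text \<open>A vertex without outgoing weight contributes to no closed path.\<close>

lemma cycsum_support:
  assumes "S \<subseteq> A" "\<And>y y'. y \<in> A \<Longrightarrow> M y y' \<noteq> 0 \<Longrightarrow> y \<in> S" shows "cycsum A M = cycsum S M"
  unfolding cycsum_def
proof (rule esum_cong)
  fix p
  show "of_bool (set p \<subseteq> A) * (ennreal (1 / length p) * cyc M p) = of_bool (set p \<subseteq> S) * (ennreal (1 / length p) * cyc M p)"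
  proof (cases "set p \<subseteq> A \<longrightarrow> set p \<subseteq> S")
    case False
    then obtain j where "j < length p" "p ! j \<in> A" "p ! j \<notin> S" by (auto simp: in_set_conv_nth subset_iff)
    then have "cyc M p = 0" unfolding cyc_def using assms(2) by (intro prod_zero) auto
    then show ?thesis by simp
  qed (use assms(1) in auto)
qed

text \<open>\<open>Z\<close> is a trap: a path through \<open>Q\<close> that starts in
  \<open>Z\<close> stays there, and \<open>Z\<close> has no edge to \<open>r\<close>.\<close>

lemma kern_zero:
  assumes "\<And>y. y \<in> Z \<Longrightarrow> M y r = 0" "\<And>y y'. y \<in> Z \<Longrightarrow> y' \<in> Q \<Longrightarrow> M y y' \<noteq> 0 \<Longrightarrow> y' \<in> Z" "y \<in> Z"
  shows "kern Q M y r = 0"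
proof -
  have "set ys \<subseteq> Q \<Longrightarrow> y \<in> Z \<Longrightarrow> pw M y ys r = 0" for y ys
    by (induction ys arbitrary: y) (use assms in auto)
  then have "of_bool (set ys \<subseteq> Q) * pw M y ys r = 0" for ys using assms(3) by auto
  then show ?thesis unfolding kern_def by (simp only: nn_integral_const mult_zero_left)
qed

text \<open>The total weight of the paths from \<open>y\<close> to \<open>r\<close> with exactly
  \<open>n\<close> interior vertices, all in \<open>Q\<close>.\<close>

primrec kstep :: "'v set \<Rightarrow> ('v \<Rightarrow> 'v \<Rightarrow> ennreal) \<Rightarrow> 'v \<Rightarrow> nat \<Rightarrow> 'v \<Rightarrow> ennreal" where
  "kstep Q M r 0 y = M y r"
| "kstep Q M r (Suc n) y = esum (\<lambda>y'. of_bool (y' \<in> Q) * M y y' * kstep Q M r n y')"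

lemma kern_series: "kern Q M y r = (\<Sum>n. kstep Q M r n y)"
proof -
  have len: "esum (\<lambda>ys. of_bool (length ys = n) * (of_bool (set ys \<subseteq> Q) * pw M y ys r)) = kstep Q M r n y" for n y
  proof (induction n arbitrary: y)
    case 0
    show ?case by (subst esum_single[of "[]"]) auto
  next
    case (Suc n)
    have "esum (\<lambda>ys. of_bool (length ys = Suc n) * (of_bool (set ys \<subseteq> Q) * pw M y ys r)) =
      esum (\<lambda>y'. esum (\<lambda>ys. (of_bool (y' \<in> Q) * M y y') * (of_bool (length ys = n) * (of_bool (set ys \<subseteq> Q) * pw M y' ys r))))"
      by (subst esum_list) (simp add: of_bool_conj mult_ac)
    also have "\<dots> = kstep Q M r (Suc n) y" by (simp add: esum_cmult Suc)
    finally show ?case .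
  qed
  have "kern Q M y r = esum (\<lambda>ys. esum (\<lambda>n. of_bool (length ys = n) * (of_bool (set ys \<subseteq> Q) * pw M y ys r)))"
    unfolding kern_def
  proof (rule esum_cong)
    fix ys
    show "of_bool (set ys \<subseteq> Q) * pw M y ys r = esum (\<lambda>n. of_bool (length ys = n) * (of_bool (set ys \<subseteq> Q) * pw M y ys r))"
      by (subst esum_single[of "length ys"]) auto
  qed
  also have "\<dots> = esum (\<lambda>n. kstep Q M r n y)" by (subst esum_swap) (simp add: len)
  also have "\<dots> = (\<Sum>n. kstep Q M r n y)" by (rule nn_integral_count_space_nat)
  finally show ?thesis .
qed

text \<open>The words on one letter are its powers; the result is the series of
  \<open>- ln (1 - M a a)\<close>.\<close>

lemma cycsum_singleton: "cycsum {a} M = (\<Sum>n. ennreal (1 / n) * M a a ^ n)"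
proof -
  have "cyc M (replicate n a) = M a a ^ n" for n
    by (cases "n = 0") (auto simp: cyc_def)
  moreover have "cycsum {a} M = esum (\<lambda>n. ennreal (1 / length (replicate n a)) * cyc M (replicate n a))"
    unfolding cycsum_def
  proof (rule esum_bij_betw[symmetric, of "\<lambda>n. replicate n a" UNIV "{p. set p \<subseteq> {a}}"])
    show "bij_betw (\<lambda>n. replicate n a) UNIV {p. set p \<subseteq> {a}}"
      by (rule bij_betwI[where g = length]) (auto simp: replicate_length_same subset_iff)
  qed auto
  ultimately show ?thesis by (simp add: nn_integral_count_space_nat)
qed

text \<open>A rank-one perturbation of a triangular kernel: the rank-one part is routed through an auxiliary
  vertex, and the resulting kernel is eliminated in two ways.\<close>

lemma cycsum_rank_one:
  fixes U :: "nat \<Rightarrow> nat \<Rightarrow> ennreal"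
  assumes U: "\<And>d d'. U d d' \<noteq> 0 \<Longrightarrow> d < d'" and eigen: "\<And>d. esum (\<lambda>d'. U d d' * \<phi> d') = \<rho> * \<phi> d"
  shows "cycsum UNIV (\<lambda>d d'. U d d' + \<phi> d * s d') = (\<Sum>n. ennreal (1 / n) * (esum (\<lambda>d. s d * \<phi> d) * (\<Sum>n. \<rho> ^ n)) ^ n)"
proof -
  define M :: "nat option \<Rightarrow> nat option \<Rightarrow> ennreal" where
    "M y y' = (case y of Some d \<Rightarrow> (case y' of Some d' \<Rightarrow> U d d' | None \<Rightarrow> \<phi> d)
                       | None \<Rightarrow> (case y' of Some d' \<Rightarrow> s d' | None \<Rightarrow> 0))" for y y'
  have C: "- range Some = {None}" "- {None} = range Some" by (auto simp: notin_range_Some)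
  have opt: "esum (\<lambda>y. of_bool (y \<in> range Some) * f y) = esum (\<lambda>d. f (Some d))" for f :: "nat option \<Rightarrow> ennreal"
    by (subst esum_inj[of Some]) auto
  have kN: "kern {None} M None (Some d) = s d" for d
    by (subst kern_rec, subst esum_single[of None]) (auto simp: M_def)
  have kS: "kern {None} M (Some d) (Some d') = U d d' + \<phi> d * s d'" for d d'
    by (subst kern_rec, subst esum_single[of None]) (auto simp: M_def kN)
  have "cycsum {None} M = 0" by (rule cycsum_acyclic) (auto simp: M_def)
  then have "cycsum UNIV M = cycsum (range Some) (kern {None} M)"
    using cycsum_eliminate[of M "range Some"] unfolding C by simp
  also have "\<dots> = cycsum UNIV (\<lambda>d d'. U d d' + \<phi> d * s d')"
    by (rule cycsum_reindex[of Some]) (auto simp: bij_betw_def kS)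
  finally have 1: "cycsum UNIV M = cycsum UNIV (\<lambda>d d'. U d d' + \<phi> d * s d')" .
  have "cycsum (range Some) M = 0"
    by (rule cycsum_acyclic[where f = "\<lambda>y. int (the y)"]) (auto simp: M_def dest: U)
  then have 2: "cycsum UNIV M = cycsum {None} (kern (range Some) M)"
    using cycsum_eliminate[of M "{None}"] unfolding C by simp
  \<comment> \<open>\<open>\<phi>\<close> is an eigenvector of \<open>U\<close>, so each interior
    step costs a factor \<open>\<rho>\<close> and the kernel becomes a geometric series.\<close>
  have ks: "kstep (range Some) M None n (Some d) = \<rho> ^ n * \<phi> d" for n d
  proof (induction n arbitrary: d)
    case 0 show ?case by (simp add: M_def)
  next
    case (Suc n)
    have "kstep (range Some) M None (Suc n) (Some d) = esum (\<lambda>d'. \<rho> ^ n * (U d d' * \<phi> d'))"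
      by (simp add: mult.assoc opt Suc) (simp add: M_def mult_ac)
    also have "\<dots> = \<rho> ^ Suc n * \<phi> d" unfolding esum_cmult eigen by (simp add: mult_ac)
    finally show ?case .
  qed
  have "kern (range Some) M None None = esum (\<lambda>d. s d * kern (range Some) M (Some d) None)"
    by (subst kern_rec) (simp add: mult.assoc opt, simp add: M_def)
  also have "\<dots> = esum (\<lambda>d. s d * \<phi> d * (\<Sum>n. \<rho> ^ n))"
    unfolding kern_series ks by (simp add: mult_ac)
  also have "\<dots> = esum (\<lambda>d. s d * \<phi> d) * (\<Sum>n. \<rho> ^ n)" by (rule esum_multc)
  finally have "kern (range Some) M None None = esum (\<lambda>d. s d * \<phi> d) * (\<Sum>n. \<rho> ^ n)" .
  then show ?thesis using 1 2 by (simp add: cycsum_singleton)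
qed

section \<open>The kernel on the quadrant of pairs \<open>(d, e)\<close>\<close>

context
  fixes q r x :: ennreal
  assumes q: "q = r + 1"
begin

text \<open>The powers come from eliminated stretches: \<open>x ^ e'\<close> from a chain below
  height 0 that ends with a jump to height \<open>e'\<close>, and \<open>(q ^ 2 * x) ^ d\<close> or
  \<open>(q ^ 2 * x) ^ (d + 1)\<close> from the descent after a jump that resets \<open>d\<close> to
  0.\<close>

definition M2 :: "nat \<times> nat \<Rightarrow> nat \<times> nat \<Rightarrow> ennreal" where
  "M2 y y' = (case y of (d, e) \<Rightarrow> case y' of (d', e') \<Rightarrow>
    (if e \<ge> 1 then q * x * of_bool (d' = d + 1 \<and> e' = e - 1) + q * r * x * (q ^ 2 * x) ^ (d + 1) * of_bool (d' = 0 \<and> e' = e - 1)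
     else of_bool (e' \<ge> 1) * (x ^ e' * (q * r * (q ^ 2 * x) ^ d * of_bool (d' = 0) + r * of_bool (d' = d)))))"

text \<open>For \<open>e \<ge> 1\<close> the weight of going from \<open>(d, e)\<close> to
  \<open>(D, 0)\<close> through positive heights, see \<open>kern_M2\<close>; for
  \<open>e = 0\<close> the indicator of having arrived.\<close>

primrec hit :: "nat \<Rightarrow> nat \<Rightarrow> nat \<Rightarrow> ennreal" where
  "hit D 0 d = of_bool (d = D)"
| "hit D (Suc e) d = q * x * hit D e (d + 1) + q * r * x * (q ^ 2 * x) ^ (d + 1) * hit D e 0"

text \<open>The coefficient of the part of \<open>hit\<close> that is reset to \<open>d = 0\<close>
  at least once.\<close>

primrec hit' :: "nat \<Rightarrow> nat \<Rightarrow> ennreal" where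
  "hit' D 0 = 0"
| "hit' D (Suc e) = q ^ 2 * x * (q * x * hit' D e + q * r * x * hit D e 0)"

text \<open>Paths that are never reset give the second summand. The others feel \<open>d\<close>
  only through the weight of their first reset, which is the source of the rank-one part.\<close>

lemma hit_eq: "hit D e d = (q ^ 2 * x) ^ d * hit' D e + (q * x) ^ e * of_bool (d + e = D)"
proof (induction e arbitrary: d)
  case (Suc e)
  have "hit D (Suc e) d = q * x * ((q ^ 2 * x) ^ (d + 1) * hit' D e + (q * x) ^ e * of_bool (d + 1 + e = D)) +
      q * r * x * (q ^ 2 * x) ^ (d + 1) * hit D e 0"
    by (simp only: hit.simps Suc)
  also have "\<dots> = (q ^ 2 * x) ^ d * hit' D (Suc e) + (q * x) ^ Suc e * of_bool (d + Suc e = D)"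
    by (simp add: algebra_simps del: hit.simps)
  finally show ?case .
qed simp

text \<open>One height down multiplies the vector \<open>(q ^ 2 * x) ^ D\<close> by
  \<open>q ^ 4 * x ^ 2\<close>: the two kinds of step contribute in the ratio 1 to \<open>r\<close>,
  and \<open>r + 1 = q\<close>.\<close>

lemma sum_hit: "esum (\<lambda>D. hit D e d * (q ^ 2 * x) ^ D) = (q ^ 2 * x) ^ d * (q ^ 4 * x ^ 2) ^ e"
proof (induction e arbitrary: d)
  case 0
  show ?case by (subst esum_single[of d]) auto
next
  case (Suc e)
  have "esum (\<lambda>D. hit D (Suc e) d * (q ^ 2 * x) ^ D) =
    esum (\<lambda>D. (q * x) * (hit D e (d + 1) * (q ^ 2 * x) ^ D) + (q * r * x * (q ^ 2 * x) ^ (d + 1)) * (hit D e 0 * (q ^ 2 * x) ^ D))"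
    by (rule esum_cong) (simp add: algebra_simps)
  also have "\<dots> = (q * x) * ((q ^ 2 * x) ^ (d + 1) * (q ^ 4 * x ^ 2) ^ e) + (q * r * x * (q ^ 2 * x) ^ (d + 1)) * (q ^ 4 * x ^ 2) ^ e"
    by (simp only: esum_add esum_cmult Suc power_0 mult_1)
  also have "\<dots> = (q * x) * (q ^ 2 * x) ^ (d + 1) * (q ^ 4 * x ^ 2) ^ e * (r + 1)"
    by (simp add: algebra_simps)
  also have "\<dots> = (q ^ 2 * x) ^ d * (q ^ 4 * x ^ 2) ^ Suc e"
    unfolding q[symmetric] by (simp add: power_add power2_eq_square power4_eq_xxxx mult_ac)
  finally show ?case .
qed

lemma kern_M2: "kern {y. snd y \<ge> 1} M2 (d, Suc e) (D, 0) = hit D (Suc e) d"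
proof (induction e arbitrary: d)
  case 0
  have z: "of_bool (y' \<in> {y. snd y \<ge> 1}) * M2 (d, Suc 0) y' * kern {y. snd y \<ge> 1} M2 y' (D, 0) = 0" for y'
    by (auto simp: M2_def split: prod.splits)
  show ?case by (subst kern_rec) (simp only: z, simp add: M2_def)
next
  case (Suc e)
  let ?Q = "{y :: nat \<times> nat. snd y \<ge> 1}"
  have "esum (\<lambda>y'. of_bool (y' \<in> ?Q) * M2 (d, Suc (Suc e)) y' * kern ?Q M2 y' (D, 0)) =
     esum (\<lambda>y'. (q * x) * (of_bool (y' = (d + 1, Suc e)) * kern ?Q M2 y' (D, 0)) +
       (q * r * x * (q ^ 2 * x) ^ (d + 1)) * (of_bool (y' = (0, Suc e)) * kern ?Q M2 y' (D, 0)))"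
    by (rule esum_cong) (auto simp: M2_def distrib_right)
  also have "\<dots> = (q * x) * kern ?Q M2 (d + 1, Suc e) (D, 0) + (q * r * x * (q ^ 2 * x) ^ (d + 1)) * kern ?Q M2 (0, Suc e) (D, 0)"
    unfolding esum_add esum_cmult
    by (subst esum_single[of "(d + 1, Suc e)"], simp, subst esum_single[of "(0, Suc e)"]) auto
  also have "\<dots> = hit D (Suc (Suc e)) d" by (simp only: Suc hit.simps(2)[of D "Suc e"])
  finally have "M2 (d, Suc (Suc e)) (D, 0) + esum (\<lambda>y'. of_bool (y' \<in> ?Q) * M2 (d, Suc (Suc e)) y' * kern ?Q M2 y' (D, 0)) =
    hit D (Suc (Suc e)) d" by (simp add: M2_def)
  then show ?case unfolding kern_rec[of ?Q M2 "(d, Suc (Suc e))"] .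
qed

text \<open>The coefficient of \<open>(q ^ 2 * x) ^ d\<close> in the kernel on the row
  \<open>e = 0\<close>: the jump to height \<open>e + 1\<close> resets \<open>d\<close> itself, or
  leaves it and a reset follows on the way down.\<close>

definition shot :: "nat \<Rightarrow> ennreal" where
  "shot D = esum (\<lambda>e. x ^ Suc e * (q * r * hit D (Suc e) 0 + r * hit' D (Suc e)))"

text \<open>Paths without a reset: one jump to height \<open>D - d\<close>, with factor
  \<open>r\<close>, and the diagonal back down; each unit of height costs \<open>x\<close> on the
  way up and \<open>q * x\<close> on the way down.\<close>

definition UU :: "nat \<Rightarrow> nat \<Rightarrow> ennreal" where
  "UU d D = of_bool (d < D) * (r * (q * x ^ 2) ^ (D - d))"

lemma kern_M2_0: "kern {y. snd y \<ge> 1} M2 (d, 0) (D, 0) = UU d D + (q ^ 2 * x) ^ d * shot D"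
proof -
  let ?Q = "{y :: nat \<times> nat. snd y \<ge> 1}"
  have "kern ?Q M2 (d, 0) (D, 0) = esum (\<lambda>y'. of_bool (y' \<in> ?Q) * M2 (d, 0) y' * kern ?Q M2 y' (D, 0))"
    by (subst kern_rec) (simp add: M2_def)
  also have "\<dots> = esum (\<lambda>e. esum (\<lambda>d'. of_bool (e \<ge> 1) * M2 (d, 0) (d', e) * kern ?Q M2 (d', e) (D, 0)))"
    by (subst esum_pair, subst esum_swap) simp
  also have "\<dots> = esum (\<lambda>e. esum (\<lambda>d'. of_bool (Suc e \<ge> 1) * M2 (d, 0) (d', Suc e) * kern ?Q M2 (d', Suc e) (D, 0)))"
  proof (rule esum_inj)
    fix e :: nat assume "e \<notin> range Suc"
    then have "e = 0" by (cases e) auto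
    then show "esum (\<lambda>d'. of_bool (e \<ge> 1) * M2 (d, 0) (d', e) * kern ?Q M2 (d', e) (D, 0)) = 0" by simp
  qed simp
  also have "\<dots> = esum (\<lambda>e. esum (\<lambda>d'. M2 (d, 0) (d', Suc e) * hit D (Suc e) d'))"
    by (rule esum_cong, rule esum_cong) (simp only: kern_M2, simp del: hit.simps)
  also have "\<dots> = esum (\<lambda>e. x ^ Suc e * (q * r * (q ^ 2 * x) ^ d * hit D (Suc e) 0) + x ^ Suc e * (r * hit D (Suc e) d))"
  proof (rule esum_cong)
    fix e
    have "esum (\<lambda>d'. M2 (d, 0) (d', Suc e) * hit D (Suc e) d') =
      esum (\<lambda>d'. (x ^ Suc e * (q * r * (q ^ 2 * x) ^ d)) * (of_bool (d' = 0) * hit D (Suc e) d') + (x ^ Suc e * r) * (of_bool (d' = d) * hit D (Suc e) d'))"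
      by (rule esum_cong) (auto simp: M2_def algebra_simps simp del: hit.simps)
    also have "\<dots> = (x ^ Suc e * (q * r * (q ^ 2 * x) ^ d)) * hit D (Suc e) 0 + (x ^ Suc e * r) * hit D (Suc e) d"
      unfolding esum_add esum_cmult by (subst esum_single[of 0], simp, subst esum_single[of d]) (auto simp del: hit.simps)
    finally show "esum (\<lambda>d'. M2 (d, 0) (d', Suc e) * hit D (Suc e) d') =
       x ^ Suc e * (q * r * (q ^ 2 * x) ^ d * hit D (Suc e) 0) + x ^ Suc e * (r * hit D (Suc e) d)"
      by (simp only: mult.assoc)
  qed
  also have "\<dots> = esum (\<lambda>e. (q ^ 2 * x) ^ d * (x ^ Suc e * (q * r * hit D (Suc e) 0 + r * hit' D (Suc e))) +
      r * (x ^ Suc e * (q * x) ^ Suc e * of_bool (d + Suc e = D)))"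
    by (subst (2) hit_eq) (simp add: distrib_left mult_ac add_ac del: hit.simps hit'.simps power_Suc)
  also have "\<dots> = (q ^ 2 * x) ^ d * shot D + r * esum (\<lambda>e. x ^ Suc e * (q * x) ^ Suc e * of_bool (d + Suc e = D))"
    unfolding esum_add esum_cmult shot_def ..
  also have "r * esum (\<lambda>e. x ^ Suc e * (q * x) ^ Suc e * of_bool (d + Suc e = D)) = UU d D"
  proof (cases "d < D")
    case True
    then have e: "d + Suc e = D \<longleftrightarrow> e = D - d - 1" for e by auto
    have "esum (\<lambda>e. x ^ Suc e * (q * x) ^ Suc e * of_bool (d + Suc e = D)) = x ^ (D - d) * (q * x) ^ (D - d)"
      unfolding e using True by (subst esum_single[of "D - d - 1"]) (auto simp: Suc_diff_Suc simp del: power_Suc)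
    also have "\<dots> = (q * x ^ 2) ^ (D - d)" by (simp add: power2_eq_square mult_ac flip: power_mult_distrib)
    finally show ?thesis using True by (simp add: UU_def)
  next
    case False
    then have "d + Suc e \<noteq> D" for e by auto
    then show ?thesis using False by (simp add: UU_def)
  qed
  finally show ?thesis by (simp add: add.commute)
qed

text \<open>A gain of \<open>n\<close> in \<open>d\<close> costs \<open>(q * x ^ 2) ^ n\<close> and
  multiplies the eigenvector by \<open>(q ^ 2 * x) ^ n\<close>; hence the powers of
  \<open>q ^ 3 * x ^ 3\<close> in the eigenvalue.\<close>

lemma esum_UU: "esum (\<lambda>D. UU d D * (q ^ 2 * x) ^ D) = (\<Sum>n. r * (q ^ 3 * x ^ 3) ^ Suc n) * (q ^ 2 * x) ^ d"
proof -
  have "esum (\<lambda>D. UU d D * (q ^ 2 * x) ^ D) = esum (\<lambda>n. UU d (d + Suc n) * (q ^ 2 * x) ^ (d + Suc n))"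
  proof (rule esum_inj)
    show "inj (\<lambda>n. d + Suc n)" by (auto simp: inj_def)
    fix D assume "D \<notin> range (\<lambda>n. d + Suc n)"
    then have "\<not> d < D" by (auto simp: image_iff less_iff_Suc_add)
    then show "UU d D * (q ^ 2 * x) ^ D = 0" by (simp add: UU_def)
  qed
  also have "\<dots> = esum (\<lambda>n. r * (q ^ 3 * x ^ 3) ^ Suc n * (q ^ 2 * x) ^ d)"
  proof (rule esum_cong)
    fix n
    have "(q * x ^ 2) ^ Suc n * (q ^ 2 * x) ^ Suc n = (q ^ 3 * x ^ 3) ^ Suc n"
      unfolding power_mult_distrib[symmetric] by (simp add: power2_eq_square power3_eq_cube mult_ac)
    then have "r * (q * x ^ 2) ^ Suc n * (q ^ 2 * x) ^ (d + Suc n) = r * (q ^ 3 * x ^ 3) ^ Suc n * (q ^ 2 * x) ^ d"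
      by (simp only: power_add mult_ac)
    then show "UU d (d + Suc n) * (q ^ 2 * x) ^ (d + Suc n) = r * (q ^ 3 * x ^ 3) ^ Suc n * (q ^ 2 * x) ^ d"
      by (simp add: UU_def mult.assoc del: power_Suc)
  qed
  also have "\<dots> = esum (\<lambda>n. r * (q ^ 3 * x ^ 3) ^ Suc n) * (q ^ 2 * x) ^ d" by (rule esum_multc)
  finally show ?thesis by (simp only: nn_integral_count_space_nat)
qed

lemma cycsum_M2:
  "cycsum UNIV M2 = (\<Sum>n. ennreal (1 / n) *
     (esum (\<lambda>D. shot D * (q ^ 2 * x) ^ D) * (\<Sum>n. (\<Sum>n. r * (q ^ 3 * x ^ 3) ^ Suc n) ^ n)) ^ n)"
proof -
  let ?Q = "{y :: nat \<times> nat. snd y \<ge> 1}"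
  have C: "- {y :: nat \<times> nat. snd y = 0} = ?Q" by auto
  have "cycsum ?Q M2 = 0"
    by (rule cycsum_acyclic[where f = "\<lambda>y. - int (snd y)"]) (auto simp: M2_def split: if_splits)
  then have "cycsum UNIV M2 = cycsum {y. snd y = 0} (kern ?Q M2)"
    using cycsum_eliminate[of M2 "{y. snd y = 0}"] unfolding C by simp
  also have "\<dots> = cycsum UNIV (\<lambda>d D. UU d D + (q ^ 2 * x) ^ d * shot D)"
  proof (rule cycsum_reindex[of "\<lambda>d. (d, 0)"])
    show "bij_betw (\<lambda>d. (d, 0)) UNIV {y :: nat \<times> nat. snd y = 0}"
      by (rule bij_betwI[where g = fst]) auto
  qed (rule kern_M2_0)
  also have "\<dots> = (\<Sum>n. ennreal (1 / n) *
     (esum (\<lambda>D. shot D * (q ^ 2 * x) ^ D) * (\<Sum>n. (\<Sum>n. r * (q ^ 3 * x ^ 3) ^ Suc n) ^ n)) ^ n)"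
  proof (rule cycsum_rank_one)
    show "UU d D \<noteq> 0 \<Longrightarrow> d < D" for d D by (auto simp: UU_def split: if_splits)
  qed (rule esum_UU)
  finally show ?thesis .
qed

text \<open>The difference of \<open>sum_hit\<close> at \<open>d = 0\<close> and the part without
  reset in \<open>hit_eq\<close>, stated as a sum since subtraction in
  \<open>[0, \<infinity>]\<close> is delicate.\<close>

lemma sum_hit': "esum (\<lambda>D. hit' D e * (q ^ 2 * x) ^ D) + (q ^ 3 * x ^ 2) ^ e = (q ^ 4 * x ^ 2) ^ e"
proof -
  have "esum (\<lambda>D. hit D e 0 * (q ^ 2 * x) ^ D) = esum (\<lambda>D. hit' D e * (q ^ 2 * x) ^ D + (q * x) ^ e * of_bool (e = D) * (q ^ 2 * x) ^ D)"
    by (subst hit_eq) (simp add: distrib_right)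
  also have "\<dots> = esum (\<lambda>D. hit' D e * (q ^ 2 * x) ^ D) + (q * x) ^ e * (q ^ 2 * x) ^ e"
    by (subst esum_add, subst esum_single[of e "\<lambda>D. (q * x) ^ e * of_bool (e = D) * (q ^ 2 * x) ^ D"]) auto
  also have "(q * x) ^ e * (q ^ 2 * x) ^ e = (q ^ 3 * x ^ 2) ^ e"
    unfolding power_mult_distrib[symmetric] by (simp add: power2_eq_square power3_eq_cube mult_ac)
  finally show ?thesis using sum_hit[of e 0] by simp
qed

lemma sum_shot:
  "esum (\<lambda>D. shot D * (q ^ 2 * x) ^ D) =
     esum (\<lambda>e. x ^ Suc e * (q * r * (q ^ 4 * x ^ 2) ^ Suc e + r * esum (\<lambda>D. hit' D (Suc e) * (q ^ 2 * x) ^ D)))"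
proof -
  have "esum (\<lambda>D. shot D * (q ^ 2 * x) ^ D) =
     esum (\<lambda>D. esum (\<lambda>e. x ^ Suc e * (q * r * hit D (Suc e) 0 + r * hit' D (Suc e)) * (q ^ 2 * x) ^ D))"
    unfolding shot_def esum_multc ..
  also have "\<dots> = esum (\<lambda>e. esum (\<lambda>D. x ^ Suc e * (q * r * hit D (Suc e) 0 + r * hit' D (Suc e)) * (q ^ 2 * x) ^ D))"
    by (rule esum_swap)
  also have "\<dots> = esum (\<lambda>e. esum (\<lambda>D. (x ^ Suc e * (q * r)) * (hit D (Suc e) 0 * (q ^ 2 * x) ^ D) + (x ^ Suc e * r) * (hit' D (Suc e) * (q ^ 2 * x) ^ D)))"
    by (rule esum_cong, rule esum_cong) (simp add: algebra_simps del: hit.simps hit'.simps power_Suc)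
  also have "\<dots> = esum (\<lambda>e. x ^ Suc e * (q * r * (q ^ 4 * x ^ 2) ^ Suc e + r * esum (\<lambda>D. hit' D (Suc e) * (q ^ 2 * x) ^ D)))"
  proof (rule esum_cong)
    fix e
    have "esum (\<lambda>D. (x ^ Suc e * (q * r)) * (hit D (Suc e) 0 * (q ^ 2 * x) ^ D) + (x ^ Suc e * r) * (hit' D (Suc e) * (q ^ 2 * x) ^ D)) =
      (x ^ Suc e * (q * r)) * ((q ^ 2 * x) ^ 0 * (q ^ 4 * x ^ 2) ^ Suc e) + (x ^ Suc e * r) * esum (\<lambda>D. hit' D (Suc e) * (q ^ 2 * x) ^ D)"
      by (simp only: esum_add esum_cmult sum_hit)
    then show "esum (\<lambda>D. (x ^ Suc e * (q * r)) * (hit D (Suc e) 0 * (q ^ 2 * x) ^ D) + (x ^ Suc e * r) * (hit' D (Suc e) * (q ^ 2 * x) ^ D)) =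
       x ^ Suc e * (q * r * (q ^ 4 * x ^ 2) ^ Suc e + r * esum (\<lambda>D. hit' D (Suc e) * (q ^ 2 * x) ^ D))"
      by (simp only: distrib_left mult.assoc power_0 mult_1)
  qed
  finally show ?thesis .
qed

end


section \<open>Closed paths of the quotient\<close>

context
  fixes q r x :: ennreal
  assumes q: "q = r + 1"
begin

text \<open>\<open>M0\<close> is \<open>x\<close> times the transition kernel of the quotient, with \<open>q = CARD('a)\<close> and \<open>r = q - 1\<close>.
  Eliminating the vertices with \<open>a \<ge> 1\<close> gives \<open>M1\<close>; eliminating those with \<open>b < 0\<close> from it gives
  \<open>M2\<close>, in the coordinates \<open>(d, e) = (- a, b)\<close>.\<close>

definition M0 :: "int \<times> int \<Rightarrow> int \<times> int \<Rightarrow> ennreal" where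
  "M0 y y' = (case y of (a, b) \<Rightarrow> of_bool (a \<le> b) * (x *
     (if a \<ge> 1 then q ^ 2 * of_bool (y' = (a - 1, b - 1))
      else if b \<ge> 1 then q * r * of_bool (y' = (1 - a, b - a)) + q * of_bool (y' = (a - 1, b - 1))
      else q * r * of_bool (y' = (b - a, 1 - a)) + r * of_bool (y' = (a - b, 1 - b)) + of_bool (y' = (a - 1, b - 1)))))"

definition M1 :: "int \<times> int \<Rightarrow> int \<times> int \<Rightarrow> ennreal" where
  "M1 y y' = (case y of (a, b) \<Rightarrow> of_bool (a \<le> 0 \<and> a \<le> b) * (x *
     (if b \<ge> 1 then q * r * (q ^ 2 * x) ^ nat (1 - a) * of_bool (y' = (0, b - 1)) + q * of_bool (y' = (a - 1, b - 1))
      else q * r * (q ^ 2 * x) ^ nat (b - a) * of_bool (y' = (0, 1 - b)) + r * of_bool (y' = (a - b, 1 - b)) + of_bool (y' = (a - 1, b - 1)))))"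

text \<open>With \<open>a \<ge> 1\<close> there is no choice: all \<open>q ^ 2\<close> successors
  are one step down the diagonal, until \<open>a = 0\<close>.\<close>

lemma kern_M0_drop:
  assumes "fst y' \<le> 0" "a \<le> b" "a = int n + 1"
  shows "kern {y. fst y \<ge> 1} M0 (a, b) y' = (q ^ 2 * x) ^ nat a * of_bool (y' = (0, b - a))"
  using assms(2,3)
proof (induction n arbitrary: a b)
  case 0
  have "esum (\<lambda>z. of_bool (z \<in> {y. fst y \<ge> 1}) * M0 (a, b) z * kern {y. fst y \<ge> 1} M0 z y') = 0"
    by (subst esum_single[of "(a - 1, b - 1)"]) (use 0 in \<open>auto simp: M0_def\<close>)
  then show ?case using 0 by (subst kern_rec) (simp add: M0_def mult_ac)
next
  case (Suc n)
  have "esum (\<lambda>z. of_bool (z \<in> {y. fst y \<ge> 1}) * M0 (a, b) z * kern {y. fst y \<ge> 1} M0 z y') =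
      q ^ 2 * x * kern {y. fst y \<ge> 1} M0 (a - 1, b - 1) y'"
    by (subst esum_single[of "(a - 1, b - 1)"]) (use Suc.prems in \<open>auto simp: M0_def mult_ac\<close>)
  also have "\<dots> = q ^ 2 * x * ((q ^ 2 * x) ^ nat (a - 1) * of_bool (y' = (0, b - a)))"
  proof -
    have i: "b - 1 - (a - 1) = b - a" by simp
    have "kern {y. fst y \<ge> 1} M0 (a - 1, b - 1) y' = (q ^ 2 * x) ^ nat (a - 1) * of_bool (y' = (0, b - 1 - (a - 1)))"
      by (rule Suc.IH) (use Suc.prems in auto)
    then show ?thesis unfolding i by (rule arg_cong)
  qed
  also have "\<dots> = (q ^ 2 * x) ^ nat a * of_bool (y' = (0, b - a))"
    using Suc.prems by (simp add: nat_add_distrib mult.assoc)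
  finally have e: "esum (\<lambda>z. of_bool (z \<in> {y. fst y \<ge> 1}) * M0 (a, b) z * kern {y. fst y \<ge> 1} M0 z y') = (q ^ 2 * x) ^ nat a * of_bool (y' = (0, b - a))" .
  have "y' \<noteq> (a - 1, b - 1)" using assms(1) Suc.prems by auto
  then have "M0 (a, b) y' = 0" using Suc.prems by (simp add: M0_def)
  then show ?case unfolding kern_rec[of "{y. fst y \<ge> 1}" M0 "(a, b)"] e by simp
qed

text \<open>A jump with coefficient \<open>q * r\<close> lands at first exponent
  \<open>1 - a\<close> or \<open>b - a\<close>, and the forced descent takes that many steps. If
  \<open>a = b \<le> 0\<close> it lands at exponent 0 at once and nothing is eliminated.\<close>

lemma kern_M0:
  assumes "fst y \<le> 0" "fst y' \<le> 0" shows "kern {y. fst y \<ge> 1} M0 y y' = M1 y y'"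
proof -
  let ?Q = "{y :: int \<times> int. fst y \<ge> 1}"
  obtain a b where y: "y = (a, b)" by (cases y)
  consider "\<not> a \<le> b" | "a \<le> b" "b \<ge> 1" | "a \<le> b" "b \<le> 0" "a < b" | "a = b" "b \<le> 0" by linarith
  then show ?thesis
  proof cases
    case 1
    then show ?thesis unfolding y by (subst kern_rec) (simp add: M0_def M1_def)
  next
    case 2
    have "esum (\<lambda>z. of_bool (z \<in> ?Q) * M0 (a, b) z * kern ?Q M0 z y') = x * (q * r) * kern ?Q M0 (1 - a, b - a) y'"
      by (subst esum_single[of "(1 - a, b - a)"]) (use 2 assms y in \<open>auto simp: M0_def\<close>)
    also have "kern ?Q M0 (1 - a, b - a) y' = (q ^ 2 * x) ^ nat (1 - a) * of_bool (y' = (0, b - 1))"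
    proof -
      have i: "b - a - (1 - a) = b - 1" by simp
      show ?thesis by (rule kern_M0_drop[where n = "nat (- a)", of y' "1 - a" "b - a", unfolded i]) (use 2 assms y in auto)
    qed
    finally have e: "esum (\<lambda>z. of_bool (z \<in> ?Q) * M0 (a, b) z * kern ?Q M0 z y') = x * (q * r) * ((q ^ 2 * x) ^ nat (1 - a) * of_bool (y' = (0, b - 1)))" .
    have "y' \<noteq> (1 - a, b - a)" using assms y by auto
    then show ?thesis unfolding y kern_rec[of ?Q M0 "(a, b)"] e
      using 2 assms y by (simp add: M0_def M1_def distrib_left mult_ac add_ac)
  next
    case 3
    have "esum (\<lambda>z. of_bool (z \<in> ?Q) * M0 (a, b) z * kern ?Q M0 z y') = x * (q * r) * kern ?Q M0 (b - a, 1 - a) y'"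
      by (subst esum_single[of "(b - a, 1 - a)"]) (use 3 assms y in \<open>auto simp: M0_def\<close>)
    also have "kern ?Q M0 (b - a, 1 - a) y' = (q ^ 2 * x) ^ nat (b - a) * of_bool (y' = (0, 1 - b))"
    proof -
      have i: "1 - a - (b - a) = 1 - b" by simp
      show ?thesis by (rule kern_M0_drop[where n = "nat (b - a - 1)", of y' "b - a" "1 - a", unfolded i]) (use 3 assms y in auto)
    qed
    finally have e: "esum (\<lambda>z. of_bool (z \<in> ?Q) * M0 (a, b) z * kern ?Q M0 z y') = x * (q * r) * ((q ^ 2 * x) ^ nat (b - a) * of_bool (y' = (0, 1 - b)))" .
    have "y' \<noteq> (b - a, 1 - a)" using assms y 3 by auto
    then show ?thesis unfolding y kern_rec[of ?Q M0 "(a, b)"] e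
      using 3 assms y by (simp add: M0_def M1_def distrib_left mult_ac add_ac)
  next
    case 4
    have "esum (\<lambda>z. of_bool (z \<in> ?Q) * M0 (a, b) z * kern ?Q M0 z y') = 0"
      by (subst esum_single[of "(0, 0)"]) (use 4 assms y in \<open>auto simp: M0_def\<close>)
    then show ?thesis unfolding y kern_rec[of ?Q M0 "(a, b)"]
      using 4 assms y by (simp add: M0_def M1_def)
  qed
qed

lemma cycsum_M0_M1: "cycsum UNIV M0 = cycsum UNIV M1"
proof -
  have C: "- {y :: int \<times> int. fst y \<le> 0} = {y. fst y \<ge> 1}" by auto
  have "cycsum {y. fst y \<ge> 1} M0 = 0"
    by (rule cycsum_acyclic[where f = "\<lambda>y. - fst y"]) (auto simp: M0_def split: if_splits)
  then have "cycsum UNIV M0 = cycsum {y. fst y \<le> 0} (kern {y. fst y \<ge> 1} M0)"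
    using cycsum_eliminate[of M0 "{y. fst y \<le> 0}"] unfolding C by simp
  also have "\<dots> = cycsum {y. fst y \<le> 0} M1" by (rule cycsum_cong) (simp add: kern_M0)
  also have "\<dots> = cycsum UNIV M1" by (rule cycsum_support[symmetric]) (auto simp: M1_def split: if_splits)
  finally show ?thesis .
qed

text \<open>A jump from height \<open>b \<le> 0\<close> arrives at height \<open>1 - b\<close>,
  which exceeds \<open>b'\<close>, and the diagonal step only lowers \<open>b\<close>
  further.\<close>

lemma kern_M1_zero:
  assumes "b \<le> 0" "b \<le> - b'" "b' \<ge> 0" shows "kern {y. snd y < 0} M1 (a, b) (a', b') = 0"
  by (rule kern_zero[where Z = "{y. snd y \<le> 0 \<and> snd y \<le> - b'}"]) (use assms in \<open>auto simp: M1_def split: if_splits\<close>)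

text \<open>To arrive at \<open>b'\<close> the jump must start at height \<open>1 - b'\<close>,
  after \<open>n\<close> diagonal steps. These preserve \<open>b - a\<close>, on which the weight
  and the first coordinate of the landing point depend.\<close>

lemma kern_M1_chain:
  assumes "b' \<ge> 0" "b \<le> 0" "a \<le> b" "b = int n + 1 - b'"
  shows "kern {y. snd y < 0} M1 (a, b) (a', b') =
     x ^ Suc n * (q * r * (q ^ 2 * x) ^ nat (b - a) * of_bool (a' = 0) + r * of_bool (a' = a - b))"
  using assms(2-4)
proof (induction n arbitrary: a b)
  case 0
  have "kern {y. snd y < 0} M1 (a - 1, b - 1) (a', b') = 0" using 0 assms(1) by (intro kern_M1_zero) auto
  then have "esum (\<lambda>z. of_bool (z \<in> {y. snd y < 0}) * M1 (a, b) z * kern {y. snd y < 0} M1 z (a', b')) = 0"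
    by (subst esum_single[of "(a - 1, b - 1)"]) (use 0 in \<open>auto simp: M1_def\<close>)
  then show ?case using 0 by (subst kern_rec) (auto simp: M1_def)
next
  case (Suc n)
  have "esum (\<lambda>z. of_bool (z \<in> {y. snd y < 0}) * M1 (a, b) z * kern {y. snd y < 0} M1 z (a', b')) =
      x * kern {y. snd y < 0} M1 (a - 1, b - 1) (a', b')"
    by (subst esum_single[of "(a - 1, b - 1)"]) (use Suc.prems in \<open>auto simp: M1_def\<close>)
  also have "\<dots> = x * (x ^ Suc n * (q * r * (q ^ 2 * x) ^ nat (b - a) * of_bool (a' = 0) + r * of_bool (a' = a - b)))"
  proof -
    have i: "b - 1 - (a - 1) = b - a" "a - 1 - (b - 1) = a - b" by simp_all
    have "kern {y. snd y < 0} M1 (a - 1, b - 1) (a', b') =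
        x ^ Suc n * (q * r * (q ^ 2 * x) ^ nat (b - 1 - (a - 1)) * of_bool (a' = 0) + r * of_bool (a' = a - 1 - (b - 1)))"
      by (rule Suc.IH) (use Suc.prems in auto)
    then show ?thesis unfolding i by (rule arg_cong)
  qed
  finally have e: "esum (\<lambda>z. of_bool (z \<in> {y. snd y < 0}) * M1 (a, b) z * kern {y. snd y < 0} M1 z (a', b')) =
      x ^ Suc (Suc n) * (q * r * (q ^ 2 * x) ^ nat (b - a) * of_bool (a' = 0) + r * of_bool (a' = a - b))"
    by (simp add: mult.assoc)
  have "M1 (a, b) (a', b') = 0" using Suc.prems assms(1) by (auto simp: M1_def)
  then show ?case unfolding kern_rec[of "{y. snd y < 0}" M1 "(a, b)"] e by simp
qed

text \<open>From height \<open>e \<ge> 1\<close> no step leads below 0. From height 0 the chain with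
  \<open>n = e' - 1\<close> applies, and height 0 itself is not reached.\<close>

lemma kern_M1:
  "kern {y. snd y < 0} M1 (- int d, int e) (- int d', int e') = M2 q r x (d, e) (d', e')"
proof (cases "e = 0")
  case False
  then have z: "of_bool (y \<in> {y. snd y < 0}) * M1 (- int d, int e) y * c = 0" for y c
    by (auto simp: M1_def)
  have "nat (1 + int d) = d + 1" by simp
  then show ?thesis using False
    by (subst kern_rec) (simp only: z, auto simp: M1_def M2_def[OF q] mult_ac nat_add_distrib)
next
  case True
  show ?thesis
  proof (cases "e' = 0")
    case True
    then show ?thesis using \<open>e = 0\<close> by (simp add: kern_M1_zero M2_def[OF q])
  next
    case False
    then have "kern {y. snd y < 0} M1 (- int d, 0) (- int d', int e') =
     x ^ Suc (e' - 1) * (q * r * (q ^ 2 * x) ^ nat (0 - - int d) * of_bool (- int d' = 0) + r * of_bool (- int d' = - int d - 0))"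
      by (intro kern_M1_chain) auto
    then show ?thesis using \<open>e = 0\<close> False by (simp add: M2_def[OF q])
  qed
qed

lemma cycsum_M0_M2: "cycsum UNIV M0 = cycsum UNIV (M2 q r x)"
proof -
  let ?Q = "{y :: int \<times> int. snd y < 0}"
  let ?S = "{y :: int \<times> int. fst y \<le> 0 \<and> snd y \<ge> 0}"
  have C: "- {y :: int \<times> int. snd y \<ge> 0} = ?Q" by auto
  have "cycsum ?Q M1 = 0"
    by (rule cycsum_acyclic[where f = "\<lambda>y. - snd y"]) (auto simp: M1_def split: if_splits)
  then have "cycsum UNIV M1 = cycsum {y. snd y \<ge> 0} (kern ?Q M1)"
    using cycsum_eliminate[of M1 "{y. snd y \<ge> 0}"] unfolding C by simp
  \<comment> \<open>Pairs with \<open>a > 0\<close> emit nothing in \<open>M1\<close>, so only a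
    quadrant remains.\<close>
  also have "\<dots> = cycsum ?S (kern ?Q M1)"
  proof (rule cycsum_support)
    fix y y' assume y: "y \<in> {y :: int \<times> int. snd y \<ge> 0}" "kern ?Q M1 y y' \<noteq> 0"
    have "kern ?Q M1 y y' = 0" if "fst y > 0"
      by (subst kern_rec) (use that in \<open>auto simp: M1_def split: prod.splits\<close>)
    then show "y \<in> ?S" using y by force
  qed auto
  also have "\<dots> = cycsum UNIV (M2 q r x)"
  proof (rule cycsum_reindex[of "\<lambda>y. (- int (fst y), int (snd y))"])
    show "bij_betw (\<lambda>y. (- int (fst y), int (snd y))) UNIV ?S"
      by (rule bij_betwI[where g = "\<lambda>y. (nat (- fst y), nat (snd y))"]) auto
    fix y y' :: "nat \<times> nat"
    show "kern ?Q M1 (- int (fst y), int (snd y)) (- int (fst y'), int (snd y')) = M2 q r x y y'"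
      using kern_M1[of "fst y" "snd y" "fst y'" "snd y'"] by simp
  qed
  finally show ?thesis by (simp add: cycsum_M0_M1)
qed

end

section \<open>Evaluation of the closed path sum at positive real arguments\<close>

lemma suminf_geometric_ennreal:
  assumes "0 \<le> c" "0 \<le> y" "y < 1"
  shows "(\<Sum>n. ennreal (c * y ^ Suc n)) = ennreal (c * y / (1 - y))" "(\<Sum>n. ennreal (y ^ n)) = ennreal (1 / (1 - y))"
proof -
  have s: "(\<lambda>n. y ^ n) sums (1 / (1 - y))" using assms by (intro geometric_sums) simp
  then have "(\<lambda>n. (c * y) * y ^ n) sums ((c * y) * (1 / (1 - y)))" by (rule sums_mult)
  then have s': "(\<lambda>n. c * y ^ Suc n) sums (c * y / (1 - y))" by (simp add: mult.assoc)
  show "(\<Sum>n. ennreal (c * y ^ Suc n)) = ennreal (c * y / (1 - y))"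
    using s' assms by (subst suminf_ennreal2) (auto simp: sums_iff)
  show "(\<Sum>n. ennreal (y ^ n)) = ennreal (1 / (1 - y))"
    using s assms by (subst suminf_ennreal2) (auto simp: sums_iff)
qed

lemma suminf_ln_ennreal:
  assumes "0 \<le> y" "y < 1" shows "(\<Sum>n. ennreal (1 / real n) * ennreal y ^ n) = ennreal (- ln (1 - y))"
proof -
  have "(\<lambda>n. - ((- (- y)) ^ n) / real n) sums ln (1 + (- y))" using assms by (intro ln_series') simp
  then have "(\<lambda>n. - (- ((- (- y)) ^ n) / real n)) sums (- ln (1 + (- y)))" by (rule sums_minus)
  then have s: "(\<lambda>n. 1 / real n * y ^ n) sums (- ln (1 - y))" by simp
  have "(\<Sum>n. ennreal (1 / real n) * ennreal y ^ n) = (\<Sum>n. ennreal (1 / real n * y ^ n))"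
    using assms by (simp add: ennreal_power ennreal_mult[symmetric])
  also have "\<dots> = ennreal (- ln (1 - y))" using s assms by (subst suminf_ennreal2) (auto simp: sums_iff)
  finally show ?thesis .
qed

text \<open>By the rank-one formula the sum is \<open>- ln (1 - G)\<close> with
  \<open>G = F / (1 - \<rho>)\<close>, where \<open>F\<close> pairs \<open>shot\<close> with the
  eigenvector of eigenvalue \<open>\<rho>\<close>. All geometric ratios stay below
  \<open>Q^6 t^3 = (Q^2 t)^3 < 1\<close>.\<close>

lemma cycsum_M0_value:
  fixes Q t :: real
  assumes Q: "Q \<ge> 1" and t: "t > 0" "Q ^ 2 * t < 1"
  defines "V \<equiv> (1 - Q ^ 6 * t ^ 3) * (1 - Q ^ 3 * t ^ 3) / (1 - Q ^ 4 * t ^ 3) ^ 2"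
  shows "cycsum UNIV (M0 (ennreal Q) (ennreal (Q - 1)) (ennreal t)) = ennreal (- ln V)" "0 < V" "V \<le> 1"
proof -
  define q r x where "q = ennreal Q" "r = ennreal (Q - 1)" "x = ennreal t"
  have qr: "q = r + 1" using Q by (simp add: q_r_x_def flip: ennreal_1 ennreal_plus)
  define X Y where "X = Q ^ 4 * t ^ 3" "Y = Q ^ 3 * t ^ 3"
  have XY: "X = Q * Y" by (simp add: X_Y_def power3_eq_cube power4_eq_xxxx)
  have Y6: "Q ^ 6 * t ^ 3 = (Q ^ 2 * t) ^ 3" by (simp add: power_mult_distrib flip: power_mult)
  have "(Q ^ 2 * t) ^ 3 < 1" using t Q by (intro power_less_one_iff[THEN iffD2]) auto
  then have b6: "Q ^ 3 * Y < 1" using Y6 by (simp add: X_Y_def flip: power_add)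
  have Y0: "Y > 0" using t Q by (simp add: X_Y_def)
  have b4: "X < 1" unfolding XY
  proof (rule le_less_trans[OF _ b6])
    show "Q * Y \<le> Q ^ 3 * Y" using Q Y0 by (intro mult_right_mono) (auto simp: power_increasing[of 1 3 Q, simplified])
  qed
  have b3: "Y < 1" using b4 Q Y0 unfolding XY by (metis less_le_trans mult_le_cancel_right1 not_le order.asym)
  have X0: "X > 0" using XY Y0 Q by simp
  define \<rho> where "\<rho> = (Q - 1) * Y / (1 - Y)"
  \<comment> \<open>\<open>\<rho> < 1\<close> amounts to \<open>Q * Y < 1\<close>.\<close>
  have \<rho>: "0 \<le> \<rho>" "\<rho> < 1" using Q Y0 b3 b4 by (auto simp: \<rho>_def XY field_simps)
  have rho: "(\<Sum>n. r * (q ^ 3 * x ^ 3) ^ Suc n) = ennreal \<rho>"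
  proof -
    have "r * (q ^ 3 * x ^ 3) ^ Suc n = ennreal ((Q - 1) * Y ^ Suc n)" for n
      using Q t Y0 by (simp add: q_r_x_def X_Y_def ennreal_power ennreal_mult[symmetric] del: power_Suc)
    then have "(\<Sum>n. r * (q ^ 3 * x ^ 3) ^ Suc n) = (\<Sum>n. ennreal ((Q - 1) * Y ^ Suc n))" by (rule suminf_cong)
    also have "\<dots> = ennreal \<rho>" unfolding \<rho>_def by (rule suminf_geometric_ennreal(1)) (use Q Y0 b3 in auto)
    finally show ?thesis .
  qed
  have hit: "esum (\<lambda>D. hit' q r x D e * (q ^ 2 * x) ^ D) = ennreal ((Q ^ 4 * t ^ 2) ^ e - (Q ^ 3 * t ^ 2) ^ e)" for e
  proof -
    let ?b = "esum (\<lambda>D. hit' q r x D e * (q ^ 2 * x) ^ D)"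
    have "?b + ennreal ((Q ^ 3 * t ^ 2) ^ e) = ennreal ((Q ^ 4 * t ^ 2) ^ e)"
      using sum_hit'[OF qr, of x e] Q t by (simp add: q_r_x_def ennreal_power ennreal_mult[symmetric])
    then have "?b = ennreal ((Q ^ 4 * t ^ 2) ^ e) - ennreal ((Q ^ 3 * t ^ 2) ^ e)"
      by (metis ennreal_add_diff_cancel_right ennreal_neq_top)
    then show ?thesis using Q t by (simp add: ennreal_minus)
  qed
  \<comment> \<open>\<open>Q * (Q - 1)\<close> and \<open>Q - 1\<close> belong to the jumps in
    \<open>shot\<close> with and without an immediate reset; the subtracted series is the part
    without any reset, from \<open>sum_hit'\<close>.\<close>
  define F where "F = (Q * (Q - 1) + (Q - 1)) * X / (1 - X) - (Q - 1) * Y / (1 - Y)"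
  have YX: "Y \<le> X" using XY Q Y0 by simp
  have sshot: "esum (\<lambda>D. shot q r x D * (q ^ 2 * x) ^ D) = ennreal F"
  proof -
    have le: "Y ^ Suc e \<le> X ^ Suc e" for e using YX Y0 by (intro power_mono) auto
    have "x ^ Suc e * (q * r * (q ^ 4 * x ^ 2) ^ Suc e + r * ennreal ((Q ^ 4 * t ^ 2) ^ Suc e - (Q ^ 3 * t ^ 2) ^ Suc e)) =
        ennreal ((Q * (Q - 1) + (Q - 1)) * X ^ Suc e - (Q - 1) * Y ^ Suc e)" for e
    proof -
      have m: "(Q ^ 3 * t ^ 2) ^ Suc e \<le> (Q ^ 4 * t ^ 2) ^ Suc e"
        using Q t by (intro power_mono mult_right_mono power_increasing) auto
      have "x ^ Suc e * (q * r * (q ^ 4 * x ^ 2) ^ Suc e + r * ennreal ((Q ^ 4 * t ^ 2) ^ Suc e - (Q ^ 3 * t ^ 2) ^ Suc e)) =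
        ennreal (t ^ Suc e * (Q * (Q - 1) * (Q ^ 4 * t ^ 2) ^ Suc e + (Q - 1) * ((Q ^ 4 * t ^ 2) ^ Suc e - (Q ^ 3 * t ^ 2) ^ Suc e)))"
        using Q t m by (simp add: q_r_x_def ennreal_power ennreal_mult[symmetric] ennreal_plus[symmetric] del: power_Suc ennreal_plus)
      moreover have "X ^ Suc e = t ^ Suc e * (Q ^ 4 * t ^ 2) ^ Suc e" "Y ^ Suc e = t ^ Suc e * (Q ^ 3 * t ^ 2) ^ Suc e"
        unfolding X_Y_def power_mult_distrib[symmetric] by (simp_all add: power2_eq_square power3_eq_cube mult_ac)
      ultimately show ?thesis by (simp only: algebra_simps)
    qed
    then have "esum (\<lambda>D. shot q r x D * (q ^ 2 * x) ^ D) = (\<Sum>e. ennreal ((Q * (Q - 1) + (Q - 1)) * X ^ Suc e - (Q - 1) * Y ^ Suc e))"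
      unfolding sum_shot[OF qr] hit by (simp only: nn_integral_count_space_nat)
    also have "\<dots> = ennreal F"
    proof -
      have "(\<lambda>n. X ^ n) sums (1 / (1 - X))" "(\<lambda>n. Y ^ n) sums (1 / (1 - Y))"
        using X0 Y0 b3 b4 by (auto intro!: geometric_sums)
      then have "(\<lambda>n. ((Q * (Q - 1) + (Q - 1)) * X) * X ^ n - ((Q - 1) * Y) * Y ^ n) sums
        (((Q * (Q - 1) + (Q - 1)) * X) * (1 / (1 - X)) - ((Q - 1) * Y) * (1 / (1 - Y)))"
        by (intro sums_diff sums_mult)
      then have s: "(\<lambda>n. (Q * (Q - 1) + (Q - 1)) * X ^ Suc n - (Q - 1) * Y ^ Suc n) sums F"
        unfolding F_def by (simp add: mult.assoc)
      have "0 \<le> (Q * (Q - 1) + (Q - 1)) * X ^ Suc n - (Q - 1) * Y ^ Suc n" for n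
      proof -
        have "(Q - 1) * Y ^ Suc n \<le> (Q * (Q - 1) + (Q - 1)) * X ^ Suc n"
          using le[of n] Q Y0 by (intro mult_mono) auto
        then show ?thesis by simp
      qed
      then show ?thesis using s by (subst suminf_ennreal2) (auto simp: sums_iff)
    qed
    finally show ?thesis .
  qed
  have F0: "F \<ge> 0"
  proof -
    have "(Q - 1) * Y / (1 - Y) \<le> (Q * (Q - 1) + (Q - 1)) * X / (1 - X)"
      using Q Y0 YX b4 by (intro frac_le mult_mono) auto
    then show ?thesis by (simp add: F_def)
  qed
  define G where "G = F * (1 / (1 - \<rho>))"
  have "1 - \<rho> = (1 - Q * Y) / (1 - Y)" using b3 by (simp add: \<rho>_def field_simps)
  then have "G = F * ((1 - Y) / (1 - Q * Y))" by (simp add: G_def)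
  then have G1: "1 - G = (1 - Q ^ 3 * Y) * (1 - Y) / (1 - Q * Y) ^ 2"
    using b3 b4 unfolding F_def XY by (simp add: divide_simps) algebra
  have "(1 - Q ^ 3 * Y) * (1 - Y) / (1 - Q * Y) ^ 2 > 0" using b6 b3 b4 XY by (intro divide_pos_pos mult_pos_pos) auto
  then have Glt: "G < 1" using G1 by linarith
  have G0: "G \<ge> 0" using F0 \<rho> by (simp add: G_def)
  have "(\<Sum>n. ennreal \<rho> ^ n) = (\<Sum>n. ennreal (\<rho> ^ n))"
    by (rule suminf_cong) (rule ennreal_power[OF \<rho>(1)])
  also have "\<dots> = ennreal (1 / (1 - \<rho>))"
    by (rule suminf_geometric_ennreal(2)[of 1]) (use \<rho> in auto)
  finally have geo: "(\<Sum>n. ennreal \<rho> ^ n) = ennreal (1 / (1 - \<rho>))" .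
  have fg: "ennreal F * ennreal (1 / (1 - \<rho>)) = ennreal G"
    unfolding G_def by (rule ennreal_mult[symmetric]) (use F0 \<rho> in auto)
  have "cycsum UNIV (M0 q r x) = (\<Sum>n. ennreal (1 / real n) * ennreal G ^ n)"
    unfolding cycsum_M0_M2[OF qr] cycsum_M2[OF qr] sshot rho geo fg by (rule refl)
  also have "\<dots> = ennreal (- ln (1 - G))" using G0 Glt by (rule suminf_ln_ennreal)
  finally have *: "cycsum UNIV (M0 q r x) = ennreal (- ln (1 - G))" .
  have V: "1 - G = V"
    unfolding G1 XY[symmetric] V_def unfolding X_Y_def by (simp add: mult.assoc[symmetric] power_add[symmetric])
  show "cycsum UNIV (M0 (ennreal Q) (ennreal (Q - 1)) (ennreal t)) = ennreal (- ln V)"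
    using * unfolding q_r_x_def V .
  show "0 < V" "V \<le> 1" using Glt G0 V by linarith+
qed


section \<open>The zeta function\<close>

lemma sum_strata:
  "(\<Sum>c\<in>(UNIV :: ('a::finite_field \<times> 'a) set). if fst c \<noteq> 0 then \<alpha> else if snd c \<noteq> 0 then \<beta> else \<gamma>) =
     CARD('a) * (CARD('a) - 1) * \<alpha> + (CARD('a) - 1) * \<beta> + (\<gamma> :: nat)"
proof -
  have s: "(\<Sum>d\<in>(UNIV :: 'a set). if d \<noteq> 0 then f else g) = (CARD('a) - 1) * f + (g :: nat)" for f g
    by (subst sum.remove[of UNIV 0]) (auto simp: card_Diff_singleton)
  have "(\<Sum>c\<in>(UNIV :: ('a \<times> 'a) set). if fst c \<noteq> 0 then \<alpha> else if snd c \<noteq> 0 then \<beta> else \<gamma>) =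
      (\<Sum>c\<in>(UNIV :: 'a set). \<Sum>d\<in>(UNIV :: 'a set). if c \<noteq> 0 then \<alpha> else if d \<noteq> 0 then \<beta> else \<gamma>)"
    unfolding UNIV_Times_UNIV[symmetric] by (simp add: sum.cartesian_product case_prod_beta)
  also have "\<dots> = (\<Sum>c\<in>(UNIV :: 'a set). if c \<noteq> 0 then CARD('a) * \<alpha> else (CARD('a) - 1) * \<beta> + \<gamma>)"
    by (rule sum.cong) (auto simp: s)
  also have "\<dots> = (CARD('a) - 1) * (CARD('a) * \<alpha>) + ((CARD('a) - 1) * \<beta> + \<gamma>)" by (rule s)
  finally show ?thesis by (simp add: mult_ac)
qed

text \<open>\<open>nxt\<close> is constant on the strata \<open>c \<noteq> 0\<close>, then
  \<open>c = 0\<close> with \<open>d \<noteq> 0\<close>, then \<open>(0, 0)\<close>, of sizes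
  \<open>q (q - 1)\<close>, \<open>q - 1\<close> and 1; strata merge when the relevant exponent is
  positive.\<close>

lemma card_nxt:
  assumes "a \<le> b"
  shows "card {c :: 'a::finite_field \<times> 'a. nxt (a, b) c = v'} =
     (if a \<ge> 1 then CARD('a) ^ 2 * of_bool (v' = (a - 1, b - 1))
      else if b \<ge> 1 then CARD('a) * (CARD('a) - 1) * of_bool (v' = (1 - a, b - a)) + CARD('a) * of_bool (v' = (a - 1, b - 1))
      else CARD('a) * (CARD('a) - 1) * of_bool (v' = (b - a, 1 - a)) + (CARD('a) - 1) * of_bool (v' = (a - b, 1 - b)) + of_bool (v' = (a - 1, b - 1)))"
proof -
  define \<gamma> where "\<gamma> = (of_bool (v' = (a - 1, b - 1)) :: nat)"
  define \<beta> where "\<beta> = (if b \<le> 0 then of_bool (v' = (a - b, 1 - b)) else \<gamma>)"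
  define \<alpha> where "\<alpha> = (if a \<le> 0 then of_bool (v' = (min (1 - a) (b - a), max (1 - a) (b - a))) else \<gamma>)"
  have nxt: "of_bool (nxt (a, b) c = v') = (if fst c \<noteq> 0 then \<alpha> else if snd c \<noteq> 0 then \<beta> else \<gamma>)" for c :: "'a \<times> 'a"
  proof -
    obtain c1 c2 where c: "c = (c1, c2)" by (cases c)
    have e: "(w = v') = (v' = w)" for w by (rule eq_commute)
    show ?thesis
      unfolding c nxt.simps fst_conv snd_conv \<alpha>_def \<beta>_def \<gamma>_def e
      using assms by (cases "a \<le> 0"; cases "b \<le> 0"; cases "c1 = 0"; cases "c2 = 0") simp_all
  qed
  have "card {c :: 'a \<times> 'a. nxt (a, b) c = v'} = (\<Sum>c\<in>(UNIV :: ('a \<times> 'a) set). of_bool (nxt (a, b) c = v'))"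
    by (simp add: of_bool_def sum.If_cases)
  also have "\<dots> = CARD('a) * (CARD('a) - 1) * \<alpha> + (CARD('a) - 1) * \<beta> + \<gamma>" unfolding nxt by (rule sum_strata)
  finally have c: "card {c :: 'a \<times> 'a. nxt (a, b) c = v'} = CARD('a) * (CARD('a) - 1) * \<alpha> + (CARD('a) - 1) * \<beta> + \<gamma>" .
  obtain n where n: "CARD('a) = Suc n" by (metis card_field_gt_1 less_imp_Suc_add)
  consider "a \<ge> 1" | "a \<le> 0" "b \<ge> 1" | "a \<le> 0" "b \<le> 0" by linarith
  then show ?thesis
  proof cases
    case 1
    then have "\<alpha> = \<gamma>" "\<beta> = \<gamma>" using assms by (simp_all add: \<alpha>_def \<beta>_def)
    then show ?thesis unfolding c n using 1 by (simp add: \<gamma>_def power2_eq_square)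
  next
    case 2
    then have "\<alpha> = of_bool (v' = (1 - a, b - a))" "\<beta> = \<gamma>" by (simp_all add: \<alpha>_def \<beta>_def min_def max_def)
    then show ?thesis unfolding c n using 2 by (simp add: \<gamma>_def)
  next
    case 3
    then have "min (1 - a) (b - a) = b - a" "max (1 - a) (b - a) = 1 - a" by simp_all
    then have "\<alpha> = of_bool (v' = (b - a, 1 - a))" "\<beta> = of_bool (v' = (a - b, 1 - b))"
      unfolding \<alpha>_def \<beta>_def using 3 by simp_all
    then show ?thesis unfolding c n using 3 by (simp add: \<gamma>_def)
  qed
qed

lemma M0_card:
  assumes "v \<in> sorted_pairs"
  shows "of_nat (card {c :: 'a::finite_field \<times> 'a. nxt v c = v'}) * x = M0 (of_nat CARD('a)) (of_nat (CARD('a) - 1)) x v v'"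
proof -
  obtain a b where v: "v = (a, b)" by (cases v)
  have ab: "a \<le> b" using assms by (simp add: v sorted_pairs_def)
  obtain n where n: "CARD('a) = Suc n" by (metis card_field_gt_1 less_imp_Suc_add)
  have q: "(of_nat CARD('a) :: ennreal) = of_nat (CARD('a) - 1) + 1" unfolding n by (simp add: add.commute)
  show ?thesis unfolding v card_nxt[OF ab] M0_def[OF q] using ab
    by (simp add: mult.commute)
qed

lemma cycsum_edges:
  assumes k: "k \<in> {1, 2}"
  shows "cycsum (edge_orbits (PGL3_poly :: ('a::finite_field fls ^ 3 ^ 3) set set) k) (\<lambda>e e'. of_nat (edge_weight k e e') * x) =
    cycsum UNIV (M0 (of_nat CARD('a)) (of_nat (CARD('a) - 1)) x)"
proof -
  let ?M = "M0 (of_nat CARD('a)) (of_nat (CARD('a) - 1)) x"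
  obtain n where n: "CARD('a) = Suc n" by (metis card_field_gt_1 less_imp_Suc_add)
  have q: "(of_nat CARD('a) :: ennreal) = of_nat (CARD('a) - 1) + 1" unfolding n by (simp add: add.commute)
  have "cycsum (edge_orbits (PGL3_poly :: ('a fls ^ 3 ^ 3) set set) k) (\<lambda>e e'. of_nat (edge_weight k e e') * x) = cycsum sorted_pairs ?M"
  proof (cases "k = 1")
    case True
    show ?thesis unfolding True edge_orbits_1
      by (rule cycsum_reindex[of std_orbit]) (simp_all add: bij_betw_def inj_std_orbit edge_weight_1 M0_card del: One_nat_def)
  next
    case False
    then have "k = 2" using k by simp
    show ?thesis unfolding \<open>k = 2\<close> edge_orbits_2
      by (rule cycsum_reindex[of std_orbit2]) (simp_all add: bij_betw_def inj_std_orbit2 edge_weight_2 M0_card)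
  qed
  \<comment> \<open>Unsorted pairs are inert: the factor \<open>of_bool (a \<le> b)\<close> kills
    their outgoing weight.\<close>
  also have "\<dots> = cycsum UNIV ?M"
  proof (rule cycsum_support[symmetric])
    fix v v' assume M: "?M v v' \<noteq> 0"
    obtain a b where v: "v = (a, b)" by (cases v)
    have "a \<le> b"
    proof (rule ccontr)
      assume "\<not> a \<le> b"
      then have "?M v v' = 0" unfolding v M0_def[OF q] by simp
      then show False using M by simp
    qed
    then show "v \<in> sorted_pairs" by (simp add: v sorted_pairs_def)
  qed simp
  finally show ?thesis .
qed

text \<open>Words of weight 0 may be added freely, so only the restriction on the letters survives;
  the empty word counts 0 on the right because \<open>1 / 0 = 0\<close>.\<close>

lemma cycsum_closed_paths:
  assumes "t \<ge> 0"
  shows "(\<integral>\<^sup>+p. ennreal (real (path_weight k p) * t ^ length p / real (length p)) \<partial>count_space (closed_paths \<Gamma> k)) =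
    cycsum (edge_orbits \<Gamma> k) (\<lambda>e e'. of_nat (edge_weight k e e') * ennreal t)"
proof -
  have e: "ennreal (real (path_weight k p) * t ^ length p / real (length p)) * indicator (closed_paths \<Gamma> k) p =
    of_bool (set p \<subseteq> edge_orbits \<Gamma> k) * (ennreal (1 / real (length p)) * cyc (\<lambda>e e'. of_nat (edge_weight k e e') * ennreal t) p)" for p
  proof -
    have c: "cyc (\<lambda>e e'. of_nat (edge_weight k e e') * ennreal t) p = of_nat (path_weight k p) * ennreal t ^ length p"
      by (simp add: cyc_def path_weight_def prod.distrib)
    have "ennreal (1 / real (length p)) * (of_nat (path_weight k p) * ennreal t ^ length p) =
      ennreal (real (path_weight k p) * t ^ length p / real (length p))"
      using assms by (simp add: ennreal_of_nat_eq_real_of_nat ennreal_power ennreal_mult[symmetric])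
    then show ?thesis unfolding c
      by (cases "p = [] \<or> path_weight k p = 0") (auto simp: closed_paths_iff)
  qed
  show ?thesis unfolding cycsum_def e[symmetric] by (simp add: nn_integral_count_space_indicator)
qed

text \<open>The way back from \<open>[0, \<infinity>]\<close>: finiteness of the integral is itself
  the proof of summability.\<close>

lemma infsum_ennreal:
  fixes f :: "'b \<Rightarrow> real"
  assumes f: "\<And>p. p \<in> A \<Longrightarrow> f p \<ge> 0" and i: "(\<integral>\<^sup>+p. ennreal (f p) \<partial>count_space A) = ennreal c" and c: "c \<ge> 0"
  shows "f summable_on A" "infsum f A = c"
proof -
  have int: "integrable (count_space A) f" by (rule integrableI_nonneg) (use f i in \<open>auto simp: AE_count_space\<close>)
  then have a: "Infinite_Set_Sum.abs_summable_on f A" by (simp add: Infinite_Set_Sum.abs_summable_on_def)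
  then show "f summable_on A" using abs_summable_equivalent abs_summable_summable by blast
  have "ennreal (integral\<^sup>L (count_space A) f) = ennreal c"
    using nn_integral_eq_integral[OF int] f i by (simp add: AE_count_space)
  moreover have "integral\<^sup>L (count_space A) f \<ge> 0" by (rule integral_nonneg_AE) (use f in \<open>auto simp: AE_count_space\<close>)
  ultimately have "integral\<^sup>L (count_space A) f = c" using c by simp
  then show "infsum f A = c" using infsetsum_infsum[OF a] by (simp add: infsetsum_def)
qed

text \<open>At \<open>z = u ^ k\<close> the factor of the zeta function that belongs to type
  \<open>k\<close>; it is \<open>1 / V\<close> for the \<open>V\<close> of
  \<open>cycsum_M0_value\<close>.\<close>

definition zval :: "'b::field \<Rightarrow> 'b \<Rightarrow> 'b" where
  "zval Q z = (1 - Q ^ 4 * z ^ 3) ^ 2 / ((1 - Q ^ 3 * z ^ 3) * (1 - Q ^ 6 * z ^ 3))"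

lemma real_path_sum:
  fixes t :: real
  assumes k: "k \<in> {1, 2}" and t: "t > 0" "real CARD('a::finite_field) ^ 2 * t < 1"
  defines "C \<equiv> closed_paths (PGL3_poly :: ('a fls ^ 3 ^ 3) set set) k"
  shows "(\<lambda>p. real (path_weight k p) * t ^ length p / real (length p)) summable_on C"
    "exp (\<Sum>\<^sub>\<infinity>p\<in>C. real (path_weight k p) * t ^ length p / real (length p)) = zval (real CARD('a)) t"
proof -
  define Q where "Q = real CARD('a)"
  have Q1: "Q \<ge> 1" using card_field_gt_1[where 'a = 'a] by (simp add: Q_def)
  define V where "V = (1 - Q ^ 6 * t ^ 3) * (1 - Q ^ 3 * t ^ 3) / (1 - Q ^ 4 * t ^ 3) ^ 2"
  have V: "cycsum UNIV (M0 (ennreal Q) (ennreal (Q - 1)) (ennreal t)) = ennreal (- ln V)" "0 < V" "V \<le> 1"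
    unfolding V_def by (rule cycsum_M0_value; use Q1 t in \<open>simp add: Q_def\<close>)+
  then have L0: "- ln V \<ge> 0" by simp
  have qr: "of_nat CARD('a) = ennreal Q" "of_nat (CARD('a) - 1) = ennreal (Q - 1)"
    using card_field_gt_1[where 'a = 'a] by (simp_all add: Q_def ennreal_of_nat_eq_real_of_nat of_nat_diff)
  have i: "(\<integral>\<^sup>+p. ennreal (real (path_weight k p) * t ^ length p / real (length p)) \<partial>count_space C) = ennreal (- ln V)"
    unfolding C_def cycsum_closed_paths[OF less_imp_le[OF t(1)]] cycsum_edges[OF k] qr by (rule V(1))
  have nn: "real (path_weight k p) * t ^ length p / real (length p) \<ge> 0" for p :: "'a edge set list"
    using t by simp
  show "(\<lambda>p. real (path_weight k p) * t ^ length p / real (length p)) summable_on C"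
    by (rule infsum_ennreal(1)[OF nn i L0])
  have "exp (\<Sum>\<^sub>\<infinity>p\<in>C. real (path_weight k p) * t ^ length p / real (length p)) = exp (- ln V)"
    by (simp only: infsum_ennreal(2)[OF nn i L0])
  also have "\<dots> = zval Q t" using V(2) by (simp add: exp_minus V_def zval_def mult.commute)
  finally show "exp (\<Sum>\<^sub>\<infinity>p\<in>C. real (path_weight k p) * t ^ length p / real (length p)) = zval (real CARD('a)) t"
    unfolding Q_def .
qed

text \<open>Nonnegative coefficients make the terms at the radius dominate those on the disc, so the
  finite sums converge uniformly by the Weierstrass test.\<close>

lemma holomorphic_path_sum:
  fixes w :: "'b \<Rightarrow> real"
  assumes w: "\<And>p. p \<in> C \<Longrightarrow> w p \<ge> 0" and s: "(\<lambda>p. w p * r ^ n p) summable_on C"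
  shows "(\<lambda>z :: complex. \<Sum>\<^sub>\<infinity>p\<in>C. of_real (w p) * z ^ n p) holomorphic_on ball 0 r"
proof -
  have u: "uniform_limit (cball 0 r) (\<lambda>X z :: complex. \<Sum>p\<in>X. of_real (w p) * z ^ n p) (\<lambda>z. \<Sum>\<^sub>\<infinity>p\<in>C. of_real (w p) * z ^ n p)
      (finite_subsets_at_top C)"
  proof (rule Weierstrass_m_test_general[OF _ s])
    fix p and z :: complex assume pz: "p \<in> C" "z \<in> cball 0 r"
    then have "norm z ^ n p \<le> r ^ n p" by (intro power_mono) auto
    then show "norm (of_real (w p) * z ^ n p) \<le> w p * r ^ n p"
      using w[OF pz(1)] by (simp add: norm_mult norm_power mult_left_mono)
  qed
  show ?thesis
  proof (rule holomorphic_uniform_limit[OF _ u])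
    show "\<forall>\<^sub>F X in finite_subsets_at_top C. continuous_on (cball 0 r) (\<lambda>z :: complex. \<Sum>p\<in>X. of_real (w p) * z ^ n p) \<and>
        (\<lambda>z. \<Sum>p\<in>X. of_real (w p) * z ^ n p) holomorphic_on ball 0 r"
      by (intro always_eventually allI conjI continuous_intros holomorphic_intros)
  qed auto
qed

text \<open>Both sides are holomorphic on a disc that contains \<open>z\<close> and agree on its
  positive real points, which accumulate at 0.\<close>

lemma complex_path_sum:
  fixes z :: complex
  assumes k: "k \<in> {1, 2}" and z: "real CARD('a::finite_field) ^ 2 * norm z < 1"
  defines "C \<equiv> closed_paths (PGL3_poly :: ('a fls ^ 3 ^ 3) set set) k"
  shows "exp (\<Sum>\<^sub>\<infinity>p\<in>C. of_nat (path_weight k p) * z ^ length p / of_nat (length p)) = zval (of_nat CARD('a)) z"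
proof -
  define Q where "Q = real CARD('a)"
  have Q1: "Q \<ge> 1" using card_field_gt_1[where 'a = 'a] by (simp add: Q_def)
  have "norm z < 1 / Q ^ 2" using z Q1 by (simp add: Q_def field_simps)
  then obtain r where r: "norm z < r" "r < 1 / Q ^ 2" using dense by blast
  have r0: "r > 0" using r(1) norm_ge_zero[of z] by linarith
  have small: "Q ^ 2 * t < 1" if "t \<le> r" for t
  proof -
    have "Q ^ 2 * t \<le> Q ^ 2 * r" using that by (intro mult_left_mono) auto
    moreover have "Q ^ 2 * r < 1" using r(2) Q1 by (simp add: field_simps)
    ultimately show ?thesis by linarith
  qed
  define w where "w p = real (path_weight k p) / real (length p)" for p :: "'a edge set list"
  define S where "S z = (\<Sum>\<^sub>\<infinity>p\<in>C. of_real (w p) * z ^ length p)" for z :: complex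
  have S: "(\<Sum>\<^sub>\<infinity>p\<in>C. of_nat (path_weight k p) * z ^ length p / of_nat (length p)) = S z" for z :: complex
    by (simp add: S_def w_def)
  have "(\<lambda>p. w p * r ^ length p) summable_on C"
    using real_path_sum(1)[OF k r0, where 'a = 'a] small[of r] unfolding C_def w_def Q_def by simp
  then have hS: "S holomorphic_on ball 0 r" unfolding S_def by (intro holomorphic_path_sum) (auto simp: w_def)
  \<comment> \<open>The worst case is \<open>m = 6\<close>, where the norm is the cube of
    \<open>Q ^ 2 * norm x\<close>.\<close>
  have nz: "1 - of_real Q ^ m * x ^ 3 \<noteq> 0" if "m \<le> 6" "x \<in> ball 0 r" for m and x :: complex
  proof
    assume "1 - of_real Q ^ m * x ^ 3 = 0"
    then have "norm (of_real Q ^ m * x ^ 3) = 1" by simp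
    then have "Q ^ m * norm x ^ 3 = 1" using Q1 by (simp add: norm_mult norm_power)
    moreover have "Q ^ m * norm x ^ 3 \<le> Q ^ 6 * norm x ^ 3"
      using that(1) Q1 by (intro mult_right_mono power_increasing) auto
    moreover have "Q ^ 6 * norm x ^ 3 = (Q ^ 2 * norm x) ^ 3" by (simp add: power_mult_distrib flip: power_mult)
    moreover have "(Q ^ 2 * norm x) ^ 3 < 1" using small[of "norm x"] that(2) Q1 by (intro power_less_one_iff[THEN iffD2]) auto
    ultimately show False by linarith
  qed
  have "exp (S z) - zval (of_real Q) z = 0"
  proof (rule analytic_continuation[of "\<lambda>z. exp (S z) - zval (of_real Q) z" "ball 0 r" "of_real ` {0<..<r}" 0])
    show "(\<lambda>z. exp (S z) - zval (of_real Q) z) holomorphic_on ball 0 r"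
      unfolding zval_def using nz hS by (intro holomorphic_intros) auto
    show "of_real ` {0<..<r} \<subseteq> ball (0 :: complex) r" by auto
    show "(0 :: complex) islimpt of_real ` {0<..<r}"
    proof (subst islimpt_approachable, intro allI impI)
      fix e :: real assume "e > 0"
      then show "\<exists>x'\<in>of_real ` {0<..<r}. x' \<noteq> (0 :: complex) \<and> dist x' 0 < e"
        using r0 by (intro bexI[of _ "of_real (min e r / 2)"] imageI) (auto simp: dist_norm simp del: of_real_divide)
    qed
    fix x :: complex assume "x \<in> of_real ` {0<..<r}"
    then obtain t where t: "x = of_real t" "0 < t" "t < r" by auto
    have "(\<lambda>p. w p * t ^ length p) summable_on C"
      using real_path_sum(1)[OF k t(2), where 'a = 'a] small[of t] t(3) unfolding C_def w_def Q_def by simp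
    then have "S x = of_real (\<Sum>\<^sub>\<infinity>p\<in>C. w p * t ^ length p)"
      unfolding S_def t(1) of_real_power[symmetric] of_real_mult[symmetric]
      by (intro infsumI has_sum_of_real has_sum_infsum)
    moreover have "exp (\<Sum>\<^sub>\<infinity>p\<in>C. w p * t ^ length p) = zval Q t"
      using real_path_sum(2)[OF k t(2), where 'a = 'a] small[of t] t(3) unfolding C_def w_def Q_def by simp
    ultimately have "exp (S x) = of_real (zval Q t)" by (simp add: exp_of_real)
    then show "exp (S x) - zval (of_real Q) x = 0" by (simp add: zval_def t(1))
  qed (use r r0 in auto)
  then show ?thesis unfolding S by (simp add: Q_def)
qed

text \<open>The type \<open>k\<close> enters only through the variable \<open>u ^ k\<close>. Its
  norm is positive, as \<open>real_path_sum\<close> asks, and the value is nonzero because it is an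
  exponential.\<close>

lemma euler_product_value:
  fixes u :: complex
  assumes k: "k \<in> {1, 2}" and u: "u \<noteq> 0" "real CARD('a::finite_field) ^ 2 * norm (u ^ k) < 1"
  shows "has_product (euler_factor k u) (prime_cycles (PGL3_poly :: ('a fls ^ 3 ^ 3) set set) k) (zval (of_nat CARD('a)) (u ^ k))"
    "zval (of_nat CARD('a)) (u ^ k) \<noteq> 0"
proof -
  have n: "norm (u ^ k) > 0" using u(1) by simp
  have "has_product (\<lambda>c. 1 / (1 - of_nat (cycle_weight k c) * (u ^ k) ^ cycle_length c)) (prime_cycles (PGL3_poly :: ('a fls ^ 3 ^ 3) set set) k)
    (exp (\<Sum>\<^sub>\<infinity>p\<in>closed_paths (PGL3_poly :: ('a fls ^ 3 ^ 3) set set) k. of_nat (path_weight k p) * (u ^ k) ^ length p / of_nat (length p)))"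
    by (rule euler_product) (rule real_path_sum(1)[OF k n u(2)])
  then show "has_product (euler_factor k u) (prime_cycles (PGL3_poly :: ('a fls ^ 3 ^ 3) set set) k) (zval (of_nat CARD('a)) (u ^ k))"
    unfolding complex_path_sum[OF k u(2)] euler_factor_def by (simp only: power_mult)
  show "zval (of_nat CARD('a)) (u ^ k) \<noteq> 0"
    unfolding complex_path_sum[OF k u(2), symmetric] by simp
qed

theorem theorem1p1:
  fixes s :: complex and \<Gamma> :: "('a::finite_field fls ^ 3 ^ 3) set set" and q :: complex
  defines "\<Gamma> \<equiv> PGL3_poly" and "q \<equiv> of_nat CARD('a)"
  assumes "Re s > 2"
  shows "edge_zeta_converges \<Gamma> (q powr (- s)) \<and>
    edge_zeta \<Gamma> (q powr (- s)) =
      ((1 - q powr (4 - 3 * s))\<^sup>2 * (1 - q powr (4 - 6 * s))\<^sup>2) /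
      ((1 - q powr (3 - 3 * s)) * (1 - q powr (6 - 3 * s)) *
       (1 - q powr (3 - 6 * s)) * (1 - q powr (6 - 6 * s)))"
proof -
  define Q where "Q = real CARD('a)"
  have Q1: "Q > 1" using card_field_gt_1[where 'a = 'a] by (simp add: Q_def)
  have qQ: "q = of_real Q" by (simp add: q_def Q_def)
  have q0: "q \<noteq> 0" using Q1 by (simp add: qQ)
  define u where "u = q powr (- s)"
  have u0: "u \<noteq> 0" using q0 by (simp add: u_def)
  have nu: "norm u = Q powr (- Re s)"
    unfolding u_def qQ using Q1 by (subst norm_powr_real_powr) auto
  \<comment> \<open>Here \<open>Re s > 2\<close> enters: it puts \<open>u\<close> in the disc where
    \<open>Q ^ 2 * norm u < 1\<close>.\<close>
  also have "\<dots> < Q powr (- 2)" using Q1 assms(3) by (intro powr_less_mono) auto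
  also have "\<dots> = 1 / Q ^ 2" using Q1 by (simp add: powr_minus_divide)
  finally have b1: "Q ^ 2 * norm (u ^ 1) < 1" using Q1 by (simp add: field_simps)
  have "norm u < 1"
    using b1 Q1 mult_right_mono[of 1 "Q ^ 2" "norm u"] by (auto simp: one_le_power)
  \<comment> \<open>For type 2 the variable \<open>u ^ 2\<close> is smaller still.\<close>
  then have "norm (u ^ 2) \<le> norm (u ^ 1)" by (simp add: norm_mult power2_eq_square mult_left_le)
  then have "Q ^ 2 * norm (u ^ 2) \<le> Q ^ 2 * norm (u ^ 1)" by (intro mult_left_mono) auto
  then have b2: "Q ^ 2 * norm (u ^ 2) < 1" using b1 by linarith
  have b: "real CARD('a) ^ 2 * norm (u ^ k) < 1" if "k \<in> {1, 2}" for k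
    using that b1 b2 unfolding Q_def by auto
  have hp: "has_product (euler_factor k u) (prime_cycles \<Gamma> k) (zval q (u ^ k))" "zval q (u ^ k) \<noteq> 0" if "k \<in> {1, 2}" for k
    unfolding \<Gamma>_def q_def by (rule euler_product_value[OF that u0 b[OF that]])+
  have k12: "{1..2} = {1, 2 :: nat}" by auto
  have conv: "edge_zeta_converges \<Gamma> u"
    unfolding edge_zeta_converges_def product_converges_def k12 using hp by blast
  have "edge_zeta \<Gamma> u = zval q (u ^ 1) * zval q (u ^ 2)"
    unfolding edge_zeta_def k12 using product_over_eq[OF hp(1)] by simp
  \<comment> \<open>Translates the exponents of the statement into the monomials
    \<open>Q ^ m * z ^ 3\<close> of \<open>zval\<close> at \<open>z = u ^ k\<close>.\<close>
  moreover have pw: "q powr (of_nat m - 3 * of_nat k * s) = q ^ m * (u ^ k) ^ 3" for m k :: nat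
  proof -
    have "q powr (of_nat m - 3 * of_nat k * s) = q powr of_nat m * q powr (of_nat (3 * k) * (- s))"
      by (simp add: powr_add[symmetric])
    also have "\<dots> = q ^ m * u ^ (3 * k)"
    proof -
      have "of_nat (3 * k) * (- s) * Ln q = of_nat (3 * k) * (- s * Ln q)" by simp
      then show ?thesis using q0 by (simp only: powr_def u_def if_False exp_of_nat_mult) (simp only: exp_Ln not_False_eq_True)
    qed
    finally show ?thesis by (simp add: power_mult[symmetric] mult.commute)
  qed
  have "q powr (4 - 3 * s) = q ^ 4 * (u ^ 1) ^ 3" "q powr (3 - 3 * s) = q ^ 3 * (u ^ 1) ^ 3" "q powr (6 - 3 * s) = q ^ 6 * (u ^ 1) ^ 3"
    "q powr (4 - 6 * s) = q ^ 4 * (u ^ 2) ^ 3" "q powr (3 - 6 * s) = q ^ 3 * (u ^ 2) ^ 3" "q powr (6 - 6 * s) = q ^ 6 * (u ^ 2) ^ 3"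
    using pw[of 4 1] pw[of 3 1] pw[of 6 1] pw[of 4 2] pw[of 3 2] pw[of 6 2] by simp_all
  ultimately show ?thesis using conv by (simp only: u_def[symmetric] zval_def) simp
qed

end
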